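(* Let $U\subseteq R_{2,1}$ be a basepoint free four-dimensional subspace. If $I_U$ has a unique linear syzygy, then the codimension one singular locus of $X_U$ is a union of lines.
   Context: $k$ is an algebraically closed field and $R=k[s,t,u,v]$ is bigraded with $s,t$ of degree $(1,0)$ and $u,v$ of degree $(0,1)$; $R_{m,n}$ is the graded piece of bidegree $(m,n)$. $U=\mathrm{Span}\{p_0,p_1,p_2,p_3\}\subseteq R_{2,1}=H^0(\mathcal{O}_{\mathbb{P}^1\times\mathbb{P}^1}(2,1))$ is a four-dimensional subspace and $I_U=\langle p_0,p_1,p_2,p_3\rangle\subset R$. $U$ is basepoint free if the $p_i$ have no common zero on $\mathbb{P}^1\times\mathbb{P}^1$, i.e. $\sqrt{I_U}=\langle s,t\rangle\cap\langle u,v\rangle$. In that case $\phi_U=(p_0:p_1:p_2:p_3):\mathbb{P}^1\times\mathbb{P}^1\to\mathbb{P}^3$ is a regular map, and $X_U=\phi_U(\mathbb{P}^1\times\mathbb{P}^1)\subseteq\mathbb{P}^3$ is its image surface (with reduced structure). The codimension one singular locus of $X_U$ is the union of the one-dimensional irreducible components of the singular locus of $X_U$, taken with reduced structure. A first syzygy of bidegree $(a,b)$ on $I_U$ is a nonzero tuple $(g_0,\dots,g_3)\in R_{a,b}^4$ with $\sum g_ip_i=0$; it is linear if $(a,b)\in\{(1,0),(0,1)\}$. "Unique" means unique up to nonzero scalar (among all linear first syzygies, of both bidegrees). *)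

theory Defs
  imports
    "HOL-Analysis.Cartesian_Space"
    "HOL-Library.Poly_Mapping"
    "HOL-Library.Extended_Nat"
    "HOL-Library.Numeral_Type"
    "HOL-Computational_Algebra.Polynomial"
begin

section \<open>Multivariate polynomials\<close>

text \<open>
  Monomials are exponent vectors \<open>'x \<Rightarrow>\<^sub>0 nat\<close>; the ring structure on polynomials is the convolution
  product of \<^theory>\<open>HOL-Library.Poly_Mapping\<close>.
\<close>

type_synonym ('x, 'k) mpoly = "('x \<Rightarrow>\<^sub>0 nat) \<Rightarrow>\<^sub>0 'k"

definition const_poly :: "'k \<Rightarrow> ('x, 'k::zero) mpoly" where
  "const_poly c = Poly_Mapping.single 0 c"

definition poly_scale :: "'k \<Rightarrow> ('x, 'k::comm_ring_1) mpoly \<Rightarrow> ('x, 'k) mpoly" where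
  "poly_scale c f = const_poly c * f"

global_interpretation mpoly: vector_space "poly_scale :: 'k::field \<Rightarrow> ('x, 'k) mpoly \<Rightarrow> ('x, 'k) mpoly"
  defines mpoly_span = mpoly.span
    and mpoly_dim = mpoly.dim
  by unfold_locales
    (simp_all add: poly_scale_def const_poly_def single_add mult_single
      distrib_left distrib_right flip: mult.assoc)

definition eval_poly :: "('x \<Rightarrow> 'k) \<Rightarrow> ('x, 'k::comm_ring_1) mpoly \<Rightarrow> 'k" where
  "eval_poly x f = (\<Sum>e\<in>Poly_Mapping.keys f. Poly_Mapping.lookup f e *
      (\<Prod>i\<in>Poly_Mapping.keys e. x i ^ Poly_Mapping.lookup e i))"

text \<open>
  If \<open>i\<close> does not occur in the monomial \<open>e\<close>, the truncated difference of exponents is harmless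
  because the coefficient vanishes.
\<close>

definition partial_deriv :: "'x \<Rightarrow> ('x, 'k::comm_ring_1) mpoly \<Rightarrow> ('x, 'k) mpoly" where
  "partial_deriv i f = (\<Sum>e\<in>Poly_Mapping.keys f.
      Poly_Mapping.single (e - Poly_Mapping.single i 1)
        (of_nat (Poly_Mapping.lookup e i) * Poly_Mapping.lookup f e))"

definition homogeneous :: "('x, 'k::zero) mpoly \<Rightarrow> bool" where
  "homogeneous f \<longleftrightarrow>
    (\<exists>d. \<forall>e\<in>Poly_Mapping.keys f. (\<Sum>i\<in>Poly_Mapping.keys e. Poly_Mapping.lookup e i) = d)"


section \<open>Projective space and its Zariski topology\<close>

text \<open>Points are the one-dimensional linear subspaces of \<open>k\<^sup>n\<close>, where \<open>n = CARD('n)\<close>.\<close>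

definition proj_space :: "('k::field ^ 'n) set set" where
  "proj_space = {vec.span {x} | x. x \<noteq> 0}"

definition proj_line :: "('k::field ^ 'n) set set \<Rightarrow> bool" where
  "proj_line L \<longleftrightarrow>
    (\<exists>W. vec.subspace W \<and> vec.dim W = 2 \<and> L = {P \<in> proj_space. P \<subseteq> W})"

definition vanishes_at :: "('n, 'k::field) mpoly \<Rightarrow> ('k ^ 'n) set \<Rightarrow> bool" where
  "vanishes_at f P \<longleftrightarrow> (\<forall>x\<in>P. eval_poly (($) x) f = 0)"

definition proj_closed :: "('k::field ^ 'n) set set \<Rightarrow> bool" where
  "proj_closed Z \<longleftrightarrow>
    (\<exists>F. (\<forall>f\<in>F. homogeneous f) \<and> Z = {P \<in> proj_space. \<forall>f\<in>F. vanishes_at f P})"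

definition irreducible_closed :: "('k::field ^ 'n) set set \<Rightarrow> bool" where
  "irreducible_closed Z \<longleftrightarrow> proj_closed Z \<and> Z \<noteq> {} \<and>
    (\<forall>A B. proj_closed A \<longrightarrow> proj_closed B \<longrightarrow> Z = A \<union> B \<longrightarrow> Z = A \<or> Z = B)"

definition irreducible_component :: "('k::field ^ 'n) set set \<Rightarrow> ('k ^ 'n) set set \<Rightarrow> bool" where
  "irreducible_component Z C \<longleftrightarrow> irreducible_closed C \<and> C \<subseteq> Z \<and>
    (\<forall>D. irreducible_closed D \<longrightarrow> D \<subseteq> Z \<longrightarrow> C \<subseteq> D \<longrightarrow> D = C)"

definition irreducible_chain ::
    "('k::field ^ 'n) set set \<Rightarrow> nat \<Rightarrow> (nat \<Rightarrow> ('k ^ 'n) set set) \<Rightarrow> bool" where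
  "irreducible_chain Z n C \<longleftrightarrow>
    (\<forall>i\<le>n. irreducible_closed (C i) \<and> C i \<subseteq> Z) \<and> (\<forall>i<n. C i \<subset> C (Suc i))"

definition krull_dim :: "('k::field ^ 'n) set set \<Rightarrow> enat" where
  "krull_dim Z = (SUP n\<in>{n. \<exists>C. irreducible_chain Z n C}. enat n)"

text \<open>
  Irreducible closed subsets of \<open>Z\<close> through \<open>P\<close> correspond to primes of the local ring of \<open>Z\<close> at \<open>P\<close>,
  so this is the Krull dimension of that local ring.
\<close>

definition local_dim :: "('k::field ^ 'n) set set \<Rightarrow> ('k ^ 'n) set \<Rightarrow> enat" where
  "local_dim Z P = (SUP n\<in>{n. \<exists>C. irreducible_chain Z n C \<and> P \<in> C 0}. enat n)"


section \<open>Singular locus\<close>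

definition vanishing_forms :: "('k::field ^ 'n) set set \<Rightarrow> ('n, 'k) mpoly set" where
  "vanishing_forms Z = {f. homogeneous f \<and> (\<forall>P\<in>Z. vanishes_at f P)}"

text \<open>
  The tangent space, along the line \<open>P\<close>, of the affine cone over \<open>Z\<close> with its reduced structure.
  The forms vanishing on \<open>Z\<close> generate its homogeneous ideal, so they suffice to cut out the
  tangent space.
  Its dimension is one more than that of the Zariski tangent space of \<open>Z\<close> at \<open>P\<close>.
\<close>

definition cone_tangent_space ::
    "('k::field ^ 'n) set set \<Rightarrow> ('k ^ 'n) set \<Rightarrow> ('k ^ 'n) set" where
  "cone_tangent_space Z P = {w. \<forall>f\<in>vanishing_forms Z. \<forall>x\<in>P.
      (\<Sum>i\<in>UNIV. eval_poly (($) x) (partial_deriv i f) * w $ i) = 0}"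

text \<open>
  The tangent space at \<open>P\<close> always has dimension at least the dimension of the local ring at \<open>P\<close>;
  \<open>P\<close> is regular if equality holds, and singular otherwise.
\<close>

definition singular_locus :: "('k::field ^ 'n) set set \<Rightarrow> ('k ^ 'n) set set" where
  "singular_locus Z = {P \<in> Z. enat (vec.dim (cone_tangent_space Z P)) > local_dim Z P + 1}"

text \<open>
  For a surface \<open>Z\<close>; the reduced structure means that only the point set is recorded.
\<close>

definition codim1_singular_locus :: "('k::field ^ 'n) set set \<Rightarrow> ('k ^ 'n) set set" where
  "codim1_singular_locus Z =
    \<Union>{C. irreducible_component (singular_locus Z) C \<and> krull_dim C = 1}"


section \<open>The bigraded ring \<open>k[s,t,u,v]\<close> and tensor product surfaces\<close>

datatype bivar = Vs | Vt | Vu | Vv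

type_synonym 'k bipoly = "(bivar, 'k) mpoly"

definition bigraded_piece :: "nat \<Rightarrow> nat \<Rightarrow> 'k::zero bipoly set" where
  "bigraded_piece m n = {f. \<forall>e\<in>Poly_Mapping.keys f.
      Poly_Mapping.lookup e Vs + Poly_Mapping.lookup e Vt = m \<and>
      Poly_Mapping.lookup e Vu + Poly_Mapping.lookup e Vv = n}"

definition bieval :: "'k::field ^ 2 \<Rightarrow> 'k ^ 2 \<Rightarrow> 'k bipoly \<Rightarrow> 'k" where
  "bieval a b f =
    eval_poly (\<lambda>x. case x of Vs \<Rightarrow> a $ 1 | Vt \<Rightarrow> a $ 2 | Vu \<Rightarrow> b $ 1 | Vv \<Rightarrow> b $ 2) f"

definition basepoint_free :: "'k::field bipoly set \<Rightarrow> bool" where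
  "basepoint_free U \<longleftrightarrow>
    \<not> (\<exists>A\<in>proj_space. \<exists>B\<in>proj_space. \<forall>f\<in>U. \<forall>a\<in>A. \<forall>b\<in>B. bieval a b f = 0)"

text \<open>
  The values of \<open>(p\<^sub>0, \<dots>, p\<^sub>3)\<close> at the representatives of \<open>(A, B)\<close> are proportional when the \<open>p\<^sub>i\<close> have the same bidegree,
  so they span a point of projective space when they are not all zero.
  The four coordinates are indexed by the type \<open>4\<close>.
\<close>

definition phi :: "(4 \<Rightarrow> 'k::field bipoly) \<Rightarrow> ('k ^ 2) set \<Rightarrow> ('k ^ 2) set \<Rightarrow> ('k ^ 4) set" where
  "phi p A B = vec.span {(\<chi> i. bieval a b (p i)) | a b. a \<in> A \<and> b \<in> B}"

definition image_surface :: "(4 \<Rightarrow> 'k::field bipoly) \<Rightarrow> ('k ^ 4) set set" where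
  "image_surface p = (\<lambda>(A, B). phi p A B) ` (proj_space \<times> proj_space)"

definition first_syzygy ::
    "(4 \<Rightarrow> 'k::field bipoly) \<Rightarrow> nat \<Rightarrow> nat \<Rightarrow> (4 \<Rightarrow> 'k bipoly) \<Rightarrow> bool" where
  "first_syzygy p m n g \<longleftrightarrow>
    (\<forall>i. g i \<in> bigraded_piece m n) \<and> (\<exists>i. g i \<noteq> 0) \<and> (\<Sum>i\<in>UNIV. g i * p i) = 0"

definition linear_syzygy :: "(4 \<Rightarrow> 'k::field bipoly) \<Rightarrow> (4 \<Rightarrow> 'k bipoly) \<Rightarrow> bool" where
  "linear_syzygy p g \<longleftrightarrow> first_syzygy p 1 0 g \<or> first_syzygy p 0 1 g"

definition unique_linear_syzygy :: "(4 \<Rightarrow> 'k::field bipoly) \<Rightarrow> bool" where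
  "unique_linear_syzygy p \<longleftrightarrow>
    (\<exists>g. linear_syzygy p g \<and>
      (\<forall>h. linear_syzygy p h \<longrightarrow> (\<exists>c. c \<noteq> 0 \<and> (\<forall>i. h i = poly_scale c (g i)))))"

end

theory Submission
  imports Defs "HOL-Analysis.Determinants"
begin

text \<open>
  A linear syzygy of bidegree (1,0) means that, after a change of coordinates on \<open>P\<^sup>3\<close>, two of the
  \<open>p\<^sub>i\<close> are \<open>s q\<close> and \<open>t q\<close>. Off the base line, where these two coordinates vanish, \<open>(s : t)\<close> is
  determined by the image point, and the surface is a smooth family of lines over \<open>P\<^sup>1\<close>.
  For bidegree (0,1), two of the \<open>p\<^sub>i\<close> are \<open>u q\<close> and \<open>v q\<close>, and off the base line the surface is a family of
  conics over the \<open>(u : v)\<close>-line. It is smooth where the conic is, i.e. where a binary quadratic form \<open>\<Delta>\<close>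
  does not vanish. Over a zero of \<open>\<Delta>\<close> the conic degenerates to a line covered twice, and if \<open>\<Delta>\<close> vanished identically,
  the adjugate matrix would give a second linear syzygy.

  So the singular locus lies in finitely many lines. In both cases an explicit quartic form (a
  \<open>3 \<times> 3\<close> determinant or a resultant of two quadratic forms) cuts out the surface and has nonzero gradient
  at the other points. These arguments work in every characteristic. An irreducible component of dimension one
  is infinite, so it meets one of the lines in infinitely many points and is equal to it.
\<close>

section \<open>Evaluation of polynomials\<close>

text \<open>Regularity compares the dimension of a tangent space with that of a local ring, and each
  is bounded from one side only. A single form that vanishes on the surface and has a nonzero
  derivative at the point bounds the cone tangent space by 3, so the ideal of the surface is never
  computed. The chain point, ruling line, surface bounds the local dimension below by 2. This chain
  asks for a closed and irreducible image. Closedness comes without elimination theory: every zero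
  of the quartic gets a preimage, also on the base line, where a binary form in \<open>s, t\<close>
  is solved before a linear system in \<open>u, v\<close>. Irreducibility comes from the ruling by
  lines. Derivatives are taken only in the two directions that keep the first two coordinates fixed,
  since there the parameter \<open>(s : t)\<close> or \<open>(u : v)\<close> read off from them
  stays the same.\<close>

lemma monomial_eval_superset:
  fixes x :: "'x \<Rightarrow> 'k::comm_semiring_1"
  assumes "finite S" "Poly_Mapping.keys e \<subseteq> S"
  shows "(\<Prod>i\<in>Poly_Mapping.keys e. x i ^ Poly_Mapping.lookup e i) =
    (\<Prod>i\<in>S. x i ^ Poly_Mapping.lookup e i)"
  using assms by (intro prod.mono_neutral_left) (auto simp: in_keys_iff)

lemma monomial_eval_add:
  fixes x :: "'x \<Rightarrow> 'k::comm_semiring_1"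
  shows "(\<Prod>i\<in>Poly_Mapping.keys (e + e'). x i ^ Poly_Mapping.lookup (e + e') i) =
    (\<Prod>i\<in>Poly_Mapping.keys e. x i ^ Poly_Mapping.lookup e i) *
    (\<Prod>i\<in>Poly_Mapping.keys e'. x i ^ Poly_Mapping.lookup e' i)"
proof -
  let ?S = "Poly_Mapping.keys e \<union> Poly_Mapping.keys e'"
  have "Poly_Mapping.keys (e + e') \<subseteq> ?S" by (rule keys_add)
  then show ?thesis
    by (subst (1 2 3) monomial_eval_superset[of ?S])
      (simp_all add: lookup_add power_add prod.distrib)
qed

lemma eval_poly_superset:
  assumes "finite S" "Poly_Mapping.keys f \<subseteq> S"
  shows "eval_poly x f = (\<Sum>e\<in>S. Poly_Mapping.lookup f e *
      (\<Prod>i\<in>Poly_Mapping.keys e. x i ^ Poly_Mapping.lookup e i))"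
  unfolding eval_poly_def
  using assms by (intro sum.mono_neutral_left) (auto simp: in_keys_iff)

lemma eval_poly_0 [simp]: "eval_poly x 0 = 0"
  by (simp add: eval_poly_def)

lemma eval_poly_single:
  "eval_poly x (Poly_Mapping.single e c) =
    c * (\<Prod>i\<in>Poly_Mapping.keys e. x i ^ Poly_Mapping.lookup e i)"
  by (subst eval_poly_superset[of "{e}"]) auto

lemma eval_poly_add: "eval_poly x (f + g) = eval_poly x f + eval_poly x g"
proof -
  let ?S = "Poly_Mapping.keys f \<union> Poly_Mapping.keys g"
  have "Poly_Mapping.keys (f + g) \<subseteq> ?S" by (rule keys_add)
  then show ?thesis
    by (simp add: eval_poly_superset[of ?S] lookup_add distrib_right sum.distrib)
qed

lemma eval_poly_sum: "eval_poly x (sum f A) = (\<Sum>a\<in>A. eval_poly x (f a))"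
  by (induction A rule: infinite_finite_induct) (simp_all add: eval_poly_add)

lemma poly_mapping_eq_sum_single:
  "f = (\<Sum>e\<in>Poly_Mapping.keys f. Poly_Mapping.single e (Poly_Mapping.lookup f e))"
  by (rule poly_mapping_eqI)
    (auto simp: lookup_sum lookup_single when_def in_keys_iff sum.delta)

lemma eval_poly_mult: "eval_poly x (f * g) = eval_poly x f * eval_poly x g"
proof -
  let ?s = "\<lambda>h e. Poly_Mapping.single e (Poly_Mapping.lookup h e)"
  have *: "eval_poly x (?s f a * ?s g b) = eval_poly x (?s f a) * eval_poly x (?s g b)" for a b
    by (simp add: mult_single eval_poly_single monomial_eval_add)
  have "eval_poly x (f * g) =
      eval_poly x (sum (?s f) (Poly_Mapping.keys f) * sum (?s g) (Poly_Mapping.keys g))"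
    by (simp flip: poly_mapping_eq_sum_single)
  also have "\<dots> = eval_poly x (sum (?s f) (Poly_Mapping.keys f)) *
      eval_poly x (sum (?s g) (Poly_Mapping.keys g))"
    by (simp only: sum_product eval_poly_sum *)
  finally show ?thesis by (simp flip: poly_mapping_eq_sum_single)
qed

lemma eval_poly_homogeneous_scale:
  assumes "\<And>e. e \<in> Poly_Mapping.keys f \<Longrightarrow> (\<Sum>i\<in>Poly_Mapping.keys e. Poly_Mapping.lookup e i) = d"
  shows "eval_poly (\<lambda>i. c * x i) f = c ^ d * eval_poly x f"
  unfolding eval_poly_def sum_distrib_left
  by (rule sum.cong) (simp_all add: power_mult_distrib prod.distrib assms flip: power_sum)

text \<open>The pullback of \<open>f\<close> along the curve \<open>r\<close>. It serves twice:
  infinitely many zeros on a curve force vanishing on all of it, and along a line the linear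
  coefficient is a directional derivative.\<close>

definition curve_poly :: "('x \<Rightarrow> 'k poly) \<Rightarrow> ('x, 'k::field) mpoly \<Rightarrow> 'k poly" where
  "curve_poly r f = (\<Sum>e\<in>Poly_Mapping.keys f. smult (Poly_Mapping.lookup f e)
      (\<Prod>i\<in>Poly_Mapping.keys e. r i ^ Poly_Mapping.lookup e i))"

lemma poly_curve_poly: "poly (curve_poly r f) T = eval_poly (\<lambda>i. poly (r i) T) f"
  by (simp add: curve_poly_def eval_poly_def poly_sum poly_prod)

lemma eval_poly_partial_deriv:
  "eval_poly x (partial_deriv i f) = (\<Sum>e\<in>Poly_Mapping.keys f. Poly_Mapping.lookup f e *
    (of_nat (Poly_Mapping.lookup e i) * x i ^ (Poly_Mapping.lookup e i - 1) *
      (\<Prod>j\<in>Poly_Mapping.keys e - {i}. x j ^ Poly_Mapping.lookup e j)))"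
  unfolding partial_deriv_def eval_poly_sum eval_poly_single
proof (rule sum.cong[OF refl])
  fix e assume "e \<in> Poly_Mapping.keys f"
  let ?e = "e - Poly_Mapping.single i 1"
  show "of_nat (Poly_Mapping.lookup e i) * Poly_Mapping.lookup f e *
      (\<Prod>j\<in>Poly_Mapping.keys ?e. x j ^ Poly_Mapping.lookup ?e j) =
    Poly_Mapping.lookup f e * (of_nat (Poly_Mapping.lookup e i) *
      x i ^ (Poly_Mapping.lookup e i - 1) *
      (\<Prod>j\<in>Poly_Mapping.keys e - {i}. x j ^ Poly_Mapping.lookup e j))"
  proof (cases "i \<in> Poly_Mapping.keys e")
    case True
    have "Poly_Mapping.keys ?e \<subseteq> Poly_Mapping.keys e"
      by (auto simp: in_keys_iff lookup_minus)
    then have "(\<Prod>j\<in>Poly_Mapping.keys ?e. x j ^ Poly_Mapping.lookup ?e j) =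
        (\<Prod>j\<in>Poly_Mapping.keys e. x j ^ Poly_Mapping.lookup ?e j)"
      by (intro monomial_eval_superset) auto
    also have "\<dots> = x i ^ Poly_Mapping.lookup ?e i *
        (\<Prod>j\<in>Poly_Mapping.keys e - {i}. x j ^ Poly_Mapping.lookup ?e j)"
      using True by (intro prod.remove) auto
    also have "(\<Prod>j\<in>Poly_Mapping.keys e - {i}. x j ^ Poly_Mapping.lookup ?e j) =
        (\<Prod>j\<in>Poly_Mapping.keys e - {i}. x j ^ Poly_Mapping.lookup e j)"
      by (intro prod.cong) (auto simp: lookup_minus lookup_single when_def)
    finally show ?thesis by (simp add: lookup_minus)
  qed (simp add: in_keys_iff)
qed

lemma pderiv_sum: "pderiv (sum f A) = (\<Sum>a\<in>A. pderiv (f a))"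
  by (induction A rule: infinite_finite_induct) (simp_all add: pderiv_add)

text \<open>The Leibniz rule at parameter 0, free of division. It links the formal partial
  derivatives in the definition of the tangent space with an expansion in one variable.\<close>

lemma coeff_curve_poly_line:
  fixes f :: "('n::finite, 'k::field) mpoly"
  shows "poly.coeff (curve_poly (\<lambda>i. [:x i, w i:]) f) 1 =
    (\<Sum>i\<in>UNIV. eval_poly x (partial_deriv i f) * w i)"
proof -
  let ?c = "Poly_Mapping.lookup"
  have "poly.coeff (curve_poly (\<lambda>i. [:x i, w i:]) f) 1 =
      poly (pderiv (curve_poly (\<lambda>i. [:x i, w i:]) f)) 0"
    by (simp add: coeff_pderiv poly_0_coeff_0)
  also have "\<dots> = (\<Sum>e\<in>Poly_Mapping.keys f. ?c f e * (\<Sum>i\<in>Poly_Mapping.keys e.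
      of_nat (?c e i) * x i ^ (?c e i - 1) *
      (\<Prod>j\<in>Poly_Mapping.keys e - {i}. x j ^ ?c e j) * w i))"
    by (simp add: curve_poly_def pderiv_sum pderiv_smult poly_sum pderiv_prod poly_prod
        pderiv_power pderiv_pCons mult_ac)
  also have "\<dots> = (\<Sum>e\<in>Poly_Mapping.keys f. ?c f e * (\<Sum>i\<in>UNIV.
      of_nat (?c e i) * x i ^ (?c e i - 1) *
      (\<Prod>j\<in>Poly_Mapping.keys e - {i}. x j ^ ?c e j) * w i))"
    by (intro sum.cong refl arg_cong[where f = "(*) _"] sum.mono_neutral_left)
      (auto simp: in_keys_iff)
  also have "\<dots> = (\<Sum>i\<in>UNIV. eval_poly x (partial_deriv i f) * w i)"
    by (simp add: eval_poly_partial_deriv sum_distrib_left sum_distrib_right mult_ac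
        sum.swap[of _ "UNIV :: 'n set"])
  finally show ?thesis .
qed

section \<open>Polynomials over algebraically closed fields\<close>

text \<open>In a finite field the product of all \<open>x - a\<close>, plus 1, would have positive
  degree and the value 1 everywhere.\<close>

lemma infinite_alg_closed: "infinite (UNIV :: 'k::alg_closed_field set)"
proof
  assume fin: "finite (UNIV :: 'k set)"
  define p :: "'k poly" where "p = (\<Prod>a\<in>UNIV. [:- a, 1:]) + 1"
  have "degree (\<Prod>a\<in>(UNIV :: 'k set). [:- a, 1:]) = card (UNIV :: 'k set)"
    by (subst degree_prod_eq_sum_degree) auto
  then have "degree p = card (UNIV :: 'k set)"
    unfolding p_def using fin by (subst degree_add_eq_left) (auto simp: card_gt_0_iff)
  then obtain z where "poly p z = 0"
    using alg_closed_imp_poly_has_root[of p] fin by (auto simp: card_gt_0_iff)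
  moreover have "poly (\<Prod>a\<in>(UNIV :: 'k set). [:- a, 1:]) z = 0"
    using fin by (auto simp: poly_prod)
  ultimately show False by (simp add: p_def)
qed

lemma poly_eq_0_if_infinite_roots:
  fixes p :: "'k::field poly"
  assumes "infinite {T. P T}" "\<And>T. P T \<Longrightarrow> poly p T = 0"
  shows "p = 0"
proof (rule ccontr)
  assume "p \<noteq> 0"
  then have "finite {T. poly p T = 0}" by (rule poly_roots_finite)
  moreover have "{T. P T} \<subseteq> {T. poly p T = 0}" using assms(2) by auto
  ultimately show False using assms(1) finite_subset by blast
qed

lemma poly_eq_0_if_vanishing:
  fixes p :: "'k::alg_closed_field poly"
  assumes "\<And>T. poly p T = 0"
  shows "p = 0"
  using poly_eq_0_if_infinite_roots[of "\<lambda>_. True" p] assms infinite_alg_closed[where ?'k = 'k] by simp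

section \<open>Forms as functions\<close>

text \<open>Forms are handled as functions, so that equations can be written in changed coordinates
  without substituting into polynomials; a polynomial is extracted only where the definitions ask
  for one. The degree is explicit because the summands of a form must share it.\<close>

definition is_form :: "nat \<Rightarrow> ('k::field ^ 'n \<Rightarrow> 'k) \<Rightarrow> bool" where
  "is_form d h \<longleftrightarrow> (\<exists>f. (\<forall>e\<in>Poly_Mapping.keys f.
      (\<Sum>i\<in>Poly_Mapping.keys e. Poly_Mapping.lookup e i) = d) \<and>
    (\<forall>x. h x = eval_poly (($) x) f))"

lemma sum_keys_add:
  "(\<Sum>i\<in>Poly_Mapping.keys (e + e'). Poly_Mapping.lookup (e + e') i) =
    (\<Sum>i\<in>Poly_Mapping.keys e. Poly_Mapping.lookup e i) +
    (\<Sum>i\<in>Poly_Mapping.keys e'. Poly_Mapping.lookup e' (i :: 'x) :: nat)"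
proof -
  let ?S = "Poly_Mapping.keys e \<union> Poly_Mapping.keys e'"
  have *: "(\<Sum>i\<in>Poly_Mapping.keys m. Poly_Mapping.lookup m i) = (\<Sum>i\<in>?S. Poly_Mapping.lookup m i)"
    if "Poly_Mapping.keys m \<subseteq> ?S" for m :: "'x \<Rightarrow>\<^sub>0 nat"
    using that by (intro sum.mono_neutral_left) (auto simp: in_keys_iff)
  have "Poly_Mapping.keys (e + e') \<subseteq> ?S" by (rule keys_add)
  then show ?thesis
    by (subst (1 2 3) *) (simp_all add: lookup_add sum.distrib)
qed

lemma is_formE:
  assumes "is_form d h"
  obtains f where
    "\<And>e. e \<in> Poly_Mapping.keys f \<Longrightarrow> (\<Sum>i\<in>Poly_Mapping.keys e. Poly_Mapping.lookup e i) = d"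
    "\<And>x. h x = eval_poly (($) x) f"
  using assms unfolding is_form_def by blast

lemma is_form_mult:
  assumes "is_form d g" "is_form d' h"
  shows "is_form (d + d') (\<lambda>x. g x * h x)"
proof -
  obtain f where
    f: "\<And>e. e \<in> Poly_Mapping.keys f \<Longrightarrow> (\<Sum>i\<in>Poly_Mapping.keys e. Poly_Mapping.lookup e i) = d"
      "\<And>x. g x = eval_poly (($) x) f"
    using is_formE[OF assms(1)] by metis
  obtain f' where
    f': "\<And>e. e \<in> Poly_Mapping.keys f' \<Longrightarrow> (\<Sum>i\<in>Poly_Mapping.keys e. Poly_Mapping.lookup e i) = d'"
      "\<And>x. h x = eval_poly (($) x) f'"
    using is_formE[OF assms(2)] by metis
  have "(\<Sum>i\<in>Poly_Mapping.keys e. Poly_Mapping.lookup e i) = d + d'"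
    if e: "e \<in> Poly_Mapping.keys (f * f')" for e
  proof -
    obtain a b where "e = a + b" "a \<in> Poly_Mapping.keys f" "b \<in> Poly_Mapping.keys f'"
      using e keys_mult[of f f'] by blast
    then show ?thesis by (simp add: sum_keys_add f f')
  qed
  then show ?thesis
    unfolding is_form_def by (intro exI[of _ "f * f'"]) (auto simp: f f' eval_poly_mult)
qed

lemma is_form_mult': "is_form d g \<Longrightarrow> is_form d' h \<Longrightarrow> d + d' = e \<Longrightarrow> is_form e (\<lambda>x. g x * h x)"
  using is_form_mult by blast

lemma is_form_add:
  assumes "is_form d g" "is_form d h"
  shows "is_form d (\<lambda>x. g x + h x)"
proof -
  obtain f where
    f: "\<And>e. e \<in> Poly_Mapping.keys f \<Longrightarrow> (\<Sum>i\<in>Poly_Mapping.keys e. Poly_Mapping.lookup e i) = d"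
      "\<And>x. g x = eval_poly (($) x) f"
    using is_formE[OF assms(1)] by metis
  obtain f' where
    f': "\<And>e. e \<in> Poly_Mapping.keys f' \<Longrightarrow> (\<Sum>i\<in>Poly_Mapping.keys e. Poly_Mapping.lookup e i) = d"
      "\<And>x. h x = eval_poly (($) x) f'"
    using is_formE[OF assms(2)] by metis
  show ?thesis
    unfolding is_form_def using keys_add[of f f']
    by (intro exI[of _ "f + f'"]) (auto simp: f f' eval_poly_add)
qed

lemma is_form_const: "is_form 0 (\<lambda>x. c)"
  unfolding is_form_def
  by (rule exI[of _ "Poly_Mapping.single 0 c"]) (auto simp: eval_poly_single split: if_splits)

lemma is_form_coord: "is_form 1 (\<lambda>x. x $ i)"
  unfolding is_form_def
  by (rule exI[of _ "Poly_Mapping.single (Poly_Mapping.single i 1) 1"])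
    (auto simp: eval_poly_single split: if_splits)

lemma is_form_cmult: "is_form d g \<Longrightarrow> is_form d (\<lambda>x. c * g x)"
  using is_form_mult[OF is_form_const[of c], of d g] by simp

lemma is_form_diff: "is_form d g \<Longrightarrow> is_form d h \<Longrightarrow> is_form d (\<lambda>x. g x - h x)"
  using is_form_add[OF _ is_form_cmult[of d h "- 1"], of g] by simp

lemma is_form_zero: "is_form d (\<lambda>x. 0)"
  unfolding is_form_def by (rule exI[of _ 0]) auto

lemma is_form_sum: "(\<And>a. a \<in> A \<Longrightarrow> is_form d (g a)) \<Longrightarrow> is_form d (\<lambda>x. \<Sum>a\<in>A. g a x)"
  by (induction A rule: infinite_finite_induct) (auto simp: is_form_zero intro!: is_form_add)

lemma is_form_homogeneous:
  assumes "is_form d h"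
  obtains f where "homogeneous f" "\<And>x. h x = eval_poly (($) x) f"
  using assms unfolding is_form_def homogeneous_def by blast

section \<open>Closed subsets of projective space\<close>

lemma span_singleton_mem: "y \<in> vec.span {x} \<longleftrightarrow> (\<exists>c. y = c *s x)"
  by (auto simp: vec.span_singleton)

lemma span_scale: "(c :: 'k::field) \<noteq> 0 \<Longrightarrow> vec.span {c *s x} = vec.span {x :: 'k ^ 'n}"
  using vec.span_image_scale[of "{x}" "\<lambda>_. c"] by simp

lemma span_subset_eq:
  fixes x y :: "'k::field ^ 'n"
  assumes "x \<noteq> 0" "vec.span {x} \<subseteq> vec.span {y}"
  shows "vec.span {x} = vec.span {y}"
proof -
  have "x \<in> vec.span {x}" by (rule vec.span_base) simp
  with assms(2) have "x \<in> vec.span {y}" by blast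
  then obtain c where c: "x = c *s y" unfolding span_singleton_mem by blast
  with assms(1) have "c \<noteq> 0" by auto
  then show ?thesis by (simp add: c span_scale)
qed

lemma span_in_proj_space: "x \<noteq> 0 \<Longrightarrow> vec.span {x} \<in> proj_space"
  by (auto simp: proj_space_def)

lemma eval_homogeneous_zero_scale:
  fixes x :: "'k::field ^ 'n"
  assumes "homogeneous f" "eval_poly (($) x) f = 0"
  shows "eval_poly (($) (c *s x)) f = 0"
proof -
  obtain d where "\<And>e. e \<in> Poly_Mapping.keys f \<Longrightarrow>
      (\<Sum>i\<in>Poly_Mapping.keys e. Poly_Mapping.lookup e i) = d"
    using assms(1) by (auto simp: homogeneous_def)
  then have "eval_poly (\<lambda>i. c * x $ i) f = c ^ d * eval_poly (($) x) f"
    by (rule eval_poly_homogeneous_scale)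
  moreover have "($) (c *s x) = (\<lambda>i. c * x $ i)" by auto
  ultimately show ?thesis using assms(2) by simp
qed

lemma vanishes_at_span:
  assumes "homogeneous f"
  shows "vanishes_at f (vec.span {x}) \<longleftrightarrow> eval_poly (($) x) f = 0"
  using assms vec.span_base[of x "{x}"]
  by (auto simp: vanishes_at_def span_singleton_mem intro: eval_homogeneous_zero_scale)

lemma proj_closedE:
  assumes "proj_closed Z"
  obtains F where "\<And>f. f \<in> F \<Longrightarrow> homogeneous f" "Z \<subseteq> proj_space"
    "\<And>x. x \<noteq> 0 \<Longrightarrow> vec.span {x} \<in> Z \<longleftrightarrow> (\<forall>f\<in>F. eval_poly (($) x) f = 0)"
proof -
  obtain F where F: "\<forall>f\<in>F. homogeneous f" "Z = {P \<in> proj_space. \<forall>f\<in>F. vanishes_at f P}"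
    using assms by (auto simp: proj_closed_def)
  show thesis
    by (rule that[of F]) (use F in \<open>auto simp: vanishes_at_span span_in_proj_space\<close>)
qed

lemma proj_closed_form:
  assumes "is_form d h" "Z \<subseteq> proj_space"
    and "\<And>x. x \<noteq> 0 \<Longrightarrow> vec.span {x} \<in> Z \<longleftrightarrow> h x = 0"
  shows "proj_closed Z"
proof -
  obtain f where f: "homogeneous f" "\<And>x. h x = eval_poly (($) x) f"
    using is_form_homogeneous[OF assms(1)] by metis
  have "Z = {P \<in> proj_space. \<forall>f\<in>{f}. vanishes_at f P}"
    using assms(2,3) by (auto simp: proj_space_def vanishes_at_span f)
  then show ?thesis unfolding proj_closed_def using f(1) by blast
qed

text \<open>Each equation of \<open>Z\<close> pulls back to a univariate polynomial with infinitely
  many roots, hence to 0. Lines, the curves of fixed \<open>(u : v)\<close> on the surface, and the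
  points missing from an affine chart are all reached this way.\<close>

lemma proj_closed_curve:
  fixes \<gamma> :: "'k::field \<Rightarrow> 'k ^ 'n"
  assumes "proj_closed Z" and \<gamma>: "\<And>T i. \<gamma> T $ i = poly (r i) T"
    and inf: "infinite {T. \<gamma> T \<noteq> 0 \<and> vec.span {\<gamma> T} \<in> Z}"
    and "\<gamma> T0 \<noteq> 0"
  shows "vec.span {\<gamma> T0} \<in> Z"
proof -
  obtain F where F: "\<And>x. x \<noteq> 0 \<Longrightarrow> vec.span {x} \<in> Z \<longleftrightarrow> (\<forall>f\<in>F. eval_poly (($) x) f = 0)"
    using proj_closedE[OF assms(1)] by metis
  have ev: "eval_poly (($) (\<gamma> T)) f = poly (curve_poly r f) T" for f T
    by (simp add: poly_curve_poly flip: \<gamma>)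
  have "eval_poly (($) (\<gamma> T0)) f = 0" if "f \<in> F" for f
  proof -
    have "curve_poly r f = 0"
      by (rule poly_eq_0_if_infinite_roots[OF inf]) (use F that in \<open>auto simp flip: ev\<close>)
    then show ?thesis by (simp add: ev)
  qed
  then show ?thesis using F[OF assms(4)] by auto
qed

lemma homogeneous_mult:
  assumes "homogeneous f" "homogeneous g"
  shows "homogeneous (f * g)"
proof -
  obtain d d' where
    d: "\<And>e. e \<in> Poly_Mapping.keys f \<Longrightarrow> (\<Sum>i\<in>Poly_Mapping.keys e. Poly_Mapping.lookup e i) = d"
      "\<And>e. e \<in> Poly_Mapping.keys g \<Longrightarrow> (\<Sum>i\<in>Poly_Mapping.keys e. Poly_Mapping.lookup e i) = d'"
    using assms unfolding homogeneous_def by blast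
  have "(\<Sum>i\<in>Poly_Mapping.keys e. Poly_Mapping.lookup e i) = d + d'"
    if e: "e \<in> Poly_Mapping.keys (f * g)" for e
  proof -
    obtain a b where "e = a + b" "a \<in> Poly_Mapping.keys f" "b \<in> Poly_Mapping.keys g"
      using e keys_mult[of f g] by blast
    then show ?thesis by (simp add: sum_keys_add d)
  qed
  then show ?thesis unfolding homogeneous_def by blast
qed

lemma proj_closed_Un:
  fixes A B :: "('k::field ^ 'n) set set"
  assumes "proj_closed A" "proj_closed B"
  shows "proj_closed (A \<union> B)"
proof -
  obtain F where F: "\<And>f. f \<in> F \<Longrightarrow> homogeneous f" "A \<subseteq> proj_space"
    "\<And>x. x \<noteq> 0 \<Longrightarrow> vec.span {x} \<in> A \<longleftrightarrow> (\<forall>f\<in>F. eval_poly (($) x) f = 0)"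
    using proj_closedE[OF assms(1)] by metis
  obtain G where G: "\<And>f. f \<in> G \<Longrightarrow> homogeneous f" "B \<subseteq> proj_space"
    "\<And>x. x \<noteq> 0 \<Longrightarrow> vec.span {x} \<in> B \<longleftrightarrow> (\<forall>f\<in>G. eval_poly (($) x) f = 0)"
    using proj_closedE[OF assms(2)] by metis
  let ?H = "{f * g | f g. f \<in> F \<and> g \<in> G}"
  have H: "homogeneous f" if "f \<in> ?H" for f
    using that F(1) G(1) by (auto intro: homogeneous_mult)
  have *: "vec.span {x} \<in> A \<union> B \<longleftrightarrow> (\<forall>f\<in>?H. vanishes_at f (vec.span {x}))" if "x \<noteq> 0" for x
  proof -
    have "(\<forall>f\<in>?H. vanishes_at f (vec.span {x})) \<longleftrightarrow> (\<forall>f\<in>?H. eval_poly (($) x) f = 0)"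
      using H by (auto simp: vanishes_at_span)
    also have "\<dots> \<longleftrightarrow> (\<forall>f\<in>F. eval_poly (($) x) f = 0) \<or> (\<forall>f\<in>G. eval_poly (($) x) f = 0)"
      by (auto simp: eval_poly_mult) (metis eval_poly_mult mult_eq_0_iff)
    finally show ?thesis using F(3) G(3) that by auto
  qed
  have "A \<union> B = {P \<in> proj_space. \<forall>f\<in>?H. vanishes_at f P}"
  proof (intro set_eqI)
    fix P
    show "P \<in> A \<union> B \<longleftrightarrow> P \<in> {P \<in> proj_space. \<forall>f\<in>?H. vanishes_at f P}"
    proof (cases "P \<in> proj_space")
      case True
      then obtain x where "x \<noteq> 0" "P = vec.span {x}" by (auto simp: proj_space_def)
      then show ?thesis using * True by blast
    qed (use F(2) G(2) in auto)
  qed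
  then show ?thesis unfolding proj_closed_def using H by blast
qed

section \<open>Linear subspaces, points and finite sets\<close>

lemma linear_functional_coords:
  fixes f :: "'k::field ^ 'n \<Rightarrow> 'k"
  assumes "Vector_Spaces.linear (*s) (*) f"
  shows "f x = (\<Sum>i\<in>UNIV. f (axis i 1) * x $ i)"
proof -
  interpret Vector_Spaces.linear "(*s)" "(*)" f by fact
  have "x = (\<Sum>i\<in>UNIV. x $ i *s axis i 1)"
    by (simp add: basis_expansion)
  then have "f x = f (\<Sum>i\<in>UNIV. x $ i *s axis i 1)" by simp
  then show ?thesis by (simp add: sum scale mult.commute)
qed

text \<open>The equations are the linear functionals that vanish on \<open>W\<close>. A vector
  \<open>x\<close> outside \<open>W\<close> is detected by extending a basis of \<open>W\<close> by
  \<open>x\<close> and taking the functional that is 1 at \<open>x\<close> and 0 on the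
  basis.\<close>

lemma proj_closed_subspace:
  fixes W :: "('k::field ^ 'n) set"
  assumes "vec.subspace W"
  shows "proj_closed {P \<in> proj_space. P \<subseteq> W}"
proof -
  let ?ann = "{c. \<forall>w\<in>W. (\<Sum>i\<in>UNIV. c i * w $ i) = 0}"
  have form: "is_form 1 (\<lambda>x :: 'k ^ 'n. \<Sum>i\<in>UNIV. c i * x $ i)" for c
    by (intro is_form_sum is_form_cmult is_form_coord)
  have "\<exists>f. homogeneous f \<and> (\<forall>x :: 'k ^ 'n. (\<Sum>i\<in>UNIV. c i * x $ i) = eval_poly (($) x) f)" for c
    using is_form_homogeneous[OF form[of c]] by metis
  then obtain f where f: "\<And>c. homogeneous (f c)"
    "\<And>c (x :: 'k ^ 'n). (\<Sum>i\<in>UNIV. c i * x $ i) = eval_poly (($) x) (f c)"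
    by metis
  have mem: "x \<in> W" if x: "\<forall>c\<in>?ann. (\<Sum>i\<in>UNIV. c i * x $ i) = 0" for x
  proof (rule ccontr)
    assume "x \<notin> W"
    obtain B where B: "B \<subseteq> W" "vec.independent B" "W \<subseteq> vec.span B"
      using vec.basis_exists[of W] by metis
    have "x \<notin> vec.span B"
      using \<open>x \<notin> W\<close> B(1) assms vec.span_minimal by blast
    then have "vec.independent (insert x B)" using B(2) by (rule vec.independent_insertI)
    interpret vsp: vector_space_pair "(*s) :: 'k \<Rightarrow> 'k ^ 'n \<Rightarrow> 'k ^ 'n" "(*) :: 'k \<Rightarrow> 'k \<Rightarrow> 'k"
      by unfold_locales (auto simp: algebra_simps)
    obtain g where g: "Vector_Spaces.linear (*s) (*) g"
      "\<And>b. b \<in> insert x B \<Longrightarrow> g b = (if b = x then 1 else 0)"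
      using vsp.linear_independent_extend[OF \<open>vec.independent (insert x B)\<close>,
          of "\<lambda>b. if b = x then 1 else 0"] by blast
    interpret g: Vector_Spaces.linear "(*s)" "(*)" g by (rule g(1))
    have "x \<notin> B" using \<open>x \<notin> vec.span B\<close> vec.span_base by blast
    have "g w = 0" if "w \<in> W" for w
    proof (rule vsp.linear_eq_0_on_span[OF g(1)])
      show "w \<in> vec.span B" using that B(3) by auto
      show "g b = 0" if "b \<in> B" for b using g(2)[of b] that \<open>x \<notin> B\<close> by auto
    qed
    then have "(\<lambda>i. g (axis i 1)) \<in> ?ann"
      by (simp flip: linear_functional_coords[OF g(1)])
    with x have "(\<Sum>i\<in>UNIV. g (axis i 1) * x $ i) = 0" by (rule bspec)
    then have "g x = 0" by (simp flip: linear_functional_coords[OF g(1)])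
    then show False using g(2)[of x] by simp
  qed
  have "{P \<in> proj_space. P \<subseteq> W} = {P \<in> proj_space. \<forall>h\<in>f ` ?ann. vanishes_at h P}"
  proof (intro Collect_cong conj_cong refl)
    fix P :: "('k ^ 'n) set"
    assume "P \<in> proj_space"
    then obtain x where x: "P = vec.span {x}" by (auto simp: proj_space_def)
    have "P \<subseteq> W \<longleftrightarrow> x \<in> W"
      using assms vec.span_base[of x "{x}"] vec.span_minimal[of "{x}" W] by (auto simp: x)
    also have "\<dots> \<longleftrightarrow> (\<forall>c\<in>?ann. (\<Sum>i\<in>UNIV. c i * x $ i) = 0)"
      using mem by blast
    also have "\<dots> \<longleftrightarrow> (\<forall>h\<in>f ` ?ann. vanishes_at h P)"
      by (simp add: x vanishes_at_span f(1) flip: f(2))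
    finally show "P \<subseteq> W \<longleftrightarrow> (\<forall>h\<in>f ` ?ann. vanishes_at h P)" .
  qed
  moreover have "\<forall>h\<in>f ` ?ann. homogeneous h" using f(1) by blast
  ultimately show ?thesis
    unfolding proj_closed_def by (intro exI[of _ "f ` ?ann"] conjI)
qed

lemma proj_closed_empty: "proj_closed ({} :: ('k::field ^ 'n) set set)"
proof -
  have "{P \<in> proj_space. P \<subseteq> {0 :: 'k ^ 'n}} = {}"
    using vec.span_base by (fastforce simp: proj_space_def)
  then show ?thesis using proj_closed_subspace[OF vec.subspace_single_0] by metis
qed

lemma proj_closed_point:
  assumes "P \<in> proj_space"
  shows "proj_closed {P :: ('k::field ^ 'n) set}"
proof -
  obtain x where x: "x \<noteq> 0" "P = vec.span {x}" using assms by (auto simp: proj_space_def)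
  have "{Q \<in> proj_space. Q \<subseteq> P} = {P}"
  proof (intro equalityI subsetI)
    fix Q assume "Q \<in> {Q \<in> proj_space. Q \<subseteq> P}"
    then obtain y where "y \<noteq> 0" "Q = vec.span {y}" "Q \<subseteq> P"
      unfolding proj_space_def by blast
    then show "Q \<in> {P}" using span_subset_eq[of y x] x(2) by blast
  qed (use assms in auto)
  moreover have "vec.subspace P" unfolding x(2) by (rule vec.subspace_span)
  ultimately show ?thesis using proj_closed_subspace[of P] by simp
qed

lemma proj_closed_finite:
  assumes "finite Z" "Z \<subseteq> proj_space"
  shows "proj_closed (Z :: ('k::field ^ 'n) set set)"
  using assms
proof (induction Z)
  case (insert P Z)
  then have "proj_closed ({P} \<union> Z)"
    by (intro proj_closed_Un proj_closed_point) auto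
  then show ?case by simp
qed (rule proj_closed_empty)

lemma irreducible_closed_point:
  assumes "P \<in> proj_space"
  shows "irreducible_closed {P :: ('k::field ^ 'n) set}"
  unfolding irreducible_closed_def
proof (intro conjI allI impI)
  show "proj_closed {P}" using assms by (rule proj_closed_point)
  fix A B assume "{P} = A \<union> B"
  then show "{P} = A \<or> {P} = B" by (metis singleton_Un_iff)
qed simp

text \<open>Finite sets are closed, so \<open>Z\<close> would split into \<open>P\<close> and the
  rest. Read the other way, an irreducible closed set with more than one point is infinite.\<close>

lemma irreducible_closed_finite_singleton:
  fixes Z :: "('k::field ^ 'n) set set"
  assumes "irreducible_closed Z" "finite Z" "P \<in> Z"
  shows "Z = {P}"
proof -
  have "Z \<subseteq> proj_space" using assms(1) by (auto simp: irreducible_closed_def proj_closed_def)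
  then have "proj_closed {P}" "proj_closed (Z - {P})"
    using assms by (auto intro!: proj_closed_finite)
  moreover have "Z = {P} \<union> (Z - {P})" using assms(3) by auto
  ultimately have "Z = {P} \<or> Z = Z - {P}"
    using assms(1) unfolding irreducible_closed_def by blast
  then show ?thesis using assms(3) by blast
qed

section \<open>Lines\<close>

lemma span_pair: "vec.span {v, w :: 'k::field ^ 'n} = {a *s v + b *s w | a b. True}"
proof (intro equalityI subsetI)
  fix x assume "x \<in> vec.span {v, w}"
  then obtain a where "x - a *s v \<in> vec.span {w}" by (auto simp: vec.span_insert[of v "{w}"])
  then obtain b where "x - a *s v = b *s w" unfolding span_singleton_mem by blast
  then have "x = a *s v + b *s w" by (simp add: algebra_simps)
  then show "x \<in> {a *s v + b *s w | a b. True}" by blast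
next
  fix x assume "x \<in> {a *s v + b *s w | a b. True}"
  then obtain a b where "x = a *s v + b *s w" by blast
  then show "x \<in> vec.span {v, w}"
    by (simp add: vec.span_add vec.span_scale vec.span_base)
qed

lemma points_on_span_pair:
  fixes v w :: "'k::field ^ 'n"
  assumes ind: "\<And>a b. a *s v + b *s w = 0 \<Longrightarrow> a = 0 \<and> b = 0"
  shows "{P \<in> proj_space. P \<subseteq> vec.span {v, w}} =
    {vec.span {a *s v + b *s w} | a b. a \<noteq> 0 \<or> b \<noteq> 0}"
proof (intro equalityI subsetI)
  fix P assume "P \<in> {vec.span {a *s v + b *s w} | a b. a \<noteq> 0 \<or> b \<noteq> 0}"
  then obtain a b where ab: "a \<noteq> 0 \<or> b \<noteq> 0" "P = vec.span {a *s v + b *s w}" by blast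
  have "a *s v + b *s w \<noteq> 0" using ind ab(1) by blast
  then have "P \<in> proj_space" unfolding ab(2) by (rule span_in_proj_space)
  moreover have "P \<subseteq> vec.span {v, w}"
    unfolding ab(2)
  proof (rule vec.span_minimal)
    show "{a *s v + b *s w} \<subseteq> vec.span {v, w}" unfolding span_pair by blast
  qed (rule vec.subspace_span)
  ultimately show "P \<in> {P \<in> proj_space. P \<subseteq> vec.span {v, w}}" by blast
next
  fix P assume "P \<in> {P \<in> proj_space. P \<subseteq> vec.span {v, w}}"
  then obtain x where x: "x \<noteq> 0" "P = vec.span {x}" "P \<subseteq> vec.span {v, w}"
    unfolding proj_space_def by blast
  moreover have "x \<in> vec.span {x}" by (rule vec.span_base) simp
  ultimately obtain a b where "x = a *s v + b *s w" unfolding span_pair by blast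
  moreover from this x(1) have "a \<noteq> 0 \<or> b \<noteq> 0" by auto
  ultimately show "P \<in> {vec.span {a *s v + b *s w} | a b. a \<noteq> 0 \<or> b \<noteq> 0}"
    using x(2) by blast
qed

lemma independent_pair:
  fixes v w :: "'k::field ^ 'n"
  assumes "\<And>a b. a *s v + b *s w = 0 \<Longrightarrow> a = 0 \<and> b = 0"
  shows "vec.independent {v, w} \<and> v \<noteq> w"
proof -
  have "w \<noteq> 0" using assms[of 0 1] by auto
  moreover have "v \<notin> vec.span {w}"
  proof
    assume "v \<in> vec.span {w}"
    then obtain c where "v = c *s w" unfolding span_singleton_mem by blast
    then show False using assms[of 1 "- c"] by simp
  qed
  ultimately show ?thesis
    using vec.independent_insertI[of v "{w}"] vec.span_base[of w "{w}"] by auto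
qed

lemma proj_line_span:
  fixes v w :: "'k::field ^ 'n"
  assumes "\<And>a b. a *s v + b *s w = 0 \<Longrightarrow> a = 0 \<and> b = 0"
  shows "proj_line {vec.span {a *s v + b *s w} | a b. a \<noteq> 0 \<or> b \<noteq> 0}"
proof -
  have "vec.dim (vec.span {v, w}) = 2"
    using independent_pair[of v w] assms vec.dim_span_eq_card_independent[of "{v, w}"] by auto
  then show ?thesis
    unfolding proj_line_def
    by (intro exI[of _ "vec.span {v, w}"] conjI vec.subspace_span
        points_on_span_pair[OF assms, symmetric])
qed

lemma proj_lineE:
  fixes L :: "('k::field ^ 'n) set set"
  assumes "proj_line L"
  obtains v w where "\<forall>a b. a *s v + b *s w = 0 \<longrightarrow> a = 0 \<and> b = 0"
    "L = {vec.span {a *s v + b *s w} | a b. a \<noteq> 0 \<or> b \<noteq> 0}"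
proof -
  obtain W where W: "vec.subspace W" "vec.dim W = 2" "L = {P \<in> proj_space. P \<subseteq> W}"
    using assms unfolding proj_line_def by blast
  obtain B where B: "B \<subseteq> W" "vec.independent B" "W \<subseteq> vec.span B" "card B = 2"
    using vec.basis_exists[of W] W(2) by metis
  then obtain v w where vw: "B = {v, w}" "v \<noteq> w" by (auto simp: card_2_iff)
  have w: "w \<noteq> 0" using B(2) vw vec.dependent_zero by auto
  have v: "v \<notin> vec.span {w}" using B(2) vw by (auto simp: vec.independent_insert)
  have ind: "a = 0 \<and> b = 0" if "a *s v + b *s w = 0" for a b
  proof -
    have "v = (- b / a) *s w" if "a \<noteq> 0"
    proof -
      have "a *s v = (- b) *s w" using \<open>a *s v + b *s w = 0\<close> by (simp add: add_eq_0_iff)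
      then have "inverse a *s (a *s v) = inverse a *s ((- b) *s w)" by simp
      then show ?thesis using that
        by (simp add: vector_smult_assoc divide_inverse mult.commute del: vec.scale_minus_left)
    qed
    then have "a = 0" using v unfolding span_singleton_mem by blast
    then show ?thesis using that w by simp
  qed
  have "W = vec.span {v, w}"
    using B W(1) vw(1) vec.span_minimal by blast
  then have "L = {vec.span {a *s v + b *s w} | a b. a \<noteq> 0 \<or> b \<noteq> 0}"
    unfolding W(3) using points_on_span_pair[OF ind] by simp
  moreover have "\<forall>a b. a *s v + b *s w = 0 \<longrightarrow> a = 0 \<and> b = 0"
    using ind by blast
  ultimately show thesis using that by blast
qed

lemma proj_line_closed: "proj_line L \<Longrightarrow> proj_closed L"
  unfolding proj_line_def by (elim exE conjE) (simp only: proj_closed_subspace)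

lemma proj_line_infinite:
  fixes L :: "('k::alg_closed_field ^ 'n) set set"
  assumes "proj_line L"
  shows "infinite L"
proof -
  obtain v w where ind0: "\<forall>a b. a *s v + b *s w = 0 \<longrightarrow> a = 0 \<and> b = 0"
    and L: "L = {vec.span {a *s v + b *s w} | a b. a \<noteq> 0 \<or> b \<noteq> 0}"
    by (rule proj_lineE[OF assms]) (rule that)
  note ind = ind0[rule_format]
  have "inj (\<lambda>T. vec.span {v + T *s w})"
  proof (rule injI)
    fix T T' assume "vec.span {v + T *s w} = vec.span {v + T' *s w}"
    then have "v + T *s w \<in> vec.span {v + T' *s w}" using vec.span_base by blast
    then obtain c where "v + T *s w = c *s (v + T' *s w)" by (auto simp: span_singleton_mem)
    then have "(1 - c) *s v + (T - c * T') *s w = 0"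
      by (simp add: vector_sub_rdistrib vector_add_ldistrib vector_smult_assoc algebra_simps)
    then have "1 - c = 0 \<and> T - c * T' = 0" by (rule ind)
    then show "T = T'" by simp
  qed
  then have "infinite (range (\<lambda>T. vec.span {v + T *s w}))"
    using infinite_alg_closed[where ?'k = 'k] finite_imageD by blast
  moreover have "range (\<lambda>T. vec.span {v + T *s w}) \<subseteq> L"
    unfolding L by clarify (metis one_neq_zero vector_smult_lid)
  ultimately show ?thesis using finite_subset by blast
qed

text \<open>The chart \<open>v + T *s w\<close> misses only one point of the line, so infinitely
  many of its parameters give points of \<open>Z\<close>.\<close>

lemma proj_line_subset_closed:
  fixes L :: "('k::alg_closed_field ^ 'n) set set"
  assumes "proj_line L" "proj_closed Z" "infinite (Z \<inter> L)"
  shows "L \<subseteq> Z"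
proof -
  obtain v w where ind0: "\<forall>a b. a *s v + b *s w = 0 \<longrightarrow> a = 0 \<and> b = 0"
    and L: "L = {vec.span {a *s v + b *s w} | a b. a \<noteq> 0 \<or> b \<noteq> 0}"
    by (rule proj_lineE[OF assms(1)]) (rule that)
  note ind = ind0[rule_format]
  have vT: "v + T *s w \<noteq> 0" for T using ind[of 1 T] by auto
  have wS: "w + S *s v \<noteq> 0" for S using ind[of S 1] by (auto simp: add.commute)
  have norm: "vec.span {a *s v + b *s w} = vec.span {v + (b / a) *s w}" if "a \<noteq> 0" for a b
  proof -
    have "a *s v + b *s w = a *s (v + (b / a) *s w)"
      using that by (simp add: vector_add_ldistrib vector_smult_assoc)
    then show ?thesis using that by (simp add: span_scale)
  qed
  have norm': "vec.span {b *s w} = vec.span {w}" if "b \<noteq> 0" for b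
    using that by (rule span_scale)
  have "Z \<inter> L \<subseteq> insert (vec.span {w}) ((\<lambda>T. vec.span {v + T *s w}) ` {T. vec.span {v + T *s w} \<in> Z})"
  proof
    fix P assume "P \<in> Z \<inter> L"
    then obtain a b where "a \<noteq> 0 \<or> b \<noteq> 0" "P = vec.span {a *s v + b *s w}" "P \<in> Z"
      by (auto simp: L)
    then show "P \<in> insert (vec.span {w}) ((\<lambda>T. vec.span {v + T *s w}) ` {T. vec.span {v + T *s w} \<in> Z})"
      by (cases "a = 0") (auto simp: norm norm')
  qed
  then have "infinite {T. vec.span {v + T *s w} \<in> Z}"
    using assms(3) by (meson finite_imageI finite_insert finite_subset)
  then have inf: "infinite {T. v + T *s w \<noteq> 0 \<and> vec.span {v + T *s w} \<in> Z}" by (simp add: vT)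
  have vTZ: "vec.span {v + T *s w} \<in> Z" for T
    by (rule proj_closed_curve[OF assms(2) _ inf, where r = "\<lambda>i. [:v $ i, w $ i:]"])
      (auto simp: vT)
  \<comment> \<open>The missing point \<open>w\<close> is the value at parameter 0 of the opposite
    chart \<open>w + S *s v\<close>, whose other points are already known to lie in
    \<open>Z\<close>.\<close>
  have "- {0} \<subseteq> {S. w + S *s v \<noteq> 0 \<and> vec.span {w + S *s v} \<in> Z}"
    using norm[of _ 1] vTZ wS by (auto simp: add.commute)
  moreover have "infinite (- {0 :: 'k})" using infinite_alg_closed[where ?'k = 'k] by simp
  ultimately have inf': "infinite {S. w + S *s v \<noteq> 0 \<and> vec.span {w + S *s v} \<in> Z}"
    using finite_subset by blast
  have "vec.span {w + 0 *s v} \<in> Z"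
    by (rule proj_closed_curve[OF assms(2) _ inf', where r = "\<lambda>i. [:w $ i, v $ i:]"])
      (use wS[of 0] in auto)
  then have wZ: "vec.span {w} \<in> Z" by simp
  show ?thesis
  proof
    fix P assume "P \<in> L"
    then obtain a b where "a \<noteq> 0 \<or> b \<noteq> 0" "P = vec.span {a *s v + b *s w}" by (auto simp: L)
    then show "P \<in> Z" using vTZ wZ by (cases "a = 0") (auto simp: norm norm')
  qed
qed

lemma proj_line_irreducible:
  fixes L :: "('k::alg_closed_field ^ 'n) set set"
  assumes "proj_line L"
  shows "irreducible_closed L"
  unfolding irreducible_closed_def
proof (intro conjI allI impI)
  show "proj_closed L" using assms by (rule proj_line_closed)
  show "L \<noteq> {}" using proj_line_infinite[OF assms] by auto
  fix A B assume AB: "proj_closed A" "proj_closed B" "L = A \<union> B"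
  then have "infinite (A \<inter> L) \<or> infinite (B \<inter> L)"
    using proj_line_infinite[OF assms] by (metis Int_absorb2 Un_upper1 Un_upper2 finite_Un)
  then show "L = A \<or> L = B"
    using AB assms proj_line_subset_closed[of L A] proj_line_subset_closed[of L B] by auto
qed

text \<open>Such chains bound dimensions from below: the local dimension of the surface at a point
  of a ruling line, and the dimension of a component that properly contains a line.\<close>

lemma irreducible_chain_point_line:
  fixes L Z :: "('k::alg_closed_field ^ 'n) set set"
  assumes "proj_line L" "P \<in> L" "irreducible_closed Z" "L \<subset> Z"
  shows "irreducible_chain Z 2 (\<lambda>i. if i = 0 then {P} else if i = 1 then L else Z)"
proof -
  have "P \<in> proj_space" using assms(1,2) by (auto simp: proj_line_def)
  moreover have "{P} \<noteq> L" using proj_line_infinite[OF assms(1)] by auto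
  ultimately show ?thesis
    using assms proj_line_irreducible[OF assms(1)]
    by (auto simp: irreducible_chain_def irreducible_closed_point less_2_cases_iff)
qed

lemma is_form_zero_scale: "is_form d F \<Longrightarrow> F y = 0 \<Longrightarrow> F (c *s y) = 0"
  using is_form_homogeneous eval_homogeneous_zero_scale by metis

section \<open>Singular points of surfaces\<close>

text \<open>
  The linear coefficient of \<open>F (x + \<epsilon> w)\<close> in \<open>\<epsilon>\<close> is the derivative of \<open>F\<close> at \<open>x\<close> in direction \<open>w\<close>.
\<close>

lemma nonsingularI:
  fixes Z L :: "('k::alg_closed_field ^ 'n) set set"
  assumes Z: "irreducible_closed Z" and L: "proj_line L" "P \<in> L" "L \<subset> Z"
    and n: "CARD('n) = 4"
    and F: "is_form d F" "\<And>y. y \<noteq> 0 \<Longrightarrow> vec.span {y} \<in> Z \<Longrightarrow> F y = 0"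
    and P: "P = vec.span {x}"
    and r: "\<And>\<epsilon>. F (x + \<epsilon> *s w) = poly r \<epsilon>" "poly.coeff r 1 \<noteq> 0"
  shows "P \<notin> singular_locus Z"
proof -
  obtain f where f: "homogeneous f" "\<And>x. F x = eval_poly (($) x) f"
    using is_form_homogeneous[OF F(1)] by metis
  \<comment> \<open>\<open>r\<close> is given only through its values; over an infinite field these
    determine its coefficients.\<close>
  have "r = curve_poly (\<lambda>i. [:x $ i, w $ i:]) f"
  proof -
    have "r - curve_poly (\<lambda>i. [:x $ i, w $ i:]) f = 0"
    proof (rule poly_eq_0_if_vanishing)
      fix T
      have "($) (x + T *s w) = (\<lambda>i. x $ i + T * w $ i)" by auto
      then show "poly (r - curve_poly (\<lambda>i. [:x $ i, w $ i:]) f) T = 0"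
        by (simp add: poly_curve_poly f(2) flip: r(1))
    qed
    then show ?thesis by simp
  qed
  then have grad: "(\<Sum>i\<in>UNIV. eval_poly (($) x) (partial_deriv i f) * w $ i) \<noteq> 0"
    using r(2) coeff_curve_poly_line[of "($) x" "($) w" f] by auto
  have "f \<in> vanishing_forms Z"
  proof -
    have "vanishes_at f Q" if "Q \<in> Z" for Q
    proof -
      have "Q \<in> proj_space" using that Z by (auto simp: irreducible_closed_def proj_closed_def)
      then obtain y where "y \<noteq> 0" "Q = vec.span {y}" by (auto simp: proj_space_def)
      then show ?thesis using F(2)[of y] that f by (simp add: vanishes_at_span)
    qed
    then show ?thesis using f(1) by (simp add: vanishing_forms_def)
  qed
  \<comment> \<open>The kernel of a single functional. It misses \<open>w\<close>, so it is a proper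
    subspace of the 4-dimensional space.\<close>
  define H where "H = {w. (\<Sum>i\<in>UNIV. eval_poly (($) x) (partial_deriv i f) * w $ i) = 0}"
  have "vec.subspace H"
    unfolding vec.subspace_def H_def
    by (auto simp: algebra_simps sum.distrib simp flip: sum_distrib_left)
  have "cone_tangent_space Z P \<subseteq> H"
    using \<open>f \<in> vanishing_forms Z\<close> vec.span_base[of x "{x}"]
    by (auto simp: cone_tangent_space_def H_def P)
  then have "vec.dim (cone_tangent_space Z P) \<le> vec.dim H" by (rule vec.dim_subset)
  also have "vec.dim H < vec.dim (UNIV :: ('k ^ 'n) set)"
  proof (rule vec.dim_psubset)
    have "w \<notin> H" using grad by (simp add: H_def)
    moreover have "vec.span H = H" using \<open>vec.subspace H\<close> by (simp only: vec.span_eq_iff)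
    ultimately show "vec.span H \<subset> vec.span UNIV" by (simp only: vec.span_UNIV) blast
  qed
  finally have "vec.dim (cone_tangent_space Z P) \<le> 3"
    using n by (simp add: vec_dim_card del: vec.dim_UNIV)
  \<comment> \<open>The final comparison is at most 3 for the tangent space against at least 2 + 1
    from this chain.\<close>
  have "enat 2 \<le> local_dim Z P"
    unfolding local_dim_def
  proof (rule SUP_upper, rule CollectI, rule exI, rule conjI)
    show "irreducible_chain Z 2 (\<lambda>i. if i = 0 then {P} else if i = 1 then L else Z)"
      by (rule irreducible_chain_point_line) fact+
  qed simp
  then have "enat 2 + 1 \<le> local_dim Z P + 1" by (rule add_right_mono)
  have "enat (vec.dim (cone_tangent_space Z P)) \<le> enat 2 + 1"
    using \<open>vec.dim (cone_tangent_space Z P) \<le> 3\<close> by (simp add: one_enat_def)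
  also have "\<dots> \<le> local_dim Z P + 1" by fact
  finally show ?thesis unfolding singular_locus_def by (simp add: not_less)
qed

lemma codim1_singular_locus_lines:
  fixes Z :: "('k::alg_closed_field ^ 'n) set set"
  assumes fin: "finite \<L>\<^sub>0" and lines: "\<And>L. L \<in> \<L>\<^sub>0 \<Longrightarrow> proj_line L"
    and sing: "singular_locus Z \<subseteq> \<Union>\<L>\<^sub>0"
  shows "\<exists>\<L>. finite \<L> \<and> (\<forall>L\<in>\<L>. proj_line L) \<and> codim1_singular_locus Z = \<Union>\<L>"
proof (intro exI conjI)
  let ?\<L> = "{C. irreducible_component (singular_locus Z) C \<and> krull_dim C = 1}"
  have "C \<in> \<L>\<^sub>0" if C: "irreducible_component (singular_locus Z) C" "krull_dim C = 1" for C
  proof -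
    have irr: "irreducible_closed C" and sub: "C \<subseteq> singular_locus Z"
      using C(1) by (auto simp: irreducible_component_def)
    have "\<exists>n K. irreducible_chain C n K \<and> n > 0"
    proof (rule ccontr)
      assume "\<not> ?thesis"
      then have "krull_dim C \<le> 0"
        unfolding krull_dim_def by (intro SUP_least) (auto simp: zero_enat_def)
      then show False using C(2) by simp
    qed
    then obtain n K where K: "irreducible_chain C n K" "n > 0" by blast
    then have "irreducible_closed (K 0)" "irreducible_closed (K 1)" "K 0 \<subset> K 1" "K 1 \<subseteq> C"
      by (auto simp: irreducible_chain_def)
    then have "infinite (K 1)"
      using irreducible_closed_finite_singleton[of "K 1"]
      by (metis all_not_in_conv irreducible_closed_def psubsetE subset_singleton_iff)
    then have "infinite C" using \<open>K 1 \<subseteq> C\<close> finite_subset by blast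
    moreover have "C = (\<Union>L\<in>\<L>\<^sub>0. C \<inter> L)" using sub sing by blast
    ultimately obtain L where L: "L \<in> \<L>\<^sub>0" "infinite (C \<inter> L)"
      using fin by (metis finite_UN_I)
    have "proj_closed C" using irr by (simp add: irreducible_closed_def)
    then have "L \<subseteq> C" using L lines proj_line_subset_closed by blast
    \<comment> \<open>A properly contained line would give a chain of length 2 in
      \<open>C\<close>.\<close>
    have "L = C"
    proof (rule ccontr)
      assume "L \<noteq> C"
      with \<open>L \<subseteq> C\<close> have "L \<subset> C" by blast
      obtain P where "P \<in> L" using L(2) by (metis Int_empty_right all_not_in_conv finite.emptyI)
      have "enat 2 \<le> krull_dim C"
        unfolding krull_dim_def
        by (rule SUP_upper, rule CollectI, rule exI, rule irreducible_chain_point_line)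
          (use L lines irr \<open>P \<in> L\<close> \<open>L \<subset> C\<close> in auto)
      then show False using C(2) by (simp add: one_enat_def)
    qed
    with L(1) show ?thesis by simp
  qed
  then have "?\<L> \<subseteq> \<L>\<^sub>0" by auto
  then show "finite ?\<L>" "\<forall>L\<in>?\<L>. proj_line L" using fin lines finite_subset by blast+
  show "codim1_singular_locus Z = \<Union>?\<L>" by (simp add: codim1_singular_locus_def)
qed

section \<open>Small systems of binary forms\<close>

lemma quadratic_form_root:
  fixes a b c :: "'k::alg_closed_field"
  obtains s t where "s \<noteq> 0 \<or> t \<noteq> 0" "a * s\<^sup>2 + b * (s * t) + c * t\<^sup>2 = 0"
proof (cases "c = 0")
  case True
  then show thesis using that[of 0 1] by simp
next
  case False
  then have "degree [:a, b, c:] > 0" by simp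
  then obtain T where "poly [:a, b, c:] T = 0" using alg_closed_imp_poly_has_root by blast
  then show thesis using that[of 1 T] by (simp add: algebra_simps power2_eq_square)
qed

lemma cubic_form_root:
  fixes a b c d :: "'k::alg_closed_field"
  obtains s t where "s \<noteq> 0 \<or> t \<noteq> 0"
    "a * s ^ 3 + b * s\<^sup>2 * t + c * s * t\<^sup>2 + d * t ^ 3 = 0"
proof (cases "d = 0")
  case True
  then show thesis using that[of 0 1] by simp
next
  case False
  then have "degree [:a, b, c, d:] > 0" by simp
  then obtain T where "poly [:a, b, c, d:] T = 0" using alg_closed_imp_poly_has_root by blast
  then show thesis
    using that[of 1 T] by (simp add: algebra_simps power2_eq_square power3_eq_cube)
qed

text \<open>If \<open>(a, b)\<close> is a nonzero row, \<open>(b, - a)\<close> kills it, and the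
  vanishing minors say that it kills the other rows. Shorter systems are padded with zero
  rows.\<close>

lemma kernel_3x2:
  fixes a b :: "'k::field"
  assumes "a * b' = a' * b" "a * b'' = a'' * b" "a' * b'' = a'' * b'"
  obtains u v where "u \<noteq> 0 \<or> v \<noteq> 0" "u * a + v * b = 0" "u * a' + v * b' = 0" "u * a'' + v * b'' = 0"
proof -
  consider "a \<noteq> 0 \<or> b \<noteq> 0" | "a' \<noteq> 0 \<or> b' \<noteq> 0" | "a'' \<noteq> 0 \<or> b'' \<noteq> 0"
    | "a = 0" "b = 0" "a' = 0" "b' = 0" "a'' = 0" "b'' = 0" by blast
  then show thesis
  proof cases
    case 1
    then show thesis using that[of b "- a"] assms by (auto simp: algebra_simps)
  next
    case 2
    then show thesis using that[of b' "- a'"] assms by (auto simp: algebra_simps)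
  next
    case 3
    then show thesis using that[of b'' "- a''"] assms by (auto simp: algebra_simps)
  next
    case 4
    then show thesis using that[of 1 0] by simp
  qed
qed

lemma divide_combination:
  fixes D :: "'k::field"
  assumes "D \<noteq> 0" "D * c = P * a + Q * b"
  shows "P / D * a + Q / D * b = c"
proof -
  have "P / D * a + Q / D * b = (P * a + Q * b) / D" by (simp add: add_divide_distrib)
  then show ?thesis using assms(1) by (simp flip: assms(2))
qed

text \<open>Cramer's rule on two rows with a nonzero minor; the remaining row follows from
  \<open>det\<close>, which says that the 3 x 3 matrix with rows \<open>(a, b, c)\<close>,
  \<open>(a', b', c')\<close>, \<open>(a'', b'', c'')\<close> is singular. If all minors vanish, the
  first two columns are dependent, against \<open>rank\<close>.\<close>

lemma solve_3x2:
  fixes a b :: "'k::field"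
  assumes det: "(a' * b'' - a'' * b') * c - (a * b'' - a'' * b) * c' + (a * b' - a' * b) * c'' = 0"
    and rank: "\<And>u v. u * a + v * b = 0 \<Longrightarrow> u * a' + v * b' = 0 \<Longrightarrow> u * a'' + v * b'' = 0 \<Longrightarrow>
      u = 0 \<and> v = 0"
  obtains u v where "u * a + v * b = c" "u * a' + v * b' = c'" "u * a'' + v * b'' = c''"
proof -
  consider "a * b' - a' * b \<noteq> 0" | "a * b'' - a'' * b \<noteq> 0" | "a' * b'' - a'' * b' \<noteq> 0"
    | "a * b' = a' * b" "a * b'' = a'' * b" "a' * b'' = a'' * b'" by auto
  then show thesis
  proof cases
    case 1
    define D where "D = a * b' - a' * b"
    have D: "D \<noteq> 0" using 1 by (simp add: D_def)
    have "D * c'' = (c * b' - c' * b) * a'' + (a * c' - a' * c) * b''"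
      using det unfolding D_def by algebra
    moreover have "D * c = (c * b' - c' * b) * a + (a * c' - a' * c) * b"
      "D * c' = (c * b' - c' * b) * a' + (a * c' - a' * c) * b'" unfolding D_def by algebra+
    ultimately show thesis
      using that[of "(c * b' - c' * b) / D" "(a * c' - a' * c) / D"] 
        divide_combination[OF D] by blast
  next
    case 2
    define D where "D = a * b'' - a'' * b"
    have D: "D \<noteq> 0" using 2 by (simp add: D_def)
    have "D * c' = (c * b'' - c'' * b) * a' + (a * c'' - a'' * c) * b'"
      using det unfolding D_def by algebra
    moreover have "D * c = (c * b'' - c'' * b) * a + (a * c'' - a'' * c) * b"
      "D * c'' = (c * b'' - c'' * b) * a'' + (a * c'' - a'' * c) * b''" unfolding D_def by algebra+
    ultimately show thesis
      using that[of "(c * b'' - c'' * b) / D" "(a * c'' - a'' * c) / D"] 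
        divide_combination[OF D] by blast
  next
    case 3
    define D where "D = a' * b'' - a'' * b'"
    have D: "D \<noteq> 0" using 3 by (simp add: D_def)
    have "D * c = (c' * b'' - c'' * b') * a + (a' * c'' - a'' * c') * b"
      using det unfolding D_def by algebra
    moreover have "D * c' = (c' * b'' - c'' * b') * a' + (a' * c'' - a'' * c') * b'"
      "D * c'' = (c' * b'' - c'' * b') * a'' + (a' * c'' - a'' * c') * b''" unfolding D_def by algebra+
    ultimately show thesis
      using that[of "(c' * b'' - c'' * b') / D" "(a' * c'' - a'' * c') / D"] 
        divide_combination[OF D] by blast
  next
    case 4
    then obtain u v where "u \<noteq> 0 \<or> v \<noteq> 0" "u * a + v * b = 0" "u * a' + v * b' = 0" "u * a'' + v * b'' = 0"
      by (rule kernel_3x2)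
    then show thesis using rank by blast
  qed
qed

text \<open>
  The resultant of two binary quadratic forms \<open>f\<close>, \<open>g\<close> is \<open>m\<^sub>1\<^sup>2 - m\<^sub>0 m\<^sub>2\<close> for the cross product
  \<open>m = f \<times> g\<close> of their coefficient vectors: at a common zero, \<open>m\<close> is proportional to
  \<open>(s\<^sup>2, s t, t\<^sup>2)\<close>.
\<close>

lemma resultant_zero_if_common_root:
  fixes s t :: "'k::field"
  assumes st: "s \<noteq> 0 \<or> t \<noteq> 0"
    and f: "f0 * s\<^sup>2 + f1 * (s * t) + f2 * t\<^sup>2 = 0"
    and g: "g0 * s\<^sup>2 + g1 * (s * t) + g2 * t\<^sup>2 = 0"
  shows "(f2 * g0 - f0 * g2)\<^sup>2 = (f1 * g2 - f2 * g1) * (f0 * g1 - f1 * g0)"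
proof -
  define m0 m1 m2 where m: "m0 = f1 * g2 - f2 * g1" "m1 = f2 * g0 - f0 * g2" "m2 = f0 * g1 - f1 * g0"
  have 1: "m1 * s\<^sup>2 = m0 * (s * t)" using f g unfolding m by algebra
  have 2: "m1 * t\<^sup>2 = m2 * (s * t)" using f g unfolding m by algebra
  have 3: "m0 * t\<^sup>2 = m2 * s\<^sup>2" using f g unfolding m by algebra
  have "s ^ 4 * (m1\<^sup>2 - m0 * m2) = 0" using 1 2 3 by algebra
  moreover have "t ^ 4 * (m1\<^sup>2 - m0 * m2) = 0" using 1 2 3 by algebra
  ultimately have "m1\<^sup>2 - m0 * m2 = 0" using st by auto
  then show ?thesis by (simp add: m)
qed

text \<open>The cross product \<open>m\<close> is orthogonal to \<open>f\<close> and
  \<open>g\<close>. If it is nonzero, the equation places it, up to a factor, on the conic of all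
  \<open>(s^2, s t, t^2)\<close>, with root \<open>(m0 : m1)\<close>, or \<open>(0 : 1)\<close> when
  \<open>m0 = 0\<close>. If \<open>m = 0\<close>, the forms are proportional, and a root of
  \<open>f\<close>, or of \<open>g\<close> if \<open>f = 0\<close>, is shared.\<close>

lemma common_root_if_resultant_zero:
  fixes f0 f1 f2 g0 g1 g2 :: "'k::alg_closed_field"
  assumes res: "(f2 * g0 - f0 * g2)\<^sup>2 = (f1 * g2 - f2 * g1) * (f0 * g1 - f1 * g0)"
  obtains s t where "s \<noteq> 0 \<or> t \<noteq> 0" "f0 * s\<^sup>2 + f1 * (s * t) + f2 * t\<^sup>2 = 0"
    "g0 * s\<^sup>2 + g1 * (s * t) + g2 * t\<^sup>2 = 0"
proof -
  define m0 m1 m2 where m: "m0 = f1 * g2 - f2 * g1" "m1 = f2 * g0 - f0 * g2" "m2 = f0 * g1 - f1 * g0"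
  have r: "m1\<^sup>2 = m0 * m2" using res by (simp add: m)
  have fm: "f0 * m0 + f1 * m1 + f2 * m2 = 0" "g0 * m0 + g1 * m1 + g2 * m2 = 0"
    unfolding m by algebra+
  have m10: "m1 = 0" if "m0 = 0" using r that by simp
  consider "m0 \<noteq> 0" | "m0 = 0" "m1 = 0" "m2 \<noteq> 0" | "m0 = 0" "m1 = 0" "m2 = 0"
    using m10 by blast
  then show thesis
  proof cases
    case 1
    have "f0 * m0\<^sup>2 + f1 * (m0 * m1) + f2 * m1\<^sup>2 = 0" "g0 * m0\<^sup>2 + g1 * (m0 * m1) + g2 * m1\<^sup>2 = 0"
      using fm r by algebra+
    then show thesis using that[of m0 m1] 1 by simp
  next
    case 2
    then show thesis using that[of 0 1] fm by simp
  next
    case 3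
    then have 0: "f1 * g2 = f2 * g1" "f2 * g0 = f0 * g2" "f0 * g1 = f1 * g0" by (simp_all add: m)
    show thesis
    proof (cases "f0 = 0 \<and> f1 = 0 \<and> f2 = 0")
      case True
      obtain s t where "s \<noteq> 0 \<or> t \<noteq> 0" "g0 * s\<^sup>2 + g1 * (s * t) + g2 * t\<^sup>2 = 0"
        by (rule quadratic_form_root)
      then show thesis using that[of s t] True by simp
    next
      case False
      obtain s t where st: "s \<noteq> 0 \<or> t \<noteq> 0" "f0 * s\<^sup>2 + f1 * (s * t) + f2 * t\<^sup>2 = 0"
        by (rule quadratic_form_root)
      let ?g = "g0 * s\<^sup>2 + g1 * (s * t) + g2 * t\<^sup>2"
      have "f0 * ?g = 0" "f1 * ?g = 0" "f2 * ?g = 0" using 0 st(2) by algebra+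
      then have "?g = 0" using False by auto
      then show thesis using that[of s t] st by simp
    qed
  qed
qed

section \<open>Surfaces parametrized in bidegree (2,1)\<close>

text \<open>The six vectors hold the coefficients of
  \<open>u s^2, u s t, u t^2, v s^2, v s t, v t^2\<close> in the four \<open>p i\<close>, and
  \<open>nz\<close> is basepoint freeness. With vectors, a change of coordinates on the target is a
  matrix product.\<close>

locale tensor_surface =
  fixes A0 A1 A2 B0 B1 B2 :: "'k::alg_closed_field ^ 4"
  assumes nz: "s \<noteq> 0 \<or> t \<noteq> 0 \<Longrightarrow> u \<noteq> 0 \<or> v \<noteq> 0 \<Longrightarrow>
    u *s (s\<^sup>2 *s A0 + (s * t) *s A1 + t\<^sup>2 *s A2) +
    v *s (s\<^sup>2 *s B0 + (s * t) *s B1 + t\<^sup>2 *s B2) \<noteq> 0"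
begin

definition \<Phi> :: "'k \<Rightarrow> 'k \<Rightarrow> 'k \<Rightarrow> 'k \<Rightarrow> 'k ^ 4" where
  "\<Phi> s t u v = u *s (s\<^sup>2 *s A0 + (s * t) *s A1 + t\<^sup>2 *s A2) +
    v *s (s\<^sup>2 *s B0 + (s * t) *s B1 + t\<^sup>2 *s B2)"

definition X :: "('k ^ 4) set set" where
  "X = {vec.span {\<Phi> s t u v} | s t u v. (s \<noteq> 0 \<or> t \<noteq> 0) \<and> (u \<noteq> 0 \<or> v \<noteq> 0)}"

definition ruling :: "'k \<Rightarrow> 'k \<Rightarrow> ('k ^ 4) set set" where
  "ruling s t = {vec.span {\<Phi> s t u v} | u v. u \<noteq> 0 \<or> v \<noteq> 0}"

lemma \<Phi>_nonzero: "s \<noteq> 0 \<or> t \<noteq> 0 \<Longrightarrow> u \<noteq> 0 \<or> v \<noteq> 0 \<Longrightarrow> \<Phi> s t u v \<noteq> 0"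
  unfolding \<Phi>_def by (rule nz)

lemma \<Phi>_nth: "\<Phi> s t u v $ i = u * (s\<^sup>2 * A0 $ i + (s * t) * A1 $ i + t\<^sup>2 * A2 $ i) +
    v * (s\<^sup>2 * B0 $ i + (s * t) * B1 $ i + t\<^sup>2 * B2 $ i)"
  by (simp add: \<Phi>_def)

lemma X_subset: "X \<subseteq> proj_space"
  unfolding X_def using span_in_proj_space \<Phi>_nonzero by blast

lemma X_memI: "s \<noteq> 0 \<or> t \<noteq> 0 \<Longrightarrow> u \<noteq> 0 \<or> v \<noteq> 0 \<Longrightarrow> vec.span {\<Phi> s t u v} \<in> X"
  by (auto simp: X_def)

lemma \<Phi>_scale: "\<Phi> (c * s) (c * t) u v = c\<^sup>2 *s \<Phi> s t u v"
  by (simp add: vec_eq_iff \<Phi>_nth algebra_simps power2_eq_square)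

text \<open>For fixed \<open>(s : t)\<close> the map is linear in \<open>(u, v)\<close> and has no
  zero, so its two basis values are independent.\<close>

lemma proj_line_ruling:
  assumes "s \<noteq> 0 \<or> t \<noteq> 0"
  shows "proj_line (ruling s t)"
proof -
  have lin: "\<Phi> s t u v = u *s \<Phi> s t 1 0 + v *s \<Phi> s t 0 1" for u v
    by (simp add: \<Phi>_def)
  have "proj_line {vec.span {u *s \<Phi> s t 1 0 + v *s \<Phi> s t 0 1} | u v. u \<noteq> 0 \<or> v \<noteq> 0}"
    by (rule proj_line_span) (use \<Phi>_nonzero[OF assms] in \<open>auto simp flip: lin\<close>)
  then show ?thesis by (simp add: ruling_def flip: lin)
qed

lemma ruling_subset_X: "s \<noteq> 0 \<or> t \<noteq> 0 \<Longrightarrow> ruling s t \<subseteq> X"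
  unfolding ruling_def X_def by blast

text \<open>
  If \<open>X\<close> is covered by two closed sets, each ruling line lies in one of them, so one of them, say \<open>A\<close>, contains
  infinitely many ruling lines. Then \<open>A\<close> contains infinitely many points of each curve
  \<open>(s : t) \<mapsto> \<Phi> s t u v\<close>, hence the whole curve.
\<close>

lemma X_subset_if_infinite_rulings:
  assumes A: "proj_closed A" and inf: "infinite {T. ruling 1 T \<subseteq> A}"
  shows "X \<subseteq> A"
proof -
  have 1: "vec.span {\<Phi> 1 T u v} \<in> A" if uv: "u \<noteq> 0 \<or> v \<noteq> 0" for T u v
  proof (rule proj_closed_curve[OF A, where \<gamma> = "\<lambda>T. \<Phi> 1 T u v" and r = "\<lambda>i. [:u * A0 $ i + v * B0 $ i,
          u * A1 $ i + v * B1 $ i, u * A2 $ i + v * B2 $ i:]"])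
    show "\<Phi> 1 T u v $ i = poly [:u * A0 $ i + v * B0 $ i,
        u * A1 $ i + v * B1 $ i, u * A2 $ i + v * B2 $ i:] T" for T i
      by (simp add: \<Phi>_nth algebra_simps power2_eq_square)
    have "{T. ruling 1 T \<subseteq> A} \<subseteq> {T. \<Phi> 1 T u v \<noteq> 0 \<and> vec.span {\<Phi> 1 T u v} \<in> A}"
      using uv \<Phi>_nonzero[of 1 _ u v] by (auto simp: ruling_def)
    then show "infinite {T. \<Phi> 1 T u v \<noteq> 0 \<and> vec.span {\<Phi> 1 T u v} \<in> A}"
      using inf finite_subset by blast
    show "\<Phi> 1 T u v \<noteq> 0" using uv \<Phi>_nonzero[of 1] by simp
  qed
  have 2: "vec.span {\<Phi> s t u v} \<in> A" if "u \<noteq> 0 \<or> v \<noteq> 0" "s \<noteq> 0" for s t u v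
  proof -
    have "\<Phi> s t u v = s\<^sup>2 *s \<Phi> 1 (t / s) u v"
      using \<Phi>_scale[of s 1 "t / s" u v] that(2) by simp
    then show ?thesis using 1[OF that(1)] that(2) by (simp add: span_scale)
  qed
  \<comment> \<open>The fibre over \<open>s = 0\<close> is the value at \<open>S = 0\<close> in the
    chart \<open>t = 1\<close>, where the coefficients appear in reverse order.\<close>
  have 3: "vec.span {\<Phi> 0 1 u v} \<in> A" if uv: "u \<noteq> 0 \<or> v \<noteq> 0" for u v
  proof (rule proj_closed_curve[OF A, where \<gamma> = "\<lambda>S. \<Phi> S 1 u v" and r = "\<lambda>i. [:u * A2 $ i + v * B2 $ i,
          u * A1 $ i + v * B1 $ i, u * A0 $ i + v * B0 $ i:]"])
    show "\<Phi> S 1 u v $ i = poly [:u * A2 $ i + v * B2 $ i,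
        u * A1 $ i + v * B1 $ i, u * A0 $ i + v * B0 $ i:] S" for S i
      by (simp add: \<Phi>_nth algebra_simps power2_eq_square)
    have "- {0} \<subseteq> {S. \<Phi> S 1 u v \<noteq> 0 \<and> vec.span {\<Phi> S 1 u v} \<in> A}"
      using uv \<Phi>_nonzero[of _ 1 u v] 2 by auto
    moreover have "infinite (- {0 :: 'k})" using infinite_alg_closed[where ?'k = 'k] by simp
    ultimately show "infinite {S. \<Phi> S 1 u v \<noteq> 0 \<and> vec.span {\<Phi> S 1 u v} \<in> A}"
      using finite_subset by blast
    show "\<Phi> 0 1 u v \<noteq> 0" using uv \<Phi>_nonzero[of 0 1] by simp
  qed
  have 4: "vec.span {\<Phi> 0 t u v} \<in> A" if "u \<noteq> 0 \<or> v \<noteq> 0" "t \<noteq> 0" for t u v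
  proof -
    have "\<Phi> 0 t u v = t\<^sup>2 *s \<Phi> 0 1 u v"
      using \<Phi>_scale[of t 0 1 u v] by simp
    then show ?thesis using 3[OF that(1)] that(2) by (simp add: span_scale)
  qed
  show ?thesis
  proof
    fix P assume "P \<in> X"
    then obtain s t u v where P: "P = vec.span {\<Phi> s t u v}" "s \<noteq> 0 \<or> t \<noteq> 0" "u \<noteq> 0 \<or> v \<noteq> 0"
      unfolding X_def by blast
    then show "P \<in> A" using 2 4 by (cases "s = 0") auto
  qed
qed

lemma irreducible_closed_X:
  assumes "proj_closed X"
  shows "irreducible_closed X"
  unfolding irreducible_closed_def
proof (intro conjI allI impI)
  show "proj_closed X" by fact
  show "X \<noteq> {}" using X_memI[of 1 0 1 0] by auto
  fix A B assume AB: "proj_closed A" "proj_closed B" "X = A \<union> B"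
  have "ruling 1 T \<subseteq> A \<or> ruling 1 T \<subseteq> B" for T
  proof -
    have L: "proj_line (ruling 1 T)" by (rule proj_line_ruling) simp
    have "ruling 1 T = (A \<inter> ruling 1 T) \<union> (B \<inter> ruling 1 T)"
      using ruling_subset_X[of 1 T] AB(3) by auto
    then have "infinite (A \<inter> ruling 1 T) \<or> infinite (B \<inter> ruling 1 T)"
      using proj_line_infinite[OF L] by (metis finite_Un)
    then show ?thesis using proj_line_subset_closed[OF L] AB(1,2) by blast
  qed
  then have "UNIV = {T. ruling 1 T \<subseteq> A} \<union> {T. ruling 1 T \<subseteq> B}" by auto
  then have "infinite {T. ruling 1 T \<subseteq> A} \<or> infinite {T. ruling 1 T \<subseteq> B}"
    using infinite_alg_closed[where ?'k = 'k] by (metis finite_Un)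
  then have "X \<subseteq> A \<or> X \<subseteq> B" using X_subset_if_infinite_rulings AB(1,2) by blast
  then show "X = A \<or> X = B" using AB(3) by blast
qed

text \<open>\<open>L\<close> avoids the point, so it witnesses that the surface is larger than the
  ruling line through that point. This makes the inclusions in the chain strict.\<close>

lemma nonsingular_point:
  assumes F: "is_form d F" "\<And>x. x \<noteq> 0 \<Longrightarrow> vec.span {x} \<in> X \<longleftrightarrow> F x = 0"
    and L: "proj_line L" "L \<subseteq> X" "vec.span {x} \<notin> L"
    and x: "x = \<Phi> s t u v" "s \<noteq> 0 \<or> t \<noteq> 0" "u \<noteq> 0 \<or> v \<noteq> 0"
    and r: "\<And>\<epsilon>. F (x + \<epsilon> *s w) = poly r \<epsilon>" "poly.coeff r 1 \<noteq> 0"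
  shows "vec.span {x} \<notin> singular_locus X"
proof (rule nonsingularI)
  have "proj_closed X" by (rule proj_closed_form[OF F(1) X_subset F(2)])
  then show "irreducible_closed X" by (rule irreducible_closed_X)
  show line: "proj_line (ruling s t)" using x(2) by (rule proj_line_ruling)
  show mem: "vec.span {x} \<in> ruling s t" using x(1,3) by (auto simp: ruling_def)
  have "ruling s t \<noteq> X"
  proof
    assume "ruling s t = X"
    then have "infinite (L \<inter> ruling s t)"
      using L proj_line_infinite[of L] by (simp add: Int_absorb2)
    then have "ruling s t \<subseteq> L"
      using line L(1) proj_line_closed proj_line_subset_closed by blast
    then show False using mem L(3) by blast
  qed
  then show "ruling s t \<subset> X" using ruling_subset_X[OF x(2)] by blast
  show "CARD(4) = (4 :: nat)" by simp
  show "is_form d F" "\<And>y. y \<noteq> 0 \<Longrightarrow> vec.span {y} \<in> X \<Longrightarrow> F y = 0" using F by auto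
qed (use r in auto)

end

section \<open>Linear coordinates\<close>

definition dot :: "'k::comm_ring_1 ^ 'n \<Rightarrow> 'k ^ 'n \<Rightarrow> 'k" where
  "dot c x = (\<Sum>i\<in>UNIV. c $ i * x $ i)"

lemma dot_add: "dot (c + d) x = dot c x + dot d x"
  by (simp add: dot_def distrib_right sum.distrib)

lemma dot_scale: "dot (a *s c) x = a * dot c x"
  by (simp add: dot_def sum_distrib_left mult.assoc)

lemma dot_add_right: "dot c (x + y) = dot c x + dot c y"
  by (simp add: dot_def distrib_left sum.distrib)

lemma dot_scale_right: "dot c (a *s x) = a * dot c x"
  by (simp add: dot_def sum_distrib_left mult_ac)

lemma dot_0 [simp]: "dot 0 x = 0"
  by (simp add: dot_def)

lemma matrix_invertible_mult_axis:
  fixes G H :: "'k::field ^ 'n ^ 'n"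
  assumes "G ** H = mat 1"
  shows "(G *v (H *v axis j 1)) $ i = (if i = j then 1 else 0)"
  using assms by (simp add: matrix_vector_mul_assoc axis_def)

text \<open>The rows of \<open>G\<close> become coordinate functions \<open>z i\<close>, and the
  columns of the inverse \<open>H\<close> are the dual basis \<open>h j\<close>, so that
  \<open>x + \<epsilon> *s h j\<close> moves one coordinate only.\<close>

locale surface_coordinates = tensor_surface A0 A1 A2 B0 B1 B2
  for A0 A1 A2 B0 B1 B2 :: "'k::alg_closed_field ^ 4" +
  fixes G H :: "'k ^ 4 ^ 4"
  assumes GH: "G ** H = mat 1" and HG: "H ** G = mat 1"
begin

definition z :: "4 \<Rightarrow> 'k ^ 4 \<Rightarrow> 'k" where
  "z i x = (G *v x) $ i"

definition h :: "4 \<Rightarrow> 'k ^ 4" where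
  "h j = H *v axis j 1"

lemma z_h: "z i (h j) = (if i = j then 1 else 0)"
  unfolding z_def h_def using GH by (rule matrix_invertible_mult_axis)

lemma z_dot: "z i x = dot (G $ i) x"
  by (simp add: z_def dot_def matrix_vector_mult_def)

lemma z_add: "z i (x + y) = z i x + z i y"
  by (simp add: z_def matrix_vector_right_distrib)

lemma z_scale: "z i (c *s x) = c * z i x"
  by (simp add: z_def matrix_vector_mult_scaleR vector_scalar_commute)

lemma z_0: "z i 0 = 0"
  by (simp add: z_def)

lemma z_inj:
  assumes "\<And>i. z i x = z i y"
  shows "x = y"
proof -
  have "G *v x = G *v y" using assms by (simp add: z_def vec_eq_iff)
  then have "H *v (G *v x) = H *v (G *v y)" by simp
  then show ?thesis by (simp add: matrix_vector_mul_assoc HG)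
qed

lemma z_eqI:
  assumes "z 1 x = z 1 y" "z 2 x = z 2 y" "z 3 x = z 3 y" "z 4 x = z 4 y"
  shows "x = y"
proof (rule z_inj)
  fix i :: 4
  show "z i x = z i y" using assms exhaust_4[of i] by auto
qed

lemma is_form_z: "is_form 1 (z i)"
  unfolding z_def matrix_vector_mult_def
  by (simp del: One_nat_def) (intro is_form_sum is_form_cmult is_form_coord)

lemma z_\<Phi>: "z i (\<Phi> s t u v) = u * (s\<^sup>2 * z i A0 + (s * t) * z i A1 + t\<^sup>2 * z i A2) +
    v * (s\<^sup>2 * z i B0 + (s * t) * z i B1 + t\<^sup>2 * z i B2)"
  by (simp add: \<Phi>_def z_add z_scale)

lemma z_line: "z i (x + \<epsilon> *s h j) = (if i = j then z i x + \<epsilon> else z i x)"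
  by (simp add: z_add z_scale z_h)

definition base_line :: "('k ^ 4) set set" where
  "base_line = {vec.span {a *s h 3 + b *s h 4} | a b. a \<noteq> 0 \<or> b \<noteq> 0}"

lemma z_base: "z 1 (a *s h 3 + b *s h 4) = 0" "z 2 (a *s h 3 + b *s h 4) = 0"
  "z 3 (a *s h 3 + b *s h 4) = a" "z 4 (a *s h 3 + b *s h 4) = b"
  by (simp_all add: z_add z_scale z_h)

lemma proj_line_base_line: "proj_line base_line"
  unfolding base_line_def
proof (rule proj_line_span)
  fix a b assume "a *s h 3 + b *s h 4 = 0"
  then have "z 3 (a *s h 3 + b *s h 4) = 0" "z 4 (a *s h 3 + b *s h 4) = 0"
    by (simp_all only: z_0)
  then show "a = 0 \<and> b = 0" by (simp only: z_base)
qed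

lemma base_line_mem:
  assumes "x \<noteq> 0"
  shows "vec.span {x} \<in> base_line \<longleftrightarrow> z 1 x = 0 \<and> z 2 x = 0"
proof
  assume "vec.span {x} \<in> base_line"
  then obtain a b where eq: "vec.span {x} = vec.span {a *s h 3 + b *s h 4}"
    unfolding base_line_def by blast
  have "x \<in> vec.span {x}" by (rule vec.span_base) simp
  then obtain c where "x = c *s (a *s h 3 + b *s h 4)"
    unfolding eq span_singleton_mem by blast
  then show "z 1 x = 0 \<and> z 2 x = 0" by (simp only: z_scale z_base) simp
next
  assume 0: "z 1 x = 0 \<and> z 2 x = 0"
  have x: "x = z 3 x *s h 3 + z 4 x *s h 4" by (rule z_eqI) (simp_all add: 0 z_base)
  then have "z 3 x \<noteq> 0 \<or> z 4 x \<noteq> 0" using assms by auto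
  then show "vec.span {x} \<in> base_line" unfolding base_line_def mem_Collect_eq
    by (intro exI[of _ "z 3 x"] exI[of _ "z 4 x"]) (simp flip: x)
qed

text \<open>The premise leaves \<open>c\<close> arbitrary: as \<open>\<Phi>\<close> has no zero,
  \<open>c\<close> cannot be 0. Preimages can thus be built without checking that the factor is
  invertible.\<close>

lemma X_zero_set:
  assumes F: "is_form d F" and \<Phi>: "\<And>s t u v. s \<noteq> 0 \<or> t \<noteq> 0 \<Longrightarrow> F (\<Phi> s t u v) = 0"
    and preimage: "\<And>x. x \<noteq> 0 \<Longrightarrow> F x = 0 \<Longrightarrow>
      \<exists>s t u v c. (s \<noteq> 0 \<or> t \<noteq> 0) \<and> (u \<noteq> 0 \<or> v \<noteq> 0) \<and> \<Phi> s t u v = c *s x"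
    and x: "x \<noteq> 0"
  shows "vec.span {x} \<in> X \<longleftrightarrow> F x = 0"
proof
  assume "vec.span {x} \<in> X"
  then obtain s t u v where st: "s \<noteq> 0 \<or> t \<noteq> 0" and eq: "vec.span {x} = vec.span {\<Phi> s t u v}"
    unfolding X_def by blast
  have "x \<in> vec.span {x}" by (rule vec.span_base) simp
  then obtain c where "x = c *s \<Phi> s t u v" unfolding eq span_singleton_mem by blast
  then show "F x = 0" using is_form_zero_scale[OF F \<Phi>[OF st]] by simp
next
  assume "F x = 0"
  then obtain s t u v c where
    *: "s \<noteq> 0 \<or> t \<noteq> 0" "u \<noteq> 0 \<or> v \<noteq> 0" "\<Phi> s t u v = c *s x"
    using preimage[OF x] by blast
  then have "c \<noteq> 0" using \<Phi>_nonzero[OF *(1,2)] by auto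
  then have "vec.span {x} = vec.span {\<Phi> s t u v}" using *(3) by (simp add: span_scale)
  then show "vec.span {x} \<in> X" using X_memI *(1,2) by simp
qed

text \<open>On the base line a point is its ratio \<open>z 3 : z 4\<close>, so hitting it costs a
  single equation, which is linear in \<open>(u, v)\<close> when \<open>y\<close> is a value of
  \<open>\<Phi>\<close>.\<close>

lemma base_line_preimage:
  assumes x: "x \<noteq> 0" "z 1 x = 0" "z 2 x = 0" and y: "z 1 y = 0" "z 2 y = 0"
    and eq: "z 4 x * z 3 y = z 3 x * z 4 y"
  shows "\<exists>c. y = c *s x"
proof -
  have "z 3 x \<noteq> 0 \<or> z 4 x \<noteq> 0"
  proof (rule ccontr)
    assume "\<not> ?thesis"
    then have "x = 0" by (intro z_eqI) (simp_all add: x z_0)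
    then show False using x(1) by simp
  qed
  then show ?thesis
  proof
    assume "z 3 x \<noteq> 0"
    then have "y = (z 3 y / z 3 x) *s x"
      using eq by (intro z_eqI) (simp_all add: x y z_scale field_simps)
    then show ?thesis ..
  next
    assume "z 4 x \<noteq> 0"
    then have "y = (z 4 y / z 4 x) *s x"
      using eq by (intro z_eqI) (simp_all add: x y z_scale field_simps)
    then show ?thesis ..
  qed
qed

end

section \<open>A linear syzygy of bidegree (1,0)\<close>

text \<open>
  The syzygy makes the first two coordinates \<open>s q\<close> and \<open>t q\<close> with \<open>q = u (a0 s + a1 t) + v (b0 s + b1 t)\<close>.
  Away from the base line, \<open>(s : t)\<close> is read off from them and the point lies on the line spanned by
  two columns of the \<open>3 \<times> 3\<close> determinant \<open>F\<close>.
\<close>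

locale syzygy_st = surface_coordinates A0 A1 A2 B0 B1 B2 G H
  for A0 A1 A2 B0 B1 B2 :: "'k::alg_closed_field ^ 4" and G H :: "'k ^ 4 ^ 4" +
  fixes a0 a1 b0 b1 :: 'k
  assumes z1: "z 1 A0 = a0" "z 1 A1 = a1" "z 1 A2 = 0" "z 1 B0 = b0" "z 1 B1 = b1" "z 1 B2 = 0"
    and z2: "z 2 A0 = 0" "z 2 A1 = a0" "z 2 A2 = a1" "z 2 B0 = 0" "z 2 B1 = b0" "z 2 B2 = b1"
begin

definition qa where "qa s t = a0 * s + a1 * t"
definition qb where "qb s t = b0 * s + b1 * t"
definition ca where "ca s t = s\<^sup>2 * z 3 A0 + (s * t) * z 3 A1 + t\<^sup>2 * z 3 A2"
definition cb where "cb s t = s\<^sup>2 * z 3 B0 + (s * t) * z 3 B1 + t\<^sup>2 * z 3 B2"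
definition da where "da s t = s\<^sup>2 * z 4 A0 + (s * t) * z 4 A1 + t\<^sup>2 * z 4 A2"
definition db where "db s t = s\<^sup>2 * z 4 B0 + (s * t) * z 4 B1 + t\<^sup>2 * z 4 B2"

text \<open>The determinant with columns \<open>(qa, ca, da)\<close>, \<open>(qb, cb, db)\<close>
  and \<open>(1, z 3 x, z 4 x)\<close> at \<open>(s, t) = (z 1 x, z 2 x)\<close>, expanded along the
  last column. The entry 1 is the normalization \<open>u * qa s t + v * qb s t = 1\<close>, under
  which \<open>s\<close> and \<open>t\<close> are themselves the first two coordinates.\<close>

definition F where
  "F x = (ca (z 1 x) (z 2 x) * db (z 1 x) (z 2 x) - da (z 1 x) (z 2 x) * cb (z 1 x) (z 2 x)) -
    (qa (z 1 x) (z 2 x) * db (z 1 x) (z 2 x) - da (z 1 x) (z 2 x) * qb (z 1 x) (z 2 x)) * z 3 x +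
    (qa (z 1 x) (z 2 x) * cb (z 1 x) (z 2 x) - ca (z 1 x) (z 2 x) * qb (z 1 x) (z 2 x)) * z 4 x"

lemma z12_\<Phi>: "z 1 (\<Phi> s t u v) = s * (u * qa s t + v * qb s t)"
  "z 2 (\<Phi> s t u v) = t * (u * qa s t + v * qb s t)"
  by (simp_all add: z_\<Phi> z1 z2 qa_def qb_def algebra_simps power2_eq_square)

lemma z34_\<Phi>: "z 3 (\<Phi> s t u v) = u * ca s t + v * cb s t"
  "z 4 (\<Phi> s t u v) = u * da s t + v * db s t"
  by (simp_all add: z_\<Phi> ca_def cb_def da_def db_def)

text \<open>Basepoint freeness in another form: such a relation makes all four coordinates of
  \<open>\<Phi> s t u v\<close> vanish.\<close>

lemma columns_independent:
  assumes "s \<noteq> 0 \<or> t \<noteq> 0" "u * qa s t + v * qb s t = 0" "u * ca s t + v * cb s t = 0"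
    "u * da s t + v * db s t = 0"
  shows "u = 0 \<and> v = 0"
proof (rule ccontr)
  assume "\<not> (u = 0 \<and> v = 0)"
  then have "\<Phi> s t u v \<noteq> 0" using assms(1) by (intro \<Phi>_nonzero) auto
  moreover have "\<Phi> s t u v = 0"
    by (rule z_eqI) (simp_all add: z12_\<Phi> z34_\<Phi> assms z_0)
  ultimately show False by simp
qed

lemma is_form_F: "is_form 4 F"
proof -
  have q: "is_form 1 (\<lambda>x. qa (z 1 x) (z 2 x))" "is_form 1 (\<lambda>x. qb (z 1 x) (z 2 x))"
    unfolding qa_def qb_def by (intro is_form_add is_form_cmult is_form_z)+
  have quad: "is_form 2 (\<lambda>x. (z 1 x)\<^sup>2 * k0 + (z 1 x * z 2 x) * k1 + (z 2 x)\<^sup>2 * k2)" for k0 k1 k2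
  proof -
    have "is_form 2 (\<lambda>x. k0 * (z 1 x * z 1 x) + k1 * (z 1 x * z 2 x) + k2 * (z 2 x * z 2 x))"
      by (intro is_form_add is_form_cmult) (rule is_form_mult'[OF is_form_z is_form_z], simp)+
    then show ?thesis by (simp add: power2_eq_square mult.commute)
  qed
  have c: "is_form 2 (\<lambda>x. ca (z 1 x) (z 2 x))" "is_form 2 (\<lambda>x. cb (z 1 x) (z 2 x))"
    "is_form 2 (\<lambda>x. da (z 1 x) (z 2 x))" "is_form 2 (\<lambda>x. db (z 1 x) (z 2 x))"
    unfolding ca_def cb_def da_def db_def by (rule quad)+
  have 1: "is_form 4 (\<lambda>x. ca (z 1 x) (z 2 x) * db (z 1 x) (z 2 x) -
      da (z 1 x) (z 2 x) * cb (z 1 x) (z 2 x))"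
    by (intro is_form_diff is_form_mult'[OF c(1) c(4)] is_form_mult'[OF c(3) c(2)]) simp_all
  have 2: "is_form 3 (\<lambda>x. qa (z 1 x) (z 2 x) * db (z 1 x) (z 2 x) -
      da (z 1 x) (z 2 x) * qb (z 1 x) (z 2 x))"
    by (intro is_form_diff is_form_mult'[OF q(1) c(4)] is_form_mult'[OF c(3) q(2)]) simp_all
  have 3: "is_form 3 (\<lambda>x. qa (z 1 x) (z 2 x) * cb (z 1 x) (z 2 x) -
      ca (z 1 x) (z 2 x) * qb (z 1 x) (z 2 x))"
    by (intro is_form_diff is_form_mult'[OF q(1) c(2)] is_form_mult'[OF c(1) q(2)]) simp_all
  show ?thesis
    unfolding F_def
    by (intro is_form_add is_form_diff 1 is_form_mult'[OF 2 is_form_z] is_form_mult'[OF 3 is_form_z])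
      simp_all
qed

lemma quad_scale: "(s * q)\<^sup>2 * k0 + (s * q * (t * q)) * k1 + (t * q)\<^sup>2 * k2 =
    q\<^sup>2 * (s\<^sup>2 * k0 + (s * t) * k1 + t\<^sup>2 * k2 :: 'k)"
  by (simp add: algebra_simps power2_eq_square)

lemma F_\<Phi>: "F (\<Phi> s t u v) = 0"
proof -
  define q where "q = u * qa s t + v * qb s t"
  have qq: "qa (s * q) (t * q) = q * qa s t" "qb (s * q) (t * q) = q * qb s t"
    by (simp_all add: qa_def qb_def algebra_simps)
  have c: "ca (s * q) (t * q) = q\<^sup>2 * ca s t" "cb (s * q) (t * q) = q\<^sup>2 * cb s t"
    "da (s * q) (t * q) = q\<^sup>2 * da s t" "db (s * q) (t * q) = q\<^sup>2 * db s t"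
    unfolding ca_def cb_def da_def db_def by (rule quad_scale)+
  \<comment> \<open>With \<open>(s q, t q)\<close> in place of \<open>(s, t)\<close> the three
    minors pick up \<open>q^4\<close>, \<open>q^3\<close> and \<open>q^3\<close>. What remains is
    \<open>q^3\<close> times a determinant whose last column is \<open>u\<close> times the first
    plus \<open>v\<close> times the second.\<close>
  show ?thesis
    unfolding F_def z12_\<Phi> z34_\<Phi> q_def[symmetric] qq c using q_def by algebra
qed

lemma preimage:
  assumes x: "x \<noteq> 0" "F x = 0"
  shows "\<exists>s t u v c. (s \<noteq> 0 \<or> t \<noteq> 0) \<and> (u \<noteq> 0 \<or> v \<noteq> 0) \<and> \<Phi> s t u v = c *s x"
proof (cases "z 1 x = 0 \<and> z 2 x = 0")
  case False
  define s t where st: "s = z 1 x" "t = z 2 x"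
  have nz: "s \<noteq> 0 \<or> t \<noteq> 0" using False by (simp add: st)
  have "(ca s t * db s t - da s t * cb s t) * 1 - (qa s t * db s t - da s t * qb s t) * z 3 x +
      (qa s t * cb s t - ca s t * qb s t) * z 4 x = 0"
    using x(2) by (simp add: F_def st)
  then obtain u v where uv: "u * qa s t + v * qb s t = 1" "u * ca s t + v * cb s t = z 3 x"
    "u * da s t + v * db s t = z 4 x"
    by (rule solve_3x2) (use columns_independent[OF nz] in blast)+
  have "\<Phi> s t u v = 1 *s x"
    by (rule z_eqI) (simp_all add: z12_\<Phi> z34_\<Phi> uv, simp_all add: st)
  moreover have "u \<noteq> 0 \<or> v \<noteq> 0" using uv(1) by auto
  ultimately show ?thesis using nz by blast
next
  case True
  define k where "k f g = z 4 x * f - z 3 x * (g :: 'k)" for f g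
  define k0 k1 k2 where k: "k0 = k (z 3 B0) (z 4 B0)" "k1 = k (z 3 B1) (z 4 B1)" "k2 = k (z 3 B2) (z 4 B2)"
  define l0 l1 l2 where l: "l0 = k (z 3 A0) (z 4 A0)" "l1 = k (z 3 A1) (z 4 A1)" "l2 = k (z 3 A2) (z 4 A2)"
  \<comment> \<open>Two equations are linear in \<open>(u, v)\<close>: the common factor of the
    first two coordinates vanishes, and the ratio of the last two is prescribed. The cubic is their
    determinant \<open>qa s t * K - qb s t * L\<close>, with \<open>K\<close> and \<open>L\<close>
    as defined below.\<close>
  obtain s t where st: "s \<noteq> 0 \<or> t \<noteq> 0"
    "(a0 * k0 - b0 * l0) * s ^ 3 + (a0 * k1 + a1 * k0 - b0 * l1 - b1 * l0) * s\<^sup>2 * t +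
      (a0 * k2 + a1 * k1 - b0 * l2 - b1 * l1) * s * t\<^sup>2 + (a1 * k2 - b1 * l2) * t ^ 3 = 0"
    by (rule cubic_form_root)
  define K where "K = s\<^sup>2 * k0 + (s * t) * k1 + t\<^sup>2 * k2"
  define L where "L = s\<^sup>2 * l0 + (s * t) * l1 + t\<^sup>2 * l2"
  have "qa s t * K = L * qb s t"
    using st(2) unfolding K_def L_def qa_def qb_def by algebra
  then obtain u v where uv: "u \<noteq> 0 \<or> v \<noteq> 0" "u * qa s t + v * qb s t = 0" "u * L + v * K = 0"
    using kernel_3x2[of "qa s t" K L "qb s t" 0 0] by auto
  have "z 4 x * z 3 (\<Phi> s t u v) = z 3 x * z 4 (\<Phi> s t u v)"
    using uv(3) unfolding z34_\<Phi> ca_def cb_def da_def db_def K_def L_def k l k_def by algebra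
  moreover have "z 1 (\<Phi> s t u v) = 0" "z 2 (\<Phi> s t u v) = 0" by (simp_all add: z12_\<Phi> uv)
  ultimately have "\<exists>c. \<Phi> s t u v = c *s x" using base_line_preimage x(1) True by blast
  then show ?thesis using st(1) uv(1) by blast
qed

lemma X_eq: "x \<noteq> 0 \<Longrightarrow> vec.span {x} \<in> X \<longleftrightarrow> F x = 0"
  using is_form_F F_\<Phi> preimage by (rule X_zero_set)

lemma base_line_subset: "base_line \<subseteq> X"
proof
  fix P assume P: "P \<in> base_line"
  then obtain x where x: "x \<noteq> 0" "P = vec.span {x}"
    using proj_line_base_line by (auto simp: proj_line_def proj_space_def)
  then have "z 1 x = 0" "z 2 x = 0" using P base_line_mem by auto
  then have "F x = 0" by (simp add: F_def qa_def qb_def ca_def cb_def da_def db_def)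
  then show "P \<in> X" using X_eq x by simp
qed

text \<open>In the directions \<open>h 3\<close> and \<open>h 4\<close> the form \<open>F\<close> is
  affine, with 2 x 2 minors as slopes up to sign. At a singular point off the base line both minors
  vanish, and so does the third because \<open>F x = 0\<close>; the first two columns are then
  dependent.\<close>

lemma singular_locus_subset: "singular_locus X \<subseteq> base_line"
proof
  fix P assume P: "P \<in> singular_locus X"
  then have "P \<in> X" by (simp add: singular_locus_def)
  then obtain s t u v where P\<Phi>: "P = vec.span {\<Phi> s t u v}" and st: "s \<noteq> 0 \<or> t \<noteq> 0"
    and uv: "u \<noteq> 0 \<or> v \<noteq> 0" unfolding X_def by blast
  define x where "x = \<Phi> s t u v"
  have x: "x \<noteq> 0" "P = vec.span {x}" using \<Phi>_nonzero[OF st uv] by (simp_all add: x_def P\<Phi>)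
  show "P \<in> base_line"
  proof (rule ccontr)
    assume "P \<notin> base_line"
    then have z12: "z 1 x \<noteq> 0 \<or> z 2 x \<noteq> 0" using base_line_mem x by auto
    define m3 m4 where m: "m3 = qa (z 1 x) (z 2 x) * db (z 1 x) (z 2 x) - da (z 1 x) (z 2 x) * qb (z 1 x) (z 2 x)"
      "m4 = qa (z 1 x) (z 2 x) * cb (z 1 x) (z 2 x) - ca (z 1 x) (z 2 x) * qb (z 1 x) (z 2 x)"
    have F0: "F x = 0" unfolding x_def by (rule F_\<Phi>)
    have "F (x + \<epsilon> *s h 3) = poly [:0, - m3:] \<epsilon>" for \<epsilon>
      using F0 unfolding F_def z_line m by (simp add: algebra_simps)
    then have "m3 = 0"
      using nonsingular_point[OF is_form_F X_eq proj_line_base_line base_line_subset _ x_def st uv,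
          of "h 3" "[:0, - m3:]"] P \<open>P \<notin> base_line\<close> x(2) by auto
    have "F (x + \<epsilon> *s h 4) = poly [:0, m4:] \<epsilon>" for \<epsilon>
      using F0 unfolding F_def z_line m by (simp add: algebra_simps)
    then have "m4 = 0"
      using nonsingular_point[OF is_form_F X_eq proj_line_base_line base_line_subset _ x_def st uv,
          of "h 4" "[:0, m4:]"] P \<open>P \<notin> base_line\<close> x(2) by auto
    have "ca (z 1 x) (z 2 x) * db (z 1 x) (z 2 x) = da (z 1 x) (z 2 x) * cb (z 1 x) (z 2 x)"
      using F0 \<open>m3 = 0\<close> \<open>m4 = 0\<close> by (simp add: F_def m)
    then obtain u' v' where "u' \<noteq> 0 \<or> v' \<noteq> 0"
      "u' * qa (z 1 x) (z 2 x) + v' * qb (z 1 x) (z 2 x) = 0"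
      "u' * ca (z 1 x) (z 2 x) + v' * cb (z 1 x) (z 2 x) = 0"
      "u' * da (z 1 x) (z 2 x) + v' * db (z 1 x) (z 2 x) = 0"
      using kernel_3x2[of "qa (z 1 x) (z 2 x)" "cb (z 1 x) (z 2 x)" "ca (z 1 x) (z 2 x)"
          "qb (z 1 x) (z 2 x)" "db (z 1 x) (z 2 x)" "da (z 1 x) (z 2 x)"]
        \<open>m3 = 0\<close> \<open>m4 = 0\<close> by (auto simp: m)
    then show False using columns_independent[OF z12] by blast
  qed
qed

lemma codim1_lines:
  "\<exists>\<L>. finite \<L> \<and> (\<forall>L\<in>\<L>. proj_line L) \<and> codim1_singular_locus X = \<Union>\<L>"
  by (rule codim1_singular_locus_lines[of "{base_line}"])
    (use proj_line_base_line singular_locus_subset in auto)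

end

section \<open>Degenerate conics\<close>

text \<open>The premises say that the gradient of the conic at \<open>m\<close> is orthogonal to the
  cross products of \<open>q, g\<close> and of \<open>f, q\<close> and, by \<open>conic\<close>, to
  \<open>m\<close> itself. If the determinant of \<open>q, f, g\<close> were nonzero, these three
  would be a basis and the gradient would vanish.\<close>

lemma conic_tangent:
  fixes q0 q1 q2 f0 f1 f2 g0 g1 g2 m0 m1 m2 :: "'k::field"
  assumes m: "m0 = f1 * g2 - f2 * g1" "m1 = f2 * g0 - f0 * g2" "m2 = f0 * g1 - f1 * g0"
    and conic: "m1\<^sup>2 = m0 * m2"
    and k: "2 * m1 * (q2 * g0 - q0 * g2) = m0 * (q0 * g1 - q1 * g0) + m2 * (q1 * g2 - q2 * g1)"
    and l: "2 * m1 * (f2 * q0 - f0 * q2) = m0 * (f0 * q1 - f1 * q0) + m2 * (f1 * q2 - f2 * q1)"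
  shows "q0 * m0 + q1 * m1 + q2 * m2 = 0"
proof (rule ccontr)
  define D where "D = q0 * m0 + q1 * m1 + q2 * m2"
  assume "\<not> ?thesis"
  then have D: "D \<noteq> 0" by (simp add: D_def)
  \<comment> \<open>The first component of \<open>D\<close> times \<open>(m2, - 2 * m1, m0)\<close>,
    expanded in \<open>f, g, q\<close>; \<open>exp2\<close> is the last one. The middle component
    says nothing in characteristic 2, so \<open>m1 = 0\<close> is taken from \<open>conic\<close>
    instead.\<close>
  have exp0: "D * m2 = (m2 * (g1 * q2 - g2 * q1) - 2 * m1 * (g2 * q0 - g0 * q2) + m0 * (g0 * q1 - g1 * q0)) * f0
    + (m2 * (q1 * f2 - q2 * f1) - 2 * m1 * (q2 * f0 - q0 * f2) + m0 * (q0 * f1 - q1 * f0)) * g0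
    + (m2 * m0 - 2 * m1 * m1 + m0 * m2) * q0"
    unfolding D_def m by algebra
  have exp2: "D * m0 = (m2 * (g1 * q2 - g2 * q1) - 2 * m1 * (g2 * q0 - g0 * q2) + m0 * (g0 * q1 - g1 * q0)) * f2
    + (m2 * (q1 * f2 - q2 * f1) - 2 * m1 * (q2 * f0 - q0 * f2) + m0 * (q0 * f1 - q1 * f0)) * g2
    + (m2 * m0 - 2 * m1 * m1 + m0 * m2) * q2"
    unfolding D_def m by algebra
  have 1: "m2 * (g1 * q2 - g2 * q1) - 2 * m1 * (g2 * q0 - g0 * q2) + m0 * (g0 * q1 - g1 * q0) = 0"
    using k by algebra
  have 2: "m2 * (q1 * f2 - q2 * f1) - 2 * m1 * (q2 * f0 - q0 * f2) + m0 * (q0 * f1 - q1 * f0) = 0"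
    using l by algebra
  have 3: "m2 * m0 - 2 * m1 * m1 + m0 * m2 = 0"
    using conic by algebra
  have "D * m2 = 0" "D * m0 = 0" unfolding exp0 exp2 1 2 3 by simp_all
  then have "m0 = 0" "m2 = 0" using D by simp_all
  with conic have "m1 = 0" by simp
  with \<open>m0 = 0\<close> \<open>m2 = 0\<close> D show False by (simp add: D_def)
qed

text \<open>The vectors may be dependent, so an independent part of \<open>{a, b}\<close> is filled
  up to two elements from a basis of the whole space.\<close>

lemma ex_proj_line_through:
  fixes a b :: "'k::field ^ 4"
  obtains L where "proj_line L" "\<And>y. y \<noteq> 0 \<Longrightarrow> y \<in> vec.span {a, b} \<Longrightarrow> vec.span {y} \<in> L"
proof -
  obtain B where B: "B \<subseteq> {a, b}" "vec.independent B" "{a, b} \<subseteq> vec.span B"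
    using vec.maximal_independent_subset[of "{a, b}"] by metis
  obtain B' where B': "B \<subseteq> B'" "vec.independent B'" "UNIV \<subseteq> vec.span B'"
    using vec.maximal_independent_subset_extend[OF subset_UNIV B(2)] by metis
  have "card B' = 4"
    using vec.dim_eq_card[of B' UNIV] B'
    by (simp add: vec_dim_card top.extremum_unique del: vec.dim_UNIV)
  then have "finite B'" by (metis card.infinite zero_neq_numeral)
  have "card B \<le> 2"
    using card_mono[OF _ B(1)] card_insert_le_m1[of 2 "{b}" a] by simp
  then obtain T where T: "B \<subseteq> T" "T \<subseteq> B'" "card T = 2"
    using exists_subset_between[of B 2 B'] B'(1) \<open>card B' = 4\<close> \<open>finite B'\<close> by auto
  have "vec.independent T" using B'(2) T(2) by (rule vec.independent_mono)
  then have dim: "vec.dim (vec.span T) = 2"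
    using vec.dim_span_eq_card_independent T(3) by metis
  show thesis
  proof
    show "proj_line {P \<in> proj_space. P \<subseteq> vec.span T}"
      unfolding proj_line_def using dim vec.subspace_span by blast
    fix y assume y: "y \<noteq> 0" "y \<in> vec.span {a, b}"
    have "{a, b} \<subseteq> vec.span T" using B(3) vec.span_mono[OF T(1)] by blast
    then have "y \<in> vec.span T" using y(2) vec.span_minimal[OF _ vec.subspace_span] by blast
    then have "vec.span {y} \<subseteq> vec.span T" by (simp add: vec.span_minimal)
    then show "vec.span {y} \<in> {P \<in> proj_space. P \<subseteq> vec.span T}"
      using span_in_proj_space[OF y(1)] by blast
  qed
qed

lemma dependent_3x3:
  fixes a0 a1 a2 b0 b1 b2 c0 c1 c2 :: "'k::field"
  assumes "a0 * (b1 * c2 - b2 * c1) + a1 * (b2 * c0 - b0 * c2) + a2 * (b0 * c1 - b1 * c0) = 0"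
  obtains x y w where "x \<noteq> 0 \<or> y \<noteq> 0 \<or> w \<noteq> 0" "a0 * x + a1 * y + a2 * w = 0"
    "b0 * x + b1 * y + b2 * w = 0" "c0 * x + c1 * y + c2 * w = 0"
proof -
  let ?M = "vector [vector [a0, a1, a2], vector [b0, b1, b2], vector [c0, c1, c2]] :: 'k ^ 3 ^ 3"
  have "det ?M = 0" using assms by (simp add: det_3 algebra_simps)
  then have "\<not> invertible ?M" by (simp add: invertible_det_nz)
  then have "\<not> (\<exists>B. B ** ?M = mat 1)" by (simp add: invertible_left_inverse)
  then obtain e where e: "?M *v e = 0" "e \<noteq> 0" unfolding matrix_left_invertible_ker by blast
  then have "(?M *v e) $ 1 = 0" "(?M *v e) $ 2 = 0" "(?M *v e) $ 3 = 0" by simp_all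
  moreover have "e $ 1 \<noteq> 0 \<or> e $ 2 \<noteq> 0 \<or> e $ 3 \<noteq> 0" using e(2) by (auto simp: vec_eq_iff forall_3)
  ultimately show thesis
    using that[of "e $ 1" "e $ 2" "e $ 3"] by (simp add: matrix_vector_mult_def sum_3)
qed

lemma span_dependent_triple:
  fixes C0 C1 C2 :: "'k::field ^ 'n"
  assumes e: "e0 \<noteq> 0 \<or> e1 \<noteq> 0 \<or> e2 \<noteq> 0" "e0 *s C0 + e1 *s C1 + e2 *s C2 = 0"
  obtains a b where "\<And>x y w. x *s C0 + y *s C1 + w *s C2 \<in> vec.span {a, b}"
proof -
  have red: "x *s C + y *s a + w *s b \<in> vec.span {a, b}"
    if "c \<noteq> 0" "c *s C + d *s a + d' *s b = 0" for c d d' x y w and C a b :: "'k ^ 'n"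
  proof -
    have "c *s C = - (d *s a + d' *s b)"
      using that(2) unfolding add.assoc by (rule eq_neg_iff_add_eq_0[THEN iffD2])
    then have "c *s C = (- d) *s a + (- d') *s b" by simp
    then have "inverse c *s (c *s C) = inverse c *s ((- d) *s a + (- d') *s b)" by (simp only:)
    then have C: "C = (inverse c * - d) *s a + (inverse c * - d') *s b"
      using that(1) by (simp only: vector_smult_assoc vector_add_ldistrib) simp
    have "a \<in> vec.span {a, b}" "b \<in> vec.span {a, b}" by (simp_all add: vec.span_base)
    then have ab: "d *s a + d' *s b \<in> vec.span {a, b}" for d d'
      by (intro vec.span_add vec.span_scale)
    then have "C \<in> vec.span {a, b}" unfolding C by blast
    then have "x *s C \<in> vec.span {a, b}" by (rule vec.span_scale)
    then show ?thesis using vec.span_add[OF _ ab[of y w]] by (simp add: add.assoc)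
  qed
  consider "e0 \<noteq> 0" | "e1 \<noteq> 0" | "e2 \<noteq> 0" using e(1) by blast
  then show thesis
  proof cases
    case 1
    show thesis by (rule that[of C1 C2]) (rule red[OF 1 e(2)])
  next
    case 2
    have "x *s C0 + y *s C1 + w *s C2 \<in> vec.span {C0, C2}" for x y w
      using red[of e1 C1 e0 C0 e2 C2 y x w] 2 e(2) by (simp add: add_ac)
    then show thesis by (rule that)
  next
    case 3
    have "x *s C0 + y *s C1 + w *s C2 \<in> vec.span {C0, C1}" for x y w
      using red[of e2 C2 e0 C0 e1 C1 w x y] 3 e(2) by (simp add: add_ac)
    then show thesis by (rule that)
  qed
qed

section \<open>A linear syzygy of bidegree (0,1)\<close>

text \<open>
  The syzygy makes the first two coordinates \<open>u q\<close> and \<open>v q\<close> with \<open>q = q0 s\<^sup>2 + q1 s t + q2 t\<^sup>2\<close>.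
  Away from the base line, \<open>(u : v)\<close> is read off from them, and a preimage \<open>(s : t)\<close> is a common zero of
  the two quadratic forms with coefficients \<open>f\<close> and \<open>g\<close>.  The form \<open>F\<close> is their resultant.
\<close>

locale syzygy_uv = surface_coordinates A0 A1 A2 B0 B1 B2 G H
  for A0 A1 A2 B0 B1 B2 :: "'k::alg_closed_field ^ 4" and G H :: "'k ^ 4 ^ 4" +
  fixes q0 q1 q2 :: 'k
  assumes z1: "z 1 A0 = q0" "z 1 A1 = q1" "z 1 A2 = q2" "z 1 B0 = 0" "z 1 B1 = 0" "z 1 B2 = 0"
    and z2: "z 2 A0 = 0" "z 2 A1 = 0" "z 2 A2 = 0" "z 2 B0 = q0" "z 2 B1 = q1" "z 2 B2 = q2"
begin

definition q where "q s t = q0 * s\<^sup>2 + q1 * (s * t) + q2 * t\<^sup>2"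
definition n0 where "n0 u v = u * z 3 A0 + v * z 3 B0"
definition n1 where "n1 u v = u * z 3 A1 + v * z 3 B1"
definition n2 where "n2 u v = u * z 3 A2 + v * z 3 B2"
definition r0 where "r0 u v = u * z 4 A0 + v * z 4 B0"
definition r1 where "r1 u v = u * z 4 A1 + v * z 4 B1"
definition r2 where "r2 u v = u * z 4 A2 + v * z 4 B2"

lemmas nr_defs = n0_def n1_def n2_def r0_def r1_def r2_def

text \<open>With \<open>(u, v) = (z 1 x, z 2 x)\<close>, the quadratic form with coefficients
  \<open>f\<close> vanishes at \<open>(s, t)\<close> exactly if \<open>\<Phi> s t u v\<close> and
  \<open>q s t *s x\<close> have the same third coordinate; \<open>g\<close> does the same for the
  fourth. The first two agree anyway.\<close>

definition f0 where "f0 x = n0 (z 1 x) (z 2 x) - q0 * z 3 x"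
definition f1 where "f1 x = n1 (z 1 x) (z 2 x) - q1 * z 3 x"
definition f2 where "f2 x = n2 (z 1 x) (z 2 x) - q2 * z 3 x"
definition g0 where "g0 x = r0 (z 1 x) (z 2 x) - q0 * z 4 x"
definition g1 where "g1 x = r1 (z 1 x) (z 2 x) - q1 * z 4 x"
definition g2 where "g2 x = r2 (z 1 x) (z 2 x) - q2 * z 4 x"

lemmas fg_defs = f0_def f1_def f2_def g0_def g1_def g2_def

definition F where
  "F x = (f2 x * g0 x - f0 x * g2 x) * (f2 x * g0 x - f0 x * g2 x) -
    (f1 x * g2 x - f2 x * g1 x) * (f0 x * g1 x - f1 x * g0 x)"

text \<open>The determinant with rows \<open>q\<close>, \<open>n\<close>, \<open>r\<close>. For
  fixed \<open>(u : v)\<close> this matrix maps the conic of all \<open>(s^2, s t, t^2)\<close> to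
  the fibre, in coordinates of the plane \<open>z 1 : z 2 = u : v\<close>.\<close>

definition \<Delta> where
  "\<Delta> u v = q0 * (n1 u v * r2 u v - n2 u v * r1 u v) + q1 * (n2 u v * r0 u v - n0 u v * r2 u v) +
    q2 * (n0 u v * r1 u v - n1 u v * r0 u v)"

lemma z12_\<Phi>: "z 1 (\<Phi> s t u v) = u * q s t" "z 2 (\<Phi> s t u v) = v * q s t"
  by (simp_all add: z_\<Phi> z1 z2 q_def algebra_simps)

lemma z34_\<Phi>: "z 3 (\<Phi> s t u v) = n0 u v * s\<^sup>2 + n1 u v * (s * t) + n2 u v * t\<^sup>2"
  "z 4 (\<Phi> s t u v) = r0 u v * s\<^sup>2 + r1 u v * (s * t) + r2 u v * t\<^sup>2"
  by (simp_all add: z_\<Phi> nr_defs algebra_simps)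

lemma is_form_F: "is_form 4 F"
proof -
  have fg: "is_form 1 f0" "is_form 1 f1" "is_form 1 f2" "is_form 1 g0" "is_form 1 g1" "is_form 1 g2"
    unfolding fg_defs[abs_def] nr_defs mult.commute[of "z _ _" "z _ _"]
    by (simp_all only: mult.commute[of "z 1 _"] mult.commute[of "z 2 _"])
      (intro is_form_diff is_form_add is_form_cmult is_form_z)+
  have 2: "is_form 2 (\<lambda>x. a x * b x - c x * d x)"
    if "is_form 1 a" "is_form 1 b" "is_form 1 c" "is_form 1 d" for a b c d :: "'k ^ 4 \<Rightarrow> 'k"
    by (intro is_form_diff is_form_mult'[OF that(1,2)] is_form_mult'[OF that(3,4)]) simp_all
  note m = 2[OF fg(3,4,1,6)] 2[OF fg(2,6,3,5)] 2[OF fg(1,5,2,4)]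
  show ?thesis
    unfolding F_def[abs_def]
    by (intro is_form_diff is_form_mult'[OF m(1) m(1)] is_form_mult'[OF m(2) m(3)]) simp_all
qed

lemma nr_scale: "n0 (u * c) (v * c) = c * n0 u v" "n1 (u * c) (v * c) = c * n1 u v"
  "n2 (u * c) (v * c) = c * n2 u v" "r0 (u * c) (v * c) = c * r0 u v"
  "r1 (u * c) (v * c) = c * r1 u v" "r2 (u * c) (v * c) = c * r2 u v"
  by (simp_all add: nr_defs algebra_simps)

lemma \<Delta>_scale: "\<Delta> (u * c) (v * c) = c\<^sup>2 * \<Delta> u v"
  unfolding \<Delta>_def nr_scale by algebra

lemma F_\<Phi>:
  assumes "s \<noteq> 0 \<or> t \<noteq> 0"
  shows "F (\<Phi> s t u v) = 0"
proof -
  let ?x = "\<Phi> s t u v"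
  have "f0 ?x * s\<^sup>2 + f1 ?x * (s * t) + f2 ?x * t\<^sup>2 = 0"
    unfolding fg_defs z12_\<Phi> z34_\<Phi> nr_scale q_def by algebra
  moreover have "g0 ?x * s\<^sup>2 + g1 ?x * (s * t) + g2 ?x * t\<^sup>2 = 0"
    unfolding fg_defs z12_\<Phi> z34_\<Phi> nr_scale q_def by algebra
  ultimately show ?thesis
    using resultant_zero_if_common_root[OF assms] by (simp add: F_def power2_eq_square)
qed

lemma preimage:
  assumes x: "x \<noteq> 0" "F x = 0"
  shows "\<exists>s t u v c. (s \<noteq> 0 \<or> t \<noteq> 0) \<and> (u \<noteq> 0 \<or> v \<noteq> 0) \<and> \<Phi> s t u v = c *s x"
proof (cases "z 1 x = 0 \<and> z 2 x = 0")
  case False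
  have "(f2 x * g0 x - f0 x * g2 x)\<^sup>2 = (f1 x * g2 x - f2 x * g1 x) * (f0 x * g1 x - f1 x * g0 x)"
    using x(2) by (simp add: F_def power2_eq_square)
  then obtain s t where st: "s \<noteq> 0 \<or> t \<noteq> 0" "f0 x * s\<^sup>2 + f1 x * (s * t) + f2 x * t\<^sup>2 = 0"
    "g0 x * s\<^sup>2 + g1 x * (s * t) + g2 x * t\<^sup>2 = 0"
    by (rule common_root_if_resultant_zero)
  \<comment> \<open>The case \<open>q s t = 0\<close> is not excluded here;
    \<open>X_zero_set\<close> rules it out.\<close>
  have "\<Phi> s t (z 1 x) (z 2 x) = q s t *s x"
  proof (rule z_eqI)
    show "z 3 (\<Phi> s t (z 1 x) (z 2 x)) = z 3 (q s t *s x)"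
      using st(2) unfolding z34_\<Phi> z_scale q_def fg_defs by algebra
    show "z 4 (\<Phi> s t (z 1 x) (z 2 x)) = z 4 (q s t *s x)"
      using st(3) unfolding z34_\<Phi> z_scale q_def fg_defs by algebra
  qed (simp_all add: z12_\<Phi> z_scale)
  then show ?thesis using st(1) False by blast
next
  case True
  \<comment> \<open>A root of \<open>q\<close> puts the image on the base line for every
    \<open>(u : v)\<close>; one linear equation then adjusts the ratio of the last two
    coordinates.\<close>
  obtain s t where st: "s \<noteq> 0 \<or> t \<noteq> 0" "q s t = 0"
    unfolding q_def by (rule quadratic_form_root)
  define K where "K a3 b3 c3 a4 b4 c4 = z 4 x * (a3 * s\<^sup>2 + b3 * (s * t) + c3 * t\<^sup>2) -
    z 3 x * (a4 * s\<^sup>2 + b4 * (s * t) + c4 * t\<^sup>2 :: 'k)" for a3 b3 c3 a4 b4 c4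
  obtain u v where uv: "u \<noteq> 0 \<or> v \<noteq> 0"
    "u * K (z 3 A0) (z 3 A1) (z 3 A2) (z 4 A0) (z 4 A1) (z 4 A2) +
      v * K (z 3 B0) (z 3 B1) (z 3 B2) (z 4 B0) (z 4 B1) (z 4 B2) = 0"
    by (rule kernel_3x2[of _ 0 0 _ 0 0]) simp_all
  have "z 4 x * z 3 (\<Phi> s t u v) = z 3 x * z 4 (\<Phi> s t u v)"
    using uv(2) unfolding z34_\<Phi> nr_defs K_def by algebra
  moreover have "z 1 (\<Phi> s t u v) = 0" "z 2 (\<Phi> s t u v) = 0" by (simp_all add: z12_\<Phi> st)
  ultimately have "\<exists>c. \<Phi> s t u v = c *s x" using base_line_preimage x(1) True by blast
  then show ?thesis using st(1) uv(1) by blast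
qed

lemma X_eq: "x \<noteq> 0 \<Longrightarrow> vec.span {x} \<in> X \<longleftrightarrow> F x = 0"
  using is_form_F F_\<Phi> preimage by (rule X_zero_set)

lemma base_line_subset: "base_line \<subseteq> X"
proof
  fix P assume P: "P \<in> base_line"
  then obtain x where x: "x \<noteq> 0" "P = vec.span {x}"
    using proj_line_base_line by (auto simp: proj_line_def proj_space_def)
  then have "z 1 x = 0" "z 2 x = 0" using P base_line_mem by auto
  then have "F x = 0" by (simp add: F_def fg_defs nr_defs algebra_simps)
  then show "P \<in> X" using X_eq x by simp
qed

text \<open>Along \<open>h 3\<close> the coefficients \<open>f\<close> become
  \<open>f - \<epsilon> q\<close>, so \<open>m\<close> changes by \<open>- \<epsilon> k\<close> with
  \<open>k\<close> the cross product of \<open>q\<close> and \<open>g\<close>; along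
  \<open>h 4\<close> it changes by \<open>- \<epsilon> l\<close> with \<open>l\<close> that of
  \<open>f\<close> and \<open>q\<close>. The vanishing linear terms of the resultant are the
  premises of \<open>conic_tangent\<close>.\<close>

lemma \<Delta>_eq_0_if_singular:
  assumes st: "s \<noteq> 0 \<or> t \<noteq> 0" and uv: "u \<noteq> 0 \<or> v \<noteq> 0"
    and P: "P = vec.span {\<Phi> s t u v}" "P \<in> singular_locus X" "P \<notin> base_line"
  shows "\<Delta> u v = 0"
proof -
  define x where x: "x = \<Phi> s t u v"
  have x0: "x \<noteq> 0" using \<Phi>_nonzero[OF st uv] by (simp add: x)
  have z12: "z 1 x \<noteq> 0 \<or> z 2 x \<noteq> 0" using P base_line_mem[OF x0] by (auto simp: x)
  then have qst: "q s t \<noteq> 0" by (auto simp: x z12_\<Phi>)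
  have F0: "F x = 0" unfolding x using st by (rule F_\<Phi>)
  define m0 m1 m2 where m: "m0 = f1 x * g2 x - f2 x * g1 x" "m1 = f2 x * g0 x - f0 x * g2 x"
    "m2 = f0 x * g1 x - f1 x * g0 x"
  define k0 k1 k2 where k: "k0 = q1 * g2 x - q2 * g1 x" "k1 = q2 * g0 x - q0 * g2 x"
    "k2 = q0 * g1 x - q1 * g0 x"
  define l0 l1 l2 where l: "l0 = f1 x * q2 - f2 x * q1" "l1 = f2 x * q0 - f0 x * q2"
    "l2 = f0 x * q1 - f1 x * q0"
  have conic: "m1\<^sup>2 = m0 * m2" using F0 by (simp add: F_def m power2_eq_square)
  have sing: "vec.span {x} \<in> singular_locus X" "vec.span {x} \<notin> base_line" using P by (simp_all add: x)
  have fg3: "f0 (x + \<epsilon> *s h 3) = f0 x - \<epsilon> * q0" "f1 (x + \<epsilon> *s h 3) = f1 x - \<epsilon> * q1"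
    "f2 (x + \<epsilon> *s h 3) = f2 x - \<epsilon> * q2" "g0 (x + \<epsilon> *s h 3) = g0 x" "g1 (x + \<epsilon> *s h 3) = g1 x"
    "g2 (x + \<epsilon> *s h 3) = g2 x" for \<epsilon>
    by (simp_all add: fg_defs z_line algebra_simps)
  have fg4: "f0 (x + \<epsilon> *s h 4) = f0 x" "f1 (x + \<epsilon> *s h 4) = f1 x" "f2 (x + \<epsilon> *s h 4) = f2 x"
    "g0 (x + \<epsilon> *s h 4) = g0 x - \<epsilon> * q0" "g1 (x + \<epsilon> *s h 4) = g1 x - \<epsilon> * q1"
    "g2 (x + \<epsilon> *s h 4) = g2 x - \<epsilon> * q2" for \<epsilon>
    by (simp_all add: fg_defs z_line algebra_simps)
  have "F (x + \<epsilon> *s h 3) = poly [:0, m0 * k2 + m2 * k0 - 2 * m1 * k1, k1 * k1 - k0 * k2:] \<epsilon>" for \<epsilon>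
  proof -
    have "F (x + \<epsilon> *s h 3) = (m1\<^sup>2 - m0 * m2) + \<epsilon> * ((m0 * k2 + m2 * k0 - 2 * m1 * k1) +
        \<epsilon> * (k1 * k1 - k0 * k2))"
      unfolding F_def fg3 m k by algebra
    then show ?thesis by (simp add: conic)
  qed
  then have "m0 * k2 + m2 * k0 - 2 * m1 * k1 = 0"
    using nonsingular_point[OF is_form_F X_eq proj_line_base_line base_line_subset sing(2) x st uv,
        of "h 3" "[:0, m0 * k2 + m2 * k0 - 2 * m1 * k1, k1 * k1 - k0 * k2:]"] sing(1) by auto
  then have 3: "2 * m1 * k1 = m0 * k2 + m2 * k0" by simp
  have "F (x + \<epsilon> *s h 4) = poly [:0, m0 * l2 + m2 * l0 - 2 * m1 * l1, l1 * l1 - l0 * l2:] \<epsilon>" for \<epsilon>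
  proof -
    have "F (x + \<epsilon> *s h 4) = (m1\<^sup>2 - m0 * m2) + \<epsilon> * ((m0 * l2 + m2 * l0 - 2 * m1 * l1) +
        \<epsilon> * (l1 * l1 - l0 * l2))"
      unfolding F_def fg4 m l by algebra
    then show ?thesis by (simp add: conic)
  qed
  then have "m0 * l2 + m2 * l0 - 2 * m1 * l1 = 0"
    using nonsingular_point[OF is_form_F X_eq proj_line_base_line base_line_subset sing(2) x st uv,
        of "h 4" "[:0, m0 * l2 + m2 * l0 - 2 * m1 * l1, l1 * l1 - l0 * l2:]"] sing(1) by auto
  then have 4: "2 * m1 * l1 = m0 * l2 + m2 * l0" by simp
  have "q0 * m0 + q1 * m1 + q2 * m2 = 0"
    by (rule conic_tangent[OF m conic 3[unfolded k] 4[unfolded l]])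
  \<comment> \<open>\<open>f\<close> and \<open>g\<close> differ from \<open>n\<close> and
    \<open>r\<close> by multiples of \<open>q\<close>, which leaves the determinant
    unchanged.\<close>
  then have "\<Delta> (z 1 x) (z 2 x) = 0"
    unfolding m \<Delta>_def fg_defs by algebra
  then show ?thesis using qst unfolding x z12_\<Phi> \<Delta>_scale by simp
qed

text \<open>A kernel vector of the matrix with rows \<open>q\<close>, \<open>n\<close>,
  \<open>r\<close> is a linear relation between the coefficient vectors of \<open>s^2\<close>,
  \<open>s t\<close>, \<open>t^2\<close> in \<open>\<Phi>\<close>, whose first two coordinates are
  \<open>u\<close> and \<open>v\<close> times the entries of \<open>q\<close>.\<close>

lemma degenerate_conic_line:
  assumes "\<Delta> u v = 0"
  obtains L where "proj_line L"
    "\<And>s t. s \<noteq> 0 \<or> t \<noteq> 0 \<Longrightarrow> u \<noteq> 0 \<or> v \<noteq> 0 \<Longrightarrow> vec.span {\<Phi> s t u v} \<in> L"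
proof -
  define C0 C1 C2 where C: "C0 = u *s A0 + v *s B0" "C1 = u *s A1 + v *s B1" "C2 = u *s A2 + v *s B2"
  obtain e0 e1 e2 where e: "e0 \<noteq> 0 \<or> e1 \<noteq> 0 \<or> e2 \<noteq> 0" "q0 * e0 + q1 * e1 + q2 * e2 = 0"
    "n0 u v * e0 + n1 u v * e1 + n2 u v * e2 = 0" "r0 u v * e0 + r1 u v * e1 + r2 u v * e2 = 0"
    using assms unfolding \<Delta>_def by (rule dependent_3x3)
  have "e0 *s C0 + e1 *s C1 + e2 *s C2 = 0"
  proof (rule z_eqI)
    show "z 1 (e0 *s C0 + e1 *s C1 + e2 *s C2) = z 1 0"
      using e(2) unfolding C z_add z_scale z1 z2 z_0 by algebra
    show "z 2 (e0 *s C0 + e1 *s C1 + e2 *s C2) = z 2 0"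
      using e(2) unfolding C z_add z_scale z1 z2 z_0 by algebra
    show "z 3 (e0 *s C0 + e1 *s C1 + e2 *s C2) = z 3 0"
      using e(3) unfolding C z_add z_scale z_0 nr_defs by algebra
    show "z 4 (e0 *s C0 + e1 *s C1 + e2 *s C2) = z 4 0"
      using e(4) unfolding C z_add z_scale z_0 nr_defs by algebra
  qed
  with e(1) obtain a b where ab: "\<And>x y w. x *s C0 + y *s C1 + w *s C2 \<in> vec.span {a, b}"
    using span_dependent_triple by metis
  obtain L where L: "proj_line L" "\<And>y. y \<noteq> 0 \<Longrightarrow> y \<in> vec.span {a, b} \<Longrightarrow> vec.span {y} \<in> L"
    using ex_proj_line_through[of a b] by metis
  have "\<Phi> s t u v \<in> vec.span {a, b}" for s t
  proof -
    have "\<Phi> s t u v = s\<^sup>2 *s C0 + (s * t) *s C1 + t\<^sup>2 *s C2"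
      by (simp add: vec_eq_iff \<Phi>_nth C algebra_simps)
    then show ?thesis using ab by simp
  qed
  then show thesis using that[OF L(1)] L(2) \<Phi>_nonzero by blast
qed

lemma codim1_lines:
  assumes "\<Delta> u' v' \<noteq> 0"
  shows "\<exists>\<L>. finite \<L> \<and> (\<forall>L\<in>\<L>. proj_line L) \<and> codim1_singular_locus X = \<Union>\<L>"
proof -
  \<comment> \<open>Where \<open>\<Delta>\<close> is nonzero any line will do, which makes
    \<open>line u v\<close> a line for all arguments.\<close>
  define line where "line u v = (SOME L. proj_line L \<and>
    (\<Delta> u v = 0 \<longrightarrow> (\<forall>s t. s \<noteq> 0 \<or> t \<noteq> 0 \<longrightarrow> u \<noteq> 0 \<or> v \<noteq> 0 \<longrightarrow> vec.span {\<Phi> s t u v} \<in> L)))"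
    for u v
  have "\<exists>L. proj_line L \<and>
    (\<Delta> u v = 0 \<longrightarrow> (\<forall>s t. s \<noteq> 0 \<or> t \<noteq> 0 \<longrightarrow> u \<noteq> 0 \<or> v \<noteq> 0 \<longrightarrow> vec.span {\<Phi> s t u v} \<in> L))" for u v
    using degenerate_conic_line[of u v] proj_line_base_line by metis
  then have "proj_line (line u v) \<and>
    (\<Delta> u v = 0 \<longrightarrow> (\<forall>s t. s \<noteq> 0 \<or> t \<noteq> 0 \<longrightarrow> u \<noteq> 0 \<or> v \<noteq> 0 \<longrightarrow> vec.span {\<Phi> s t u v} \<in> line u v))" for u v
    unfolding line_def by (rule someI_ex)
  then have line: "proj_line (line u v)"
    "\<Delta> u v = 0 \<Longrightarrow> s \<noteq> 0 \<or> t \<noteq> 0 \<Longrightarrow> u \<noteq> 0 \<or> v \<noteq> 0 \<Longrightarrow> vec.span {\<Phi> s t u v} \<in> line u v"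
    for s t u v by blast+
  \<comment> \<open>The mixed coefficient is the value at \<open>(1, 1)\<close> minus the two square
    terms.\<close>
  define d0 d1 d2 where d: "d0 = \<Delta> 1 0" "d1 = \<Delta> 1 1 - \<Delta> 1 0 - \<Delta> 0 1" "d2 = \<Delta> 0 1"
  have \<Delta>_eq: "\<Delta> u v = d0 * u\<^sup>2 + d1 * (u * v) + d2 * v\<^sup>2" for u v
    unfolding d \<Delta>_def nr_defs by algebra
  have "[:d0, d1, d2:] \<noteq> 0" using assms \<Delta>_eq[of u' v'] by auto
  then have "finite {T. poly [:d0, d1, d2:] T = 0}" by (rule poly_roots_finite)
  moreover have "poly [:d0, d1, d2:] T = \<Delta> 1 T" for T
    unfolding \<Delta>_eq by (simp add: algebra_simps power2_eq_square)
  ultimately have fin: "finite {T. \<Delta> 1 T = 0}" by simp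
  define \<L>\<^sub>0 where "\<L>\<^sub>0 = {base_line, line 0 1} \<union> line 1 ` {T. \<Delta> 1 T = 0}"
  show ?thesis
  proof (rule codim1_singular_locus_lines[of \<L>\<^sub>0])
    show "finite \<L>\<^sub>0" using fin by (simp add: \<L>\<^sub>0_def)
    show "proj_line L" if "L \<in> \<L>\<^sub>0" for L
      using that line(1) proj_line_base_line by (auto simp: \<L>\<^sub>0_def)
    show "singular_locus X \<subseteq> \<Union>\<L>\<^sub>0"
    proof
      fix P assume P: "P \<in> singular_locus X"
      then have "P \<in> X" by (simp add: singular_locus_def)
      then obtain s t u v where P\<Phi>: "P = vec.span {\<Phi> s t u v}" and st: "s \<noteq> 0 \<or> t \<noteq> 0"
        and uv: "u \<noteq> 0 \<or> v \<noteq> 0" unfolding X_def by blast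
      show "P \<in> \<Union>\<L>\<^sub>0"
      proof (cases "P \<in> base_line")
        case False
        then have \<Delta>: "\<Delta> u v = 0" using \<Delta>_eq_0_if_singular[OF st uv P\<Phi> P] by simp
        show ?thesis
        proof (cases "u = 0")
          case True
          then have "\<Phi> s t u v = v *s \<Phi> s t 0 1" by (simp add: \<Phi>_def)
          then have "P = vec.span {\<Phi> s t 0 1}" using P\<Phi> uv True by (simp add: span_scale)
          moreover have "\<Delta> 0 1 = 0" using \<Delta>_scale[of 0 v 1] \<Delta> True uv by simp
          ultimately have "P \<in> line 0 1" using line(2)[of 0 1] st by simp
          then show ?thesis by (auto simp: \<L>\<^sub>0_def)
        next
          case u: False
          then have "\<Phi> s t u v = u *s \<Phi> s t 1 (v / u)"
            by (simp add: \<Phi>_def vector_add_ldistrib vector_smult_assoc)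
          then have "P = vec.span {\<Phi> s t 1 (v / u)}" using P\<Phi> u by (simp add: span_scale)
          moreover have "\<Delta> 1 (v / u) = 0" using \<Delta>_scale[of 1 u "v / u"] \<Delta> u by simp
          ultimately have "P \<in> line 1 (v / u)" "\<Delta> 1 (v / u) = 0" using line(2)[of 1 "v / u"] st by simp_all
          then show ?thesis by (auto simp: \<L>\<^sub>0_def)
        qed
      qed (auto simp: \<L>\<^sub>0_def)
    qed
  qed
qed

text \<open>
  If \<open>\<Delta>\<close> vanishes identically, the rows of the adjugate of the matrix with rows \<open>q\<close>, \<open>n\<close>, \<open>r\<close> are relations among
  its rows.  Their first entry is quadratic in \<open>(u, v)\<close>, but it multiplies \<open>q\<close>, so one factor can be absorbed into
  \<open>u q\<close> and \<open>v q\<close>; this leaves syzygies of bidegree (0,1).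
\<close>

lemma second_syzygy:
  assumes \<Delta>: "\<And>u v. \<Delta> u v = 0"
    and indep: "\<And>c. dot c A0 = 0 \<Longrightarrow> dot c A1 = 0 \<Longrightarrow> dot c A2 = 0 \<Longrightarrow>
      dot c B0 = 0 \<Longrightarrow> dot c B1 = 0 \<Longrightarrow> dot c B2 = 0 \<Longrightarrow> c = 0"
  shows "\<exists>\<gamma> \<delta>. (\<forall>s t u v. u * dot \<gamma> (\<Phi> s t u v) + v * dot \<delta> (\<Phi> s t u v) = 0) \<and>
    (dot \<gamma> (h 3) \<noteq> 0 \<or> dot \<gamma> (h 4) \<noteq> 0 \<or> dot \<delta> (h 3) \<noteq> 0 \<or> dot \<delta> (h 4) \<noteq> 0)"
proof (rule ccontr)
  assume no: "\<not> ?thesis"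
  \<comment> \<open>On the surface, \<open>u^2 q\<close>, \<open>u v q\<close> and
    \<open>v^2 q\<close> are \<open>u * z 1\<close>, \<open>v * z 1\<close> and
    \<open>v * z 2\<close>, which turns \<open>rel\<close> into a syzygy. By assumption its part in
    \<open>z 3\<close> and \<open>z 4\<close> is then zero.\<close>
  have key: "a3 = 0 \<and> b3 = 0 \<and> a4 = 0 \<and> b4 = 0"
    if rel: "\<And>s t u v. (u\<^sup>2 * k0 + u * v * k1 + v\<^sup>2 * k2) * q s t +
      (u * a3 + v * b3) * z 3 (\<Phi> s t u v) + (u * a4 + v * b4) * z 4 (\<Phi> s t u v) = 0"
    for k0 k1 k2 a3 b3 a4 b4
  proof -
    define \<gamma> where "\<gamma> = k0 *s (G $ 1) + a3 *s (G $ 3) + a4 *s (G $ 4)"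
    define \<delta> where "\<delta> = k1 *s (G $ 1) + k2 *s (G $ 2) + b3 *s (G $ 3) + b4 *s (G $ 4)"
    have \<gamma>: "dot \<gamma> x = k0 * z 1 x + a3 * z 3 x + a4 * z 4 x" for x
      by (simp add: \<gamma>_def z_dot dot_add dot_scale)
    have \<delta>: "dot \<delta> x = k1 * z 1 x + k2 * z 2 x + b3 * z 3 x + b4 * z 4 x" for x
      by (simp add: \<delta>_def z_dot dot_add dot_scale)
    have "u * dot \<gamma> (\<Phi> s t u v) + v * dot \<delta> (\<Phi> s t u v) = 0" for s t u v
      using rel[of u v s t] unfolding \<gamma> \<delta> z12_\<Phi> by algebra
    then have "dot \<gamma> (h 3) = 0" "dot \<gamma> (h 4) = 0" "dot \<delta> (h 3) = 0" "dot \<delta> (h 4) = 0"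
      using no by blast+
    then show ?thesis by (simp add: \<gamma> \<delta> z_h)
  qed
  let ?c0 = "z 3 A0" and ?c1 = "z 3 A1" and ?c2 = "z 3 A2"
  let ?d0 = "z 3 B0" and ?d1 = "z 3 B1" and ?d2 = "z 3 B2"
  let ?e0 = "z 4 A0" and ?e1 = "z 4 A1" and ?e2 = "z 4 A2"
  let ?f0 = "z 4 B0" and ?f1 = "z 4 B1" and ?f2 = "z 4 B2"
  \<comment> \<open>The cofactors of the first column, applied to the three rows at
    \<open>(s^2, s t, t^2)\<close>, give \<open>s^2\<close> times the determinant; \<open>x1\<close>
    and \<open>x2\<close> use the other columns. Their coefficients at \<open>z 4\<close> together
    form the cross products of \<open>q\<close> with the \<open>u\<close> and \<open>v\<close> parts
    of the third coordinate.\<close>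
  have x0: "q1 * ?c2 - q2 * ?c1 = 0 \<and> q1 * ?d2 - q2 * ?d1 = 0"
  proof -
    have "(u\<^sup>2 * (?c1 * ?e2 - ?c2 * ?e1) + u * v * (?c1 * ?f2 - ?c2 * ?f1 + ?d1 * ?e2 - ?d2 * ?e1) +
        v\<^sup>2 * (?d1 * ?f2 - ?d2 * ?f1)) * q s t +
      (u * (?e1 * q2 - ?e2 * q1) + v * (?f1 * q2 - ?f2 * q1)) * z 3 (\<Phi> s t u v) +
      (u * (q1 * ?c2 - q2 * ?c1) + v * (q1 * ?d2 - q2 * ?d1)) * z 4 (\<Phi> s t u v) = s\<^sup>2 * \<Delta> u v"
      for s t u v unfolding z34_\<Phi> q_def \<Delta>_def nr_defs by algebra
    then show ?thesis using key unfolding \<Delta> mult_zero_right by blast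
  qed
  have x1: "q2 * ?c0 - q0 * ?c2 = 0 \<and> q2 * ?d0 - q0 * ?d2 = 0"
  proof -
    have "(u\<^sup>2 * (?c2 * ?e0 - ?c0 * ?e2) + u * v * (?c2 * ?f0 - ?c0 * ?f2 + ?d2 * ?e0 - ?d0 * ?e2) +
        v\<^sup>2 * (?d2 * ?f0 - ?d0 * ?f2)) * q s t +
      (u * (?e2 * q0 - ?e0 * q2) + v * (?f2 * q0 - ?f0 * q2)) * z 3 (\<Phi> s t u v) +
      (u * (q2 * ?c0 - q0 * ?c2) + v * (q2 * ?d0 - q0 * ?d2)) * z 4 (\<Phi> s t u v) = s * t * \<Delta> u v"
      for s t u v unfolding z34_\<Phi> q_def \<Delta>_def nr_defs by algebra
    then show ?thesis using key unfolding \<Delta> mult_zero_right by blast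
  qed
  have x2: "q0 * ?c1 - q1 * ?c0 = 0 \<and> q0 * ?d1 - q1 * ?d0 = 0"
  proof -
    have "(u\<^sup>2 * (?c0 * ?e1 - ?c1 * ?e0) + u * v * (?c0 * ?f1 - ?c1 * ?f0 + ?d0 * ?e1 - ?d1 * ?e0) +
        v\<^sup>2 * (?d0 * ?f1 - ?d1 * ?f0)) * q s t +
      (u * (?e0 * q1 - ?e1 * q0) + v * (?f0 * q1 - ?f1 * q0)) * z 3 (\<Phi> s t u v) +
      (u * (q0 * ?c1 - q1 * ?c0) + v * (q0 * ?d1 - q1 * ?d0)) * z 4 (\<Phi> s t u v) = t\<^sup>2 * \<Delta> u v"
      for s t u v unfolding z34_\<Phi> q_def \<Delta>_def nr_defs by algebra
    then show ?thesis using key unfolding \<Delta> mult_zero_right by blast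
  qed
  \<comment> \<open>By the vanishing cross products both parts of the third coordinate are multiples
    of \<open>q\<close>. Were \<open>q\<close> zero, the first coordinate would vanish on the
    surface, against \<open>indep\<close>.\<close>
  have "\<exists>l m. (?c0 = l * q0 \<and> ?c1 = l * q1 \<and> ?c2 = l * q2) \<and> (?d0 = m * q0 \<and> ?d1 = m * q1 \<and> ?d2 = m * q2)"
  proof -
    consider "q0 \<noteq> 0" | "q1 \<noteq> 0" | "q2 \<noteq> 0" | "q0 = 0" "q1 = 0" "q2 = 0" by blast
    then show ?thesis
    proof cases
      case 1
      then have "?c0 = ?c0 / q0 * q0 \<and> ?c1 = ?c0 / q0 * q1 \<and> ?c2 = ?c0 / q0 * q2"
        "?d0 = ?d0 / q0 * q0 \<and> ?d1 = ?d0 / q0 * q1 \<and> ?d2 = ?d0 / q0 * q2"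
        using x1 x2 by (auto simp: field_simps)
      then show ?thesis by blast
    next
      case 2
      then have "?c0 = ?c1 / q1 * q0 \<and> ?c1 = ?c1 / q1 * q1 \<and> ?c2 = ?c1 / q1 * q2"
        "?d0 = ?d1 / q1 * q0 \<and> ?d1 = ?d1 / q1 * q1 \<and> ?d2 = ?d1 / q1 * q2"
        using x0 x2 by (auto simp: field_simps)
      then show ?thesis by blast
    next
      case 3
      then have "?c0 = ?c2 / q2 * q0 \<and> ?c1 = ?c2 / q2 * q1 \<and> ?c2 = ?c2 / q2 * q2"
        "?d0 = ?d2 / q2 * q0 \<and> ?d1 = ?d2 / q2 * q1 \<and> ?d2 = ?d2 / q2 * q2"
        using x0 x1 by (auto simp: field_simps)
      then show ?thesis by blast
    next
      case 4
      have "G $ 1 = 0" by (rule indep) (simp_all add: z1 4 flip: z_dot)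
      then have "z 1 (h 1) = 0" by (simp add: z_dot dot_def)
      then show ?thesis by (simp add: z_h)
    qed
  qed
  then obtain l m where lm: "?c0 = l * q0" "?c1 = l * q1" "?c2 = l * q2"
    "?d0 = m * q0" "?d1 = m * q1" "?d2 = m * q2" by blast
  \<comment> \<open>On the surface the third coordinate is \<open>l\<close> times the first plus
    \<open>m\<close> times the second, so this functional vanishes there.\<close>
  define c where "c = G $ 3 + (- l) *s (G $ 1) + (- m) *s (G $ 2)"
  have c: "dot c x = z 3 x - l * z 1 x - m * z 2 x" for x
    unfolding c_def dot_add dot_scale z_dot by simp
  have "c = 0" by (rule indep) (simp_all add: c z1 z2 lm)
  then have "dot c (h 3) = 0" by (simp add: dot_def)
  then show False by (simp add: c z_h)
qed

end

section \<open>Bigraded polynomials\<close>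

definition bimono :: "nat \<Rightarrow> nat \<Rightarrow> nat \<Rightarrow> nat \<Rightarrow> bivar \<Rightarrow>\<^sub>0 nat" where
  "bimono a b c d = Poly_Mapping.single Vs a + Poly_Mapping.single Vt b +
    Poly_Mapping.single Vu c + Poly_Mapping.single Vv d"

lemma lookup_bimono [simp]:
  "Poly_Mapping.lookup (bimono a b c d) Vs = a" "Poly_Mapping.lookup (bimono a b c d) Vt = b"
  "Poly_Mapping.lookup (bimono a b c d) Vu = c" "Poly_Mapping.lookup (bimono a b c d) Vv = d"
  by (simp_all add: bimono_def lookup_add lookup_single when_def)

lemma bimono_eq_iff [simp]:
  "bimono a b c d = bimono a' b' c' d' \<longleftrightarrow> a = a' \<and> b = b' \<and> c = c' \<and> d = d'"
  by (metis lookup_bimono)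

lemma bimono_lookup:
  "e = bimono (Poly_Mapping.lookup e Vs) (Poly_Mapping.lookup e Vt)
    (Poly_Mapping.lookup e Vu) (Poly_Mapping.lookup e Vv)"
proof (rule poly_mapping_eqI)
  fix x show "Poly_Mapping.lookup e x = Poly_Mapping.lookup (bimono (Poly_Mapping.lookup e Vs)
    (Poly_Mapping.lookup e Vt) (Poly_Mapping.lookup e Vu) (Poly_Mapping.lookup e Vv)) x"
    by (cases x) simp_all
qed

lemma monomial_eval_bivar:
  fixes x :: "bivar \<Rightarrow> 'k::comm_semiring_1"
  shows "(\<Prod>i\<in>Poly_Mapping.keys e. x i ^ Poly_Mapping.lookup e i) =
    x Vs ^ Poly_Mapping.lookup e Vs * x Vt ^ Poly_Mapping.lookup e Vt *
    (x Vu ^ Poly_Mapping.lookup e Vu * x Vv ^ Poly_Mapping.lookup e Vv)"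
proof -
  have "Poly_Mapping.keys e \<subseteq> {Vs, Vt, Vu, Vv}" by (auto intro: bivar.exhaust)
  then show ?thesis by (subst monomial_eval_superset[of "{Vs, Vt, Vu, Vv}"]) (simp_all add: mult.assoc)
qed

lemma bieval_add: "bieval a b (f + g) = bieval a b f + bieval a b g"
  by (simp add: bieval_def eval_poly_add)

lemma bieval_mult: "bieval a b (f * g) = bieval a b f * bieval a b g"
  by (simp add: bieval_def eval_poly_mult)

lemma bieval_sum: "bieval a b (sum f A) = (\<Sum>i\<in>A. bieval a b (f i))"
  by (simp add: bieval_def eval_poly_sum)

lemma bieval_0: "bieval a b 0 = 0"
  by (simp add: bieval_def)

lemma bieval_scale: "bieval a b (poly_scale c f) = c * bieval a b f"
  by (simp add: bieval_def poly_scale_def const_poly_def eval_poly_mult eval_poly_single)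

lemma bieval_superset:
  assumes "finite S" "Poly_Mapping.keys f \<subseteq> S"
  shows "bieval a b f = (\<Sum>e\<in>S. Poly_Mapping.lookup f e *
    (a $ 1 ^ Poly_Mapping.lookup e Vs * a $ 2 ^ Poly_Mapping.lookup e Vt *
    (b $ 1 ^ Poly_Mapping.lookup e Vu * b $ 2 ^ Poly_Mapping.lookup e Vv)))"
  unfolding bieval_def eval_poly_superset[OF assms] monomial_eval_bivar by simp

text \<open>
  The substitution \<open>s = u = 1\<close>, \<open>t = T\<close>, \<open>v = T\<^sup>m\<^sup>+\<^sup>1\<close> sends the monomials of bidegree \<open>(m, n)\<close> to distinct
  powers of \<open>T\<close>.
\<close>

lemma bigraded_piece_eq_0:
  fixes f :: "'k::alg_closed_field bipoly"
  assumes f: "f \<in> bigraded_piece m n" and zero: "\<And>a b. bieval a b f = 0"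
  shows "f = 0"
proof -
  let ?l = "Poly_Mapping.lookup"
  let ?N = "\<lambda>e. ?l e Vt + (m + 1) * ?l e Vv"
  define P where "P = (\<Sum>e\<in>Poly_Mapping.keys f. monom (?l f e) (?N e))"
  have "poly P T = bieval (vector [1, T]) (vector [1, T ^ (m + 1)]) f" for T
    by (simp add: P_def poly_sum poly_monom bieval_superset[of "Poly_Mapping.keys f"]
        power_add power_mult power_mult_distrib mult.commute)
  then have "P = 0" using zero by (intro poly_eq_0_if_vanishing) simp
  \<comment> \<open>The exponent of \<open>Vt\<close> is at most \<open>m\<close>, so it is the
    remainder of \<open>?N e\<close> modulo \<open>m + 1\<close>, and that of \<open>Vv\<close> is
    the quotient; the bidegree fixes the other two.\<close>
  have inj: "e = e'" if e: "e \<in> Poly_Mapping.keys f" "e' \<in> Poly_Mapping.keys f" "?N e = ?N e'" for e e'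
  proof -
    have deg: "?l e Vs + ?l e Vt = m" "?l e Vu + ?l e Vv = n" "?l e' Vs + ?l e' Vt = m" "?l e' Vu + ?l e' Vv = n"
      using f e(1,2) by (auto simp: bigraded_piece_def)
    have "?N e mod (m + 1) = ?l e Vt" "?N e' mod (m + 1) = ?l e' Vt"
      "?N e div (m + 1) = ?l e Vv" "?N e' div (m + 1) = ?l e' Vv"
      using deg by (simp_all del: add_Suc_right add: div_add1_eq)
    then have "?l e Vt = ?l e' Vt" "?l e Vv = ?l e' Vv" using e(3) by metis+
    then show ?thesis
      using deg by (intro trans[OF bimono_lookup[of e] trans[OF _ bimono_lookup[of e', symmetric]]]) auto
  qed
  have "?l f e = 0" for e
  proof (rule ccontr)
    assume "?l f e \<noteq> 0"
    then have e: "e \<in> Poly_Mapping.keys f" by (simp add: in_keys_iff)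
    have "poly.coeff P (?N e) = (\<Sum>e'\<in>Poly_Mapping.keys f. if e' = e then ?l f e' else 0)"
      unfolding P_def coeff_sum coeff_monom
      by (intro sum.cong refl) (use inj e in auto)
    also have "\<dots> = ?l f e" using e by (simp add: sum.delta)
    finally show False using \<open>P = 0\<close> \<open>?l f e \<noteq> 0\<close> by simp
  qed
  then show ?thesis by (intro poly_mapping_eqI) simp
qed

lemma bigraded_piece_0: "0 \<in> bigraded_piece m n"
  by (simp add: bigraded_piece_def)

lemma bigraded_piece_add:
  "f \<in> bigraded_piece m n \<Longrightarrow> g \<in> bigraded_piece m n \<Longrightarrow> f + g \<in> bigraded_piece m n"
  using keys_add[of f g] by (auto simp: bigraded_piece_def)

lemma bigraded_piece_sum:
  "(\<And>i. i \<in> A \<Longrightarrow> f i \<in> bigraded_piece m n) \<Longrightarrow> sum f A \<in> bigraded_piece m n"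
  by (induction A rule: infinite_finite_induct) (auto intro: bigraded_piece_0 bigraded_piece_add)

lemma bigraded_piece_mult:
  assumes f: "f \<in> bigraded_piece m n" and g: "g \<in> bigraded_piece m' n'"
  shows "f * g \<in> bigraded_piece (m + m') (n + n')"
  unfolding bigraded_piece_def
proof (rule CollectI, rule ballI)
  fix e assume "e \<in> Poly_Mapping.keys (f * g)"
  then obtain a b where ab: "e = a + b" "a \<in> Poly_Mapping.keys f" "b \<in> Poly_Mapping.keys g"
    using keys_mult[of f g] by blast
  have "Poly_Mapping.lookup a Vs + Poly_Mapping.lookup a Vt = m \<and>
      Poly_Mapping.lookup a Vu + Poly_Mapping.lookup a Vv = n"
    using f ab(2) by (simp add: bigraded_piece_def)
  moreover have "Poly_Mapping.lookup b Vs + Poly_Mapping.lookup b Vt = m' \<and>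
      Poly_Mapping.lookup b Vu + Poly_Mapping.lookup b Vv = n'"
    using g ab(3) by (simp add: bigraded_piece_def)
  ultimately show "Poly_Mapping.lookup e Vs + Poly_Mapping.lookup e Vt = m + m' \<and>
      Poly_Mapping.lookup e Vu + Poly_Mapping.lookup e Vv = n + n'"
    unfolding ab(1) lookup_add by simp
qed

lemma bieval_10:
  assumes "f \<in> bigraded_piece 1 0"
  shows "bieval a b f = Poly_Mapping.lookup f (bimono 1 0 0 0) * a $ 1 +
    Poly_Mapping.lookup f (bimono 0 1 0 0) * a $ 2"
proof -
  have "Poly_Mapping.keys f \<subseteq> {bimono 1 0 0 0, bimono 0 1 0 0}"
  proof
    fix e assume "e \<in> Poly_Mapping.keys f"
    then have "Poly_Mapping.lookup e Vs + Poly_Mapping.lookup e Vt = 1"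
      "Poly_Mapping.lookup e Vu + Poly_Mapping.lookup e Vv = 0"
      using assms by (auto simp: bigraded_piece_def)
    then show "e \<in> {bimono 1 0 0 0, bimono 0 1 0 0}"
      using bimono_lookup[of e] by (cases "Poly_Mapping.lookup e Vs") auto
  qed
  then show ?thesis
    by (subst bieval_superset[of "{bimono 1 0 0 0, bimono 0 1 0 0}"]) auto
qed

lemma bieval_01:
  assumes "f \<in> bigraded_piece 0 1"
  shows "bieval a b f = Poly_Mapping.lookup f (bimono 0 0 1 0) * b $ 1 +
    Poly_Mapping.lookup f (bimono 0 0 0 1) * b $ 2"
proof -
  have "Poly_Mapping.keys f \<subseteq> {bimono 0 0 1 0, bimono 0 0 0 1}"
  proof
    fix e assume "e \<in> Poly_Mapping.keys f"
    then have "Poly_Mapping.lookup e Vs + Poly_Mapping.lookup e Vt = 0"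
      "Poly_Mapping.lookup e Vu + Poly_Mapping.lookup e Vv = 1"
      using assms by (auto simp: bigraded_piece_def)
    then show "e \<in> {bimono 0 0 1 0, bimono 0 0 0 1}"
      using bimono_lookup[of e] by (cases "Poly_Mapping.lookup e Vu") auto
  qed
  then show ?thesis
    by (subst bieval_superset[of "{bimono 0 0 1 0, bimono 0 0 0 1}"]) auto
qed

lemma bieval_21:
  assumes "f \<in> bigraded_piece 2 1"
  shows "bieval a b f =
    b $ 1 * ((a $ 1)\<^sup>2 * Poly_Mapping.lookup f (bimono 2 0 1 0) +
      (a $ 1 * a $ 2) * Poly_Mapping.lookup f (bimono 1 1 1 0) +
      (a $ 2)\<^sup>2 * Poly_Mapping.lookup f (bimono 0 2 1 0)) +
    b $ 2 * ((a $ 1)\<^sup>2 * Poly_Mapping.lookup f (bimono 2 0 0 1) +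
      (a $ 1 * a $ 2) * Poly_Mapping.lookup f (bimono 1 1 0 1) +
      (a $ 2)\<^sup>2 * Poly_Mapping.lookup f (bimono 0 2 0 1))"
proof -
  let ?S = "{bimono 2 0 1 0, bimono 1 1 1 0, bimono 0 2 1 0,
    bimono 2 0 0 1, bimono 1 1 0 1, bimono 0 2 0 1}"
  have "Poly_Mapping.keys f \<subseteq> ?S"
  proof
    fix e assume "e \<in> Poly_Mapping.keys f"
    then have *: "Poly_Mapping.lookup e Vs + Poly_Mapping.lookup e Vt = 2"
      "Poly_Mapping.lookup e Vu + Poly_Mapping.lookup e Vv = 1"
      using assms by (auto simp: bigraded_piece_def)
    have "(Poly_Mapping.lookup e Vs = 2 \<and> Poly_Mapping.lookup e Vt = 0 \<or>
        Poly_Mapping.lookup e Vs = 1 \<and> Poly_Mapping.lookup e Vt = 1 \<or>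
        Poly_Mapping.lookup e Vs = 0 \<and> Poly_Mapping.lookup e Vt = 2)"
      using *(1) by presburger
    moreover have "Poly_Mapping.lookup e Vu = 1 \<and> Poly_Mapping.lookup e Vv = 0 \<or>
        Poly_Mapping.lookup e Vu = 0 \<and> Poly_Mapping.lookup e Vv = 1"
      using *(2) by presburger
    ultimately show "e \<in> ?S"
      using bimono_lookup[of e] by auto
  qed
  then show ?thesis
    by (subst bieval_superset[of ?S]) (simp_all add: algebra_simps)
qed

definition form_01 :: "'k \<Rightarrow> 'k \<Rightarrow> 'k::comm_ring_1 bipoly" where
  "form_01 c d = Poly_Mapping.single (bimono 0 0 1 0) c + Poly_Mapping.single (bimono 0 0 0 1) d"

lemma form_01_bigraded: "form_01 c d \<in> bigraded_piece 0 1"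
  unfolding form_01_def
  by (intro bigraded_piece_add) (auto simp: bigraded_piece_def split: if_splits)

lemma lookup_form_01:
  "Poly_Mapping.lookup (form_01 c d) (bimono 0 0 1 0) = c"
  "Poly_Mapping.lookup (form_01 c d) (bimono 0 0 0 1) = d"
  by (simp_all add: form_01_def lookup_add lookup_single when_def)

lemma lookup_poly_scale: "Poly_Mapping.lookup (poly_scale c f) e = c * Poly_Mapping.lookup f e"
  unfolding poly_scale_def const_poly_def
  by (simp flip: mult_map_scale_conv_mult add: Poly_Mapping.map.rep_eq when_def)

section \<open>Reduction to coordinates\<close>

lemma quadratic_coeffs_zero:
  fixes c0 c1 c2 :: "'k::alg_closed_field"
  assumes "\<And>T. c0 + c1 * T + c2 * T\<^sup>2 = 0"
  shows "c0 = 0 \<and> c1 = 0 \<and> c2 = 0"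
proof -
  have "[:c0, c1, c2:] = 0"
  proof (rule poly_eq_0_if_vanishing)
    fix T show "poly [:c0, c1, c2:] T = 0"
      using assms[of T] by (simp add: algebra_simps power2_eq_square)
  qed
  then show ?thesis by simp
qed

lemma cubic_coeffs_zero:
  fixes c0 c1 c2 c3 :: "'k::alg_closed_field"
  assumes "\<And>T. c0 + c1 * T + c2 * T\<^sup>2 + c3 * T ^ 3 = 0"
  shows "c0 = 0 \<and> c1 = 0 \<and> c2 = 0 \<and> c3 = 0"
proof -
  have "[:c0, c1, c2, c3:] = 0"
  proof (rule poly_eq_0_if_vanishing)
    fix T show "poly [:c0, c1, c2, c3:] T = 0"
      using assms[of T] by (simp add: algebra_simps power2_eq_square power3_eq_cube)
  qed
  then show ?thesis by simp
qed

lemma extend_to_invertible: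
  fixes v w :: "'k::field ^ 4"
  assumes "\<And>a b. a *s v + b *s w = 0 \<Longrightarrow> a = 0 \<and> b = 0"
  obtains G H :: "'k ^ 4 ^ 4" where "G ** H = mat 1" "H ** G = mat 1" "G $ 1 = v" "G $ 2 = w"
proof -
  have vw: "vec.independent {v, w}" "v \<noteq> w" using independent_pair[of v w] assms by auto
  obtain B where B: "{v, w} \<subseteq> B" "vec.independent B" "UNIV \<subseteq> vec.span B"
    using vec.maximal_independent_subset_extend[OF subset_UNIV vw(1)] by metis
  have "card B = 4"
    using vec.dim_eq_card[of B UNIV] B
    by (simp add: vec_dim_card top.extremum_unique del: vec.dim_UNIV)
  then have "finite B" by (metis card.infinite zero_neq_numeral)
  have "card (B - {v, w}) = 2"
    using card_Diff_subset[of "{v, w}" B] B(1) \<open>card B = 4\<close> vw(2) by simp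
  then obtain x y where xy: "B - {v, w} = {x, y}" "x \<noteq> y" by (auto simp: card_2_iff)
  have xyB: "x \<in> B" "y \<in> B" and dist: "x \<noteq> v" "x \<noteq> w" "y \<noteq> v" "y \<noteq> w" using xy by auto
  define G :: "'k ^ 4 ^ 4" where "G = (\<chi> i. if i = 1 then v else if i = 2 then w else if i = 3 then x else y)"
  have G: "G $ 1 = v" "G $ 2 = w" "G $ 3 = x" "G $ 4 = y" by (simp_all add: G_def)
  have row: "row i G = G $ i" for i by (simp add: row_def vec_eq_iff)
  have "\<exists>H :: 'k ^ 4 ^ 4. G ** H = mat 1"
    unfolding matrix_right_invertible_independent_rows
  proof (intro allI impI)
    fix c :: "4 \<Rightarrow> 'k" and i :: 4
    assume "(\<Sum>i\<in>UNIV. c i *s row i G) = 0"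
    then have eq: "c 1 *s v + c 2 *s w + c 3 *s x + c 4 *s y = 0" by (simp add: sum_4 row G)
    define u where "u b = (if b = v then c 1 else if b = w then c 2 else if b = x then c 3 else c 4)" for b
    have u: "u v = c 1" "u w = c 2" "u x = c 3" "u y = c 4"
      using dist vw(2) xy(2) by (auto simp: u_def)
    have "(\<Sum>b\<in>{v, w, x, y}. u b *s b) = 0"
      using eq dist dist[symmetric] vw(2) xy(2) by (simp add: u add.assoc)
    then have "u b = 0" if "b \<in> {v, w, x, y}" for b
      using vec.independentD[OF B(2), of "{v, w, x, y}" u b] that B(1) xyB by auto
    then have "c 1 = 0" "c 2 = 0" "c 3 = 0" "c 4 = 0" using u by auto
    then show "c i = 0" using exhaust_4[of i] by auto
  qed
  then obtain H where H: "G ** H = mat 1" by blast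
  then have "H ** G = mat 1" by (rule matrix_left_right_inverse1)
  then show thesis using that H G(1,2) by blast
qed

section \<open>Normal forms for the two kinds of linear syzygy\<close>

context tensor_surface
begin

lemma dot_\<Phi>: "dot c (\<Phi> s t u v) = u * (s\<^sup>2 * dot c A0 + (s * t) * dot c A1 + t\<^sup>2 * dot c A2) +
    v * (s\<^sup>2 * dot c B0 + (s * t) * dot c B1 + t\<^sup>2 * dot c B2)"
  by (simp add: \<Phi>_def dot_add_right dot_scale_right)

text \<open>The syzygy says that the values of \<open>- \<beta>\<close> and \<open>\<alpha>\<close>
  on the surface are proportional to \<open>(s, t)\<close>, which dictates the first two rows of
  \<open>G\<close>. Comparing coefficients of a cubic in \<open>T\<close> yields the shape required
  by \<open>syzygy_st\<close>.\<close>

lemma lines_if_syzygy_st: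
  assumes indep: "\<And>c. dot c A0 = 0 \<Longrightarrow> dot c A1 = 0 \<Longrightarrow> dot c A2 = 0 \<Longrightarrow>
      dot c B0 = 0 \<Longrightarrow> dot c B1 = 0 \<Longrightarrow> dot c B2 = 0 \<Longrightarrow> c = 0"
    and syz: "\<And>s t u v. s * dot \<alpha> (\<Phi> s t u v) + t * dot \<beta> (\<Phi> s t u v) = 0"
    and nonzero: "\<alpha> \<noteq> 0 \<or> \<beta> \<noteq> 0"
  shows "\<exists>\<L>. finite \<L> \<and> (\<forall>L\<in>\<L>. proj_line L) \<and> codim1_singular_locus X = \<Union>\<L>"
proof -
  have A: "dot \<alpha> A0 = 0 \<and> dot \<alpha> A1 + dot \<beta> A0 = 0 \<and> dot \<alpha> A2 + dot \<beta> A1 = 0 \<and> dot \<beta> A2 = 0"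
  proof (rule cubic_coeffs_zero)
    fix T
    show "dot \<alpha> A0 + (dot \<alpha> A1 + dot \<beta> A0) * T + (dot \<alpha> A2 + dot \<beta> A1) * T\<^sup>2 + dot \<beta> A2 * T ^ 3 = 0"
      using syz[of 1 T 1 0] by (simp add: dot_\<Phi> algebra_simps power2_eq_square power3_eq_cube)
  qed
  have B: "dot \<alpha> B0 = 0 \<and> dot \<alpha> B1 + dot \<beta> B0 = 0 \<and> dot \<alpha> B2 + dot \<beta> B1 = 0 \<and> dot \<beta> B2 = 0"
  proof (rule cubic_coeffs_zero)
    fix T
    show "dot \<alpha> B0 + (dot \<alpha> B1 + dot \<beta> B0) * T + (dot \<alpha> B2 + dot \<beta> B1) * T\<^sup>2 + dot \<beta> B2 * T ^ 3 = 0"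
      using syz[of 1 T 0 1] by (simp add: dot_\<Phi> algebra_simps power2_eq_square power3_eq_cube)
  qed
  have rel: "dot \<beta> A0 = - dot \<alpha> A1" "dot \<beta> A1 = - dot \<alpha> A2" "dot \<beta> B0 = - dot \<alpha> B1" "dot \<beta> B1 = - dot \<alpha> B2"
    using A B by (simp_all add: eq_neg_iff_add_eq_0 add.commute)
  \<comment> \<open>The ratio of the two functionals varies like \<open>s : t\<close>, so a constant
    relation forces both to vanish on the surface, and \<open>indep\<close> makes them zero.\<close>
  have ind: "a = 0 \<and> b = 0" if ab: "a *s ((- 1) *s \<beta>) + b *s \<alpha> = 0" for a b
  proof (rule ccontr)
    assume ne: "\<not> (a = 0 \<and> b = 0)"
    have comb: "b * dot \<alpha> x = a * dot \<beta> x" for x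
    proof -
      have "dot (a *s ((- 1) *s \<beta>) + b *s \<alpha>) x = 0" unfolding ab by simp
      then show ?thesis unfolding dot_add dot_scale by (simp add: algebra_simps)
    qed
    have "dot \<alpha> A1 = 0" "dot \<alpha> A2 = 0" "dot \<alpha> B1 = 0" "dot \<alpha> B2 = 0"
      using comb[of A0] comb[of A1] comb[of A2] comb[of B0] comb[of B1] comb[of B2] A B rel ne
      by (cases "a = 0"; auto)+
    then have "\<alpha> = 0" "\<beta> = 0" using A B rel by (auto intro!: indep)
    then show False using nonzero by simp
  qed
  obtain G H :: "'k ^ 4 ^ 4" where G: "G ** H = mat 1" "H ** G = mat 1" "G $ 1 = (- 1) *s \<beta>" "G $ 2 = \<alpha>"
    using extend_to_invertible[of "(- 1) *s \<beta>" \<alpha>] ind by metis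
  interpret surface_coordinates A0 A1 A2 B0 B1 B2 G H by unfold_locales fact+
  have z12: "z 1 x = - dot \<beta> x" "z 2 x = dot \<alpha> x" for x by (simp_all only: z_dot G dot_scale) simp
  interpret syzygy_st A0 A1 A2 B0 B1 B2 G H "dot \<alpha> A1" "dot \<alpha> A2" "dot \<alpha> B1" "dot \<alpha> B2"
    by unfold_locales (use A B rel in \<open>simp_all add: z12\<close>)
  show ?thesis by (rule codim1_lines)
qed

lemma lines_or_second_syzygy_uv:
  assumes indep: "\<And>c. dot c A0 = 0 \<Longrightarrow> dot c A1 = 0 \<Longrightarrow> dot c A2 = 0 \<Longrightarrow>
      dot c B0 = 0 \<Longrightarrow> dot c B1 = 0 \<Longrightarrow> dot c B2 = 0 \<Longrightarrow> c = 0"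
    and syz: "\<And>s t u v. u * dot \<alpha> (\<Phi> s t u v) + v * dot \<beta> (\<Phi> s t u v) = 0"
    and nonzero: "\<alpha> \<noteq> 0 \<or> \<beta> \<noteq> 0"
  shows "(\<exists>\<L>. finite \<L> \<and> (\<forall>L\<in>\<L>. proj_line L) \<and> codim1_singular_locus X = \<Union>\<L>) \<or>
    (\<exists>\<gamma> \<delta>. (\<forall>s t u v. u * dot \<gamma> (\<Phi> s t u v) + v * dot \<delta> (\<Phi> s t u v) = 0) \<and>
      \<not> (\<exists>c. \<gamma> = c *s \<alpha> \<and> \<delta> = c *s \<beta>))"
proof -
  have sq: "dot \<alpha> A0 = 0 \<and> dot \<alpha> A1 = 0 \<and> dot \<alpha> A2 = 0" "dot \<beta> B0 = 0 \<and> dot \<beta> B1 = 0 \<and> dot \<beta> B2 = 0"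
    "(dot \<beta> A0 + dot \<alpha> B0) = 0 \<and> (dot \<beta> A1 + dot \<alpha> B1) = 0 \<and> (dot \<beta> A2 + dot \<alpha> B2) = 0"
  proof -
    show A: "dot \<alpha> A0 = 0 \<and> dot \<alpha> A1 = 0 \<and> dot \<alpha> A2 = 0"
    proof (rule quadratic_coeffs_zero)
      fix T show "dot \<alpha> A0 + dot \<alpha> A1 * T + dot \<alpha> A2 * T\<^sup>2 = 0"
        using syz[of 1 1 T 0] by (simp add: dot_\<Phi> algebra_simps power2_eq_square power3_eq_cube)
    qed
    show B: "dot \<beta> B0 = 0 \<and> dot \<beta> B1 = 0 \<and> dot \<beta> B2 = 0"
    proof (rule quadratic_coeffs_zero)
      fix T show "dot \<beta> B0 + dot \<beta> B1 * T + dot \<beta> B2 * T\<^sup>2 = 0"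
        using syz[of 0 1 T 1] by (simp add: dot_\<Phi> algebra_simps power2_eq_square power3_eq_cube)
    qed
    \<comment> \<open>At \<open>u = v = 1\<close> the pure terms have gone and only the coefficient
      of \<open>u v\<close> is left.\<close>
    show "(dot \<beta> A0 + dot \<alpha> B0) = 0 \<and> (dot \<beta> A1 + dot \<alpha> B1) = 0 \<and> (dot \<beta> A2 + dot \<alpha> B2) = 0"
    proof (rule quadratic_coeffs_zero)
      fix T show "(dot \<beta> A0 + dot \<alpha> B0) + (dot \<beta> A1 + dot \<alpha> B1) * T + (dot \<beta> A2 + dot \<alpha> B2) * T\<^sup>2 = 0"
        using syz[of 1 1 T 1] A B unfolding dot_\<Phi> by (simp add: algebra_simps)
    qed
  qed
  have rel: "dot \<beta> A0 = - dot \<alpha> B0" "dot \<beta> A1 = - dot \<alpha> B1" "dot \<beta> A2 = - dot \<alpha> B2"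
    using sq(3) by (simp_all add: eq_neg_iff_add_eq_0)
  have ind: "a = 0 \<and> b = 0" if ab: "a *s ((- 1) *s \<beta>) + b *s \<alpha> = 0" for a b
  proof (rule ccontr)
    assume ne: "\<not> (a = 0 \<and> b = 0)"
    have comb: "b * dot \<alpha> x = a * dot \<beta> x" for x
    proof -
      have "dot (a *s ((- 1) *s \<beta>) + b *s \<alpha>) x = 0" unfolding ab by simp
      then show ?thesis unfolding dot_add dot_scale by (simp add: algebra_simps)
    qed
    have "dot \<alpha> B0 = 0" "dot \<alpha> B1 = 0" "dot \<alpha> B2 = 0"
      using comb[of A0] comb[of A1] comb[of A2] comb[of B0] comb[of B1] comb[of B2] sq(1,2) rel ne
      by (cases "a = 0"; auto)+
    then have "\<alpha> = 0" "\<beta> = 0" using sq(1,2) rel by (auto intro!: indep)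
    then show False using nonzero by simp
  qed
  obtain G H :: "'k ^ 4 ^ 4" where G: "G ** H = mat 1" "H ** G = mat 1" "G $ 1 = (- 1) *s \<beta>" "G $ 2 = \<alpha>"
    using extend_to_invertible[of "(- 1) *s \<beta>" \<alpha>] ind by metis
  interpret surface_coordinates A0 A1 A2 B0 B1 B2 G H by unfold_locales fact+
  have z12: "z 1 x = - dot \<beta> x" "z 2 x = dot \<alpha> x" for x by (simp_all only: z_dot G dot_scale) simp
  interpret syzygy_uv A0 A1 A2 B0 B1 B2 G H "dot \<alpha> B0" "dot \<alpha> B1" "dot \<alpha> B2"
    by unfold_locales (use sq(1,2) rel in \<open>simp_all add: z12\<close>)
  show ?thesis
  proof (cases "\<exists>u v. \<Delta> u v \<noteq> 0")
    case True
    then obtain u v where "\<Delta> u v \<noteq> 0" by blast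
    then show ?thesis by (rule disjI1[OF codim1_lines])
  next
    case False
    have "\<exists>\<gamma> \<delta>. (\<forall>s t u v. u * dot \<gamma> (\<Phi> s t u v) + v * dot \<delta> (\<Phi> s t u v) = 0) \<and>
      (dot \<gamma> (h 3) \<noteq> 0 \<or> dot \<gamma> (h 4) \<noteq> 0 \<or> dot \<delta> (h 3) \<noteq> 0 \<or> dot \<delta> (h 4) \<noteq> 0)"
    proof (rule second_syzygy)
      show "\<Delta> u v = 0" for u v using False by blast
    qed (rule indep)
    then obtain \<gamma> \<delta> where \<gamma>\<delta>: "\<forall>s t u v. u * dot \<gamma> (\<Phi> s t u v) + v * dot \<delta> (\<Phi> s t u v) = 0"
      "dot \<gamma> (h 3) \<noteq> 0 \<or> dot \<gamma> (h 4) \<noteq> 0 \<or> dot \<delta> (h 3) \<noteq> 0 \<or> dot \<delta> (h 4) \<noteq> 0"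
      by blast
    \<comment> \<open>Up to sign \<open>\<alpha>\<close> and \<open>\<beta>\<close> are the first
      two rows of \<open>G\<close>, so every multiple of the given syzygy vanishes on
      \<open>h 3\<close> and \<open>h 4\<close>.\<close>
    have "dot \<beta> (h 3) = 0" "dot \<beta> (h 4) = 0" "dot \<alpha> (h 3) = 0" "dot \<alpha> (h 4) = 0"
      using z12(1)[of "h 3"] z12(1)[of "h 4"] z12(2)[of "h 3"] z12(2)[of "h 4"] by (simp_all add: z_h)
    then have "\<not> (\<exists>c. \<gamma> = c *s \<alpha> \<and> \<delta> = c *s \<beta>)" using \<gamma>\<delta>(2) by (auto simp: dot_scale)
    then show ?thesis using \<gamma>\<delta>(1) by blast
  qed
qed

end

text \<open>A relation with \<open>c $ j\<close> nonzero would express \<open>p j\<close> by the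
  other three, and these span dimension at most 3. Working with indices also covers a family with
  repetitions.\<close>

lemma mpoly_coeffs_zero:
  fixes p :: "4 \<Rightarrow> 'k::field bipoly" and c :: "'k ^ 4"
  assumes dim: "mpoly_dim (mpoly_span (range p)) = 4"
    and zero: "(\<Sum>i\<in>UNIV. poly_scale (c $ i) (p i)) = 0"
  shows "c = 0"
proof (rule ccontr)
  assume "c \<noteq> 0"
  then obtain j where j: "c $ j \<noteq> 0" by (auto simp: vec_eq_iff)
  let ?S = "p ` (UNIV - {j})"
  have "poly_scale (c $ j) (p j) + (\<Sum>i\<in>UNIV - {j}. poly_scale (c $ i) (p i)) = 0"
    using zero by (simp add: sum.remove[of UNIV j])
  then have "poly_scale (c $ j) (p j) = - (\<Sum>i\<in>UNIV - {j}. poly_scale (c $ i) (p i))"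
    by (rule eq_neg_iff_add_eq_0[THEN iffD2])
  also have "\<dots> \<in> mpoly_span ?S"
    by (intro mpoly.span_neg mpoly.span_sum mpoly.span_scale mpoly.span_base imageI)
  finally have "poly_scale (inverse (c $ j)) (poly_scale (c $ j) (p j)) \<in> mpoly_span ?S"
    by (rule mpoly.span_scale)
  then have "p j \<in> mpoly_span ?S" using j by simp
  then have "range p \<subseteq> mpoly_span ?S" by (auto intro: mpoly.span_base)
  then have "mpoly_span (range p) \<subseteq> mpoly_span ?S"
    by (intro mpoly.span_minimal mpoly.subspace_span)
  then have "mpoly_dim (mpoly_span (range p)) \<le> card ?S" by (intro mpoly.dim_le_card) auto
  also have "\<dots> \<le> card (UNIV - {j})" by (rule card_image_le) simp
  also have "\<dots> = 3" by simp
  finally show False using dim by simp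
qed

theorem theorem7p3:
  fixes U :: "'k::alg_closed_field bipoly set" and p :: "4 \<Rightarrow> 'k bipoly"
  assumes "U = mpoly_span (range p)"
    and "U \<subseteq> bigraded_piece 2 1"
    and "mpoly_dim U = 4"
    and "basepoint_free U"
    and "unique_linear_syzygy p"
  shows "\<exists>\<L>. finite \<L> \<and> (\<forall>L\<in>\<L>. proj_line L) \<and>
           codim1_singular_locus (image_surface p) = \<Union>\<L>"
proof -
  let ?C = "\<lambda>m. (\<chi> i. Poly_Mapping.lookup (p i) m) :: 'k ^ 4"
  define A0 A1 A2 where A: "A0 = ?C (bimono 2 0 1 0)" "A1 = ?C (bimono 1 1 1 0)" "A2 = ?C (bimono 0 2 1 0)"
  define B0 B1 B2 where B: "B0 = ?C (bimono 2 0 0 1)" "B1 = ?C (bimono 1 1 0 1)" "B2 = ?C (bimono 0 2 0 1)"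
  have p: "p i \<in> bigraded_piece 2 1" for i
    using assms(1,2) mpoly.span_base[of "p i" "range p"] by auto
  have val: "(\<chi> i. bieval a b (p i)) =
      b $ 1 *s ((a $ 1)\<^sup>2 *s A0 + (a $ 1 * a $ 2) *s A1 + (a $ 2)\<^sup>2 *s A2) +
      b $ 2 *s ((a $ 1)\<^sup>2 *s B0 + (a $ 1 * a $ 2) *s B1 + (a $ 2)\<^sup>2 *s B2)" for a b
    by (simp add: vec_eq_iff bieval_21[OF p] A B)
  have scale: "(\<chi> i. bieval (c *s a) (d *s b) (p i)) = (c\<^sup>2 * d) *s (\<chi> i. bieval a b (p i))" for a b c d
    by (simp add: vec_eq_iff bieval_21[OF p] power_mult_distrib algebra_simps power2_eq_square)
  have nz: "(\<chi> i. bieval a b (p i)) \<noteq> 0" if ab: "a \<noteq> 0" "b \<noteq> 0" for a b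
  proof
    assume 0: "(\<chi> i. bieval a b (p i)) = 0"
    \<comment> \<open>Basepoint freeness speaks of all of \<open>U\<close> and of all
      representatives; bihomogeneity and induction over the span carry the zero there from the
      \<open>p i\<close>.\<close>
    have "bieval a' b' f = 0" if f: "f \<in> U" "a' \<in> vec.span {a}" "b' \<in> vec.span {b}" for f a' b'
    proof -
      obtain c d where cd: "a' = c *s a" "b' = d *s b"
        using f(2,3) unfolding span_singleton_mem by blast
      have "(\<chi> i. bieval a' b' (p i)) = 0" unfolding cd scale 0 by simp
      then have p0: "bieval a' b' (p i) = 0" for i by (simp add: vec_eq_iff)
      have "f \<in> mpoly_span (range p)" using f(1) assms(1) by simp
      then show ?thesis
      proof (induction rule: mpoly.span_induct_alt)
        case base
        show ?case by (rule bieval_0)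
      next
        case (step c x y)
        then show ?case using p0 by (auto simp: bieval_add bieval_scale)
      qed
    qed
    then show False
      using assms(4) ab span_in_proj_space unfolding basepoint_free_def by blast
  qed
  have vec2: "vector [s, t] \<noteq> (0 :: 'k ^ 2)" if "s \<noteq> 0 \<or> t \<noteq> 0" for s t
    using that by (auto simp: vec_eq_iff forall_2)
  interpret tensor_surface A0 A1 A2 B0 B1 B2
  proof
    fix s t u v :: 'k
    assume "s \<noteq> 0 \<or> t \<noteq> 0" "u \<noteq> 0 \<or> v \<noteq> 0"
    then show "u *s (s\<^sup>2 *s A0 + (s * t) *s A1 + t\<^sup>2 *s A2) +
        v *s (s\<^sup>2 *s B0 + (s * t) *s B1 + t\<^sup>2 *s B2) \<noteq> 0"
      using nz[OF vec2 vec2, of s t u v] unfolding val by simp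
  qed
  have val\<Phi>: "(\<chi> i. bieval a b (p i)) = \<Phi> (a $ 1) (a $ 2) (b $ 1) (b $ 2)" for a b
    unfolding val \<Phi>_def ..
  have phi: "phi p (vec.span {a}) (vec.span {b}) = vec.span {\<Phi> (a $ 1) (a $ 2) (b $ 1) (b $ 2)}" for a b
  proof -
    let ?S = "{(\<chi> i. bieval a' b' (p i)) | a' b'. a' \<in> vec.span {a} \<and> b' \<in> vec.span {b}}"
    have "?S \<subseteq> vec.span {\<Phi> (a $ 1) (a $ 2) (b $ 1) (b $ 2)}"
    proof
      fix y assume "y \<in> ?S"
      then obtain c d where "y = (\<chi> i. bieval (c *s a) (d *s b) (p i))"
        unfolding span_singleton_mem by blast
      then show "y \<in> vec.span {\<Phi> (a $ 1) (a $ 2) (b $ 1) (b $ 2)}"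
        unfolding scale val\<Phi> span_singleton_mem by blast
    qed
    moreover have "\<Phi> (a $ 1) (a $ 2) (b $ 1) (b $ 2) \<in> ?S"
      using vec.span_base[of a "{a}"] vec.span_base[of b "{b}"] unfolding val\<Phi>[symmetric] by blast
    ultimately show ?thesis
      unfolding phi_def
      by (intro equalityI vec.span_minimal vec.subspace_span vec.span_mono) auto
  qed
  have X: "image_surface p = X"
  proof (intro equalityI subsetI)
    fix P assume "P \<in> image_surface p"
    then obtain a b where ab: "a \<noteq> 0" "b \<noteq> 0" "P = phi p (vec.span {a}) (vec.span {b})"
      unfolding image_surface_def proj_space_def by auto
    then show "P \<in> X" unfolding phi
      by (auto intro!: X_memI simp: vec_eq_iff forall_2)
  next
    fix P assume "P \<in> X"
    then obtain s t u v where P: "P = vec.span {\<Phi> s t u v}" "s \<noteq> 0 \<or> t \<noteq> 0" "u \<noteq> 0 \<or> v \<noteq> 0"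
      unfolding X_def by blast
    have "P = phi p (vec.span {vector [s, t]}) (vec.span {vector [u, v]})"
      unfolding phi P by simp
    then show "P \<in> image_surface p"
      unfolding image_surface_def
      using span_in_proj_space[OF vec2[OF P(2)]] span_in_proj_space[OF vec2[OF P(3)]] by auto
  qed
  \<comment> \<open>A functional that kills all six coefficient vectors is a linear relation between
    the \<open>p i\<close>, which are independent as \<open>U\<close> has dimension 4.\<close>
  have indep: "c = 0" if c: "dot c A0 = 0" "dot c A1 = 0" "dot c A2 = 0"
    "dot c B0 = 0" "dot c B1 = 0" "dot c B2 = 0" for c
  proof (rule mpoly_coeffs_zero)
    show "mpoly_dim (mpoly_span (range p)) = 4" using assms(1,3) by simp
    show "(\<Sum>i\<in>UNIV. poly_scale (c $ i) (p i)) = 0"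
    proof (rule bigraded_piece_eq_0)
      have "(\<Sum>i\<in>UNIV. poly_scale (c $ i) (p i)) \<in> mpoly_span (range p)"
        by (intro mpoly.span_sum mpoly.span_scale mpoly.span_base rangeI)
      then show "(\<Sum>i\<in>UNIV. poly_scale (c $ i) (p i)) \<in> bigraded_piece 2 1"
        using assms(1,2) by blast
      fix a b
      have "bieval a b (\<Sum>i\<in>UNIV. poly_scale (c $ i) (p i)) = dot c (\<chi> i. bieval a b (p i))"
        by (simp add: bieval_sum bieval_scale dot_def)
      then show "bieval a b (\<Sum>i\<in>UNIV. poly_scale (c $ i) (p i)) = 0"
        unfolding val\<Phi> dot_\<Phi> c by simp
    qed
  qed
  obtain g where g: "linear_syzygy p g"
    and unique: "\<And>h. linear_syzygy p h \<Longrightarrow> \<exists>c. c \<noteq> 0 \<and> (\<forall>i. h i = poly_scale c (g i))"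
    using assms(5) unfolding unique_linear_syzygy_def by blast
  consider "first_syzygy p 1 0 g" | "first_syzygy p 0 1 g" using g by (auto simp: linear_syzygy_def)
  then show ?thesis
    unfolding X
  proof cases
    case 1
    define \<alpha> :: "'k ^ 4" where "\<alpha> = (\<chi> i. Poly_Mapping.lookup (g i) (bimono 1 0 0 0))"
    define \<beta> :: "'k ^ 4" where "\<beta> = (\<chi> i. Poly_Mapping.lookup (g i) (bimono 0 1 0 0))"
    have gi: "g i \<in> bigraded_piece 1 0" for i using 1 by (simp add: first_syzygy_def)
    have ev: "bieval a b (g i) = \<alpha> $ i * a $ 1 + \<beta> $ i * a $ 2" for a b i
      using bieval_10[OF gi] by (simp add: \<alpha>_def \<beta>_def)
    have "s * dot \<alpha> (\<Phi> s t u v) + t * dot \<beta> (\<Phi> s t u v) = 0" for s t u v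
    proof -
      let ?a = "vector [s, t] :: 'k ^ 2" and ?b = "vector [u, v] :: 'k ^ 2"
      have "bieval ?a ?b (\<Sum>i\<in>UNIV. g i * p i) = 0" using 1 by (simp add: first_syzygy_def bieval_0)
      then have "(\<Sum>i\<in>UNIV. (\<alpha> $ i * s + \<beta> $ i * t) * bieval ?a ?b (p i)) = 0"
        by (simp add: bieval_sum bieval_mult ev)
      then have "s * dot \<alpha> (\<chi> i. bieval ?a ?b (p i)) + t * dot \<beta> (\<chi> i. bieval ?a ?b (p i)) = 0"
        by (simp add: dot_def sum_distrib_left algebra_simps sum.distrib)
      then show ?thesis unfolding val\<Phi> by simp
    qed
    moreover have "\<alpha> \<noteq> 0 \<or> \<beta> \<noteq> 0"
    proof (rule ccontr)
      assume "\<not> ?thesis"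
      then have "g i = 0" for i by (intro bigraded_piece_eq_0[OF gi]) (simp add: ev)
      then show False using 1 by (simp add: first_syzygy_def)
    qed
    ultimately show "\<exists>\<L>. finite \<L> \<and> (\<forall>L\<in>\<L>. proj_line L) \<and> codim1_singular_locus X = \<Union>\<L>"
      using lines_if_syzygy_st[of \<alpha> \<beta>] indep by blast
  next
    case 2
    define \<alpha> :: "'k ^ 4" where "\<alpha> = (\<chi> i. Poly_Mapping.lookup (g i) (bimono 0 0 1 0))"
    define \<beta> :: "'k ^ 4" where "\<beta> = (\<chi> i. Poly_Mapping.lookup (g i) (bimono 0 0 0 1))"
    have gi: "g i \<in> bigraded_piece 0 1" for i using 2 by (simp add: first_syzygy_def)
    have ev: "bieval a b (g i) = \<alpha> $ i * b $ 1 + \<beta> $ i * b $ 2" for a b i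
      using bieval_01[OF gi] by (simp add: \<alpha>_def \<beta>_def)
    have syz: "u * dot \<alpha> (\<Phi> s t u v) + v * dot \<beta> (\<Phi> s t u v) = 0" for s t u v
    proof -
      let ?a = "vector [s, t] :: 'k ^ 2" and ?b = "vector [u, v] :: 'k ^ 2"
      have "bieval ?a ?b (\<Sum>i\<in>UNIV. g i * p i) = 0" using 2 by (simp add: first_syzygy_def bieval_0)
      then have "(\<Sum>i\<in>UNIV. (\<alpha> $ i * u + \<beta> $ i * v) * bieval ?a ?b (p i)) = 0"
        by (simp add: bieval_sum bieval_mult ev)
      then have "u * dot \<alpha> (\<chi> i. bieval ?a ?b (p i)) + v * dot \<beta> (\<chi> i. bieval ?a ?b (p i)) = 0"
        by (simp add: dot_def sum_distrib_left algebra_simps sum.distrib)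
      then show ?thesis unfolding val\<Phi> by simp
    qed
    have nonzero: "\<alpha> \<noteq> 0 \<or> \<beta> \<noteq> 0"
    proof (rule ccontr)
      assume "\<not> ?thesis"
      then have "g i = 0" for i by (intro bigraded_piece_eq_0[OF gi]) (simp add: ev)
      then show False using 2 by (simp add: first_syzygy_def)
    qed
    \<comment> \<open>Uniqueness is stated for polynomials, so the pair is turned back into a tuple
      of linear forms in \<open>u, v\<close>, whose syzygy relation is checked on values. The zero
      tuple is no syzygy and gets \<open>c = 0\<close> separately.\<close>
    have scalar: "\<exists>c. \<gamma> = c *s \<alpha> \<and> \<delta> = c *s \<beta>"
      if \<gamma>\<delta>: "\<forall>s t u v. u * dot \<gamma> (\<Phi> s t u v) + v * dot \<delta> (\<Phi> s t u v) = 0" for \<gamma> \<delta>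
    proof (cases "\<gamma> = 0 \<and> \<delta> = 0")
      case True
      then show ?thesis by (intro exI[of _ 0]) simp
    next
      case False
      define f where "f i = form_01 (\<gamma> $ i) (\<delta> $ i)" for i
      have f: "f i \<in> bigraded_piece 0 1" for i unfolding f_def by (rule form_01_bigraded)
      have f_ev: "bieval a b (f i) = \<gamma> $ i * b $ 1 + \<delta> $ i * b $ 2" for a b i
        by (simp only: bieval_01[OF f]) (simp only: f_def lookup_form_01)
      have "\<exists>i. f i \<noteq> 0"
      proof (rule ccontr)
        assume "\<nexists>i. f i \<noteq> 0"
        then have f0: "form_01 (\<gamma> $ i) (\<delta> $ i) = 0" for i by (simp add: f_def)
        have "\<gamma> $ i = 0 \<and> \<delta> $ i = 0" for i
          using lookup_form_01[of "\<gamma> $ i" "\<delta> $ i"] unfolding f0 lookup_zero by simp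
        then show False using False by (simp add: vec_eq_iff)
      qed
      moreover have "(\<Sum>i\<in>UNIV. f i * p i) = 0"
      proof (rule bigraded_piece_eq_0)
        show "(\<Sum>i\<in>UNIV. f i * p i) \<in> bigraded_piece (0 + 2) (1 + 1)"
          by (intro bigraded_piece_sum bigraded_piece_mult f p)
        fix a b
        have "bieval a b (\<Sum>i\<in>UNIV. f i * p i) =
            (\<Sum>i\<in>UNIV. (\<gamma> $ i * b $ 1 + \<delta> $ i * b $ 2) * bieval a b (p i))"
          by (simp add: bieval_sum bieval_mult f_ev)
        also have "\<dots> = b $ 1 * dot \<gamma> (\<chi> i. bieval a b (p i)) + b $ 2 * dot \<delta> (\<chi> i. bieval a b (p i))"
          by (simp add: dot_def sum_distrib_left algebra_simps sum.distrib)
        finally show "bieval a b (\<Sum>i\<in>UNIV. f i * p i) = 0" unfolding val\<Phi> using \<gamma>\<delta> by simp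
      qed
      ultimately have "first_syzygy p 0 1 f" using f unfolding first_syzygy_def by blast
      then obtain c where c: "\<And>i. f i = poly_scale c (g i)"
        using unique[of f] unfolding linear_syzygy_def by blast
      have "\<gamma> $ i = c * \<alpha> $ i \<and> \<delta> $ i = c * \<beta> $ i" for i
        using lookup_form_01[of "\<gamma> $ i" "\<delta> $ i"] unfolding f_def[symmetric] c lookup_poly_scale
        by (simp add: \<alpha>_def \<beta>_def)
      then show ?thesis by (intro exI[of _ c]) (simp add: vec_eq_iff)
    qed
    have "(\<exists>\<L>. finite \<L> \<and> (\<forall>L\<in>\<L>. proj_line L) \<and> codim1_singular_locus X = \<Union>\<L>) \<or>
      (\<exists>\<gamma> \<delta>. (\<forall>s t u v. u * dot \<gamma> (\<Phi> s t u v) + v * dot \<delta> (\<Phi> s t u v) = 0) \<and>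
        \<not> (\<exists>c. \<gamma> = c *s \<alpha> \<and> \<delta> = c *s \<beta>))"
      by (rule lines_or_second_syzygy_uv[OF _ syz nonzero]) (rule indep)
    then show "\<exists>\<L>. finite \<L> \<and> (\<forall>L\<in>\<L>. proj_line L) \<and> codim1_singular_locus X = \<Union>\<L>"
    proof (elim disjE exE conjE)
      fix \<gamma> \<delta>
      assume "\<forall>s t u v. u * dot \<gamma> (\<Phi> s t u v) + v * dot \<delta> (\<Phi> s t u v) = 0"
        and no: "\<not> (\<exists>c. \<gamma> = c *s \<alpha> \<and> \<delta> = c *s \<beta>)"
      then have "\<exists>c. \<gamma> = c *s \<alpha> \<and> \<delta> = c *s \<beta>" by (intro scalar)
      with no show "\<exists>\<L>. finite \<L> \<and> (\<forall>L\<in>\<L>. proj_line L) \<and> codim1_singular_locus X = \<Union>\<L>"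
        by contradiction
    qed blast
  qed
qed

end
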